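(* For every $\varepsilon$ with $0<\varepsilon<1$ there exists a constant $\delta=\delta(\varepsilon)$ with $0<\delta<1$ such that for all sufficiently large $c>0$ (how large may depend on $\varepsilon$) we have $$\lambda_n(c)\ \ge\ 1-\delta^c,\qquad \text{where } n=[(1-\varepsilon)c].$$
   Context: Here $[t]$ denotes the integer part of $t$. $L^2(\mathbb{R})$ is the space of complex-valued square-integrable functions. The Fourier transform is $\mathcal{F}(f)(\xi)=\int_{\mathbb{R}} f(x)e^{-2\pi i x\xi}\,dx$, extended to a unitary operator on $L^2(\mathbb{R})$. For a measurable set $\Omega\subset\mathbb{R}$ let $P_\Omega:L^2(\mathbb{R})\to L^2(\mathbb{R})$, $P_\Omega f=f\chi_\Omega$, and $Q_\Omega=\mathcal{F}^{-1}P_\Omega\mathcal{F}$. For measurable sets $T,\Omega\subset\mathbb{R}$ the time-frequency localization operator is $S_{T,\Omega}=P_TQ_\Omega P_T$. When $T,\Omega$ have finite measure it is a compact, self-adjoint, non-negative definite operator on $L^2(\mathbb{R})$. When $T$ and $\Omega$ are bounded intervals of positive length, its positive eigenvalues, listed in non-increasing order with multiplicity as $\lambda_1\ge\lambda_2\ge\dots>0$ (indexing starts at $1$), depend only on the product of lengths $c=|T||\Omega|$; they are denoted $\lambda_1(c),\lambda_2(c),\dots$. For instance one may take $T=\Omega=[-\frac{\sqrt c}{2},\frac{\sqrt c}{2}]$. *)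

theory Defs
  imports "HOL-Analysis.Analysis"
begin

text \<open>
  Elements of \<open>L\<^sup>2(\<real>)\<close> are represented by Borel functions; all notions below
  respect equality almost everywhere, so two functions that agree a.e. stand for the same
  element (every Lebesgue class has a Borel representative).
\<close>

definition L2 :: "(real \<Rightarrow> complex) set" where
  "L2 = {f \<in> borel_measurable lborel. integrable lborel (\<lambda>x. (cmod (f x))\<^sup>2)}"

definition L2_tendsto :: "(nat \<Rightarrow> real \<Rightarrow> complex) \<Rightarrow> (real \<Rightarrow> complex) \<Rightarrow> bool" where
  "L2_tendsto u f \<longleftrightarrow>
     (\<lambda>k. \<integral>\<^sup>+ x. ennreal ((cmod (u k x - f x))\<^sup>2) \<partial>lborel) \<longlonglongrightarrow> 0"

definition fourier_integral :: "(real \<Rightarrow> complex) \<Rightarrow> real \<Rightarrow> complex" where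
  "fourier_integral f \<xi> =
     (LINT x|lborel. f x * exp (- 2 * of_real pi * \<i> * of_real x * of_real \<xi>))"

text \<open>
  The continuous extension of the Fourier integral from \<open>L\<^sup>1 \<inter> L\<^sup>2\<close> to \<open>L\<^sup>2\<close>.
  By Plancherel's theorem the choices below exist and are unique up to null sets.
\<close>

definition is_fourier_L2 :: "(real \<Rightarrow> complex) \<Rightarrow> (real \<Rightarrow> complex) \<Rightarrow> bool" where
  "is_fourier_L2 f g \<longleftrightarrow> f \<in> L2 \<and> g \<in> L2 \<and>
     (\<exists>u. (\<forall>k. u k \<in> L2 \<and> integrable lborel (u k)) \<and>
          L2_tendsto u f \<and> L2_tendsto (\<lambda>k. fourier_integral (u k)) g)"

definition fourier_L2 :: "(real \<Rightarrow> complex) \<Rightarrow> real \<Rightarrow> complex" where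
  "fourier_L2 f = (SOME g. is_fourier_L2 f g)"

definition inv_fourier_L2 :: "(real \<Rightarrow> complex) \<Rightarrow> real \<Rightarrow> complex" where
  "inv_fourier_L2 g = (SOME f. f \<in> L2 \<and> (AE \<xi> in lborel. fourier_L2 f \<xi> = g \<xi>))"

definition P_op :: "real set \<Rightarrow> (real \<Rightarrow> complex) \<Rightarrow> real \<Rightarrow> complex" where
  "P_op \<Omega> f = (\<lambda>x. f x * indicator \<Omega> x)"

definition Q_op :: "real set \<Rightarrow> (real \<Rightarrow> complex) \<Rightarrow> real \<Rightarrow> complex" where
  "Q_op \<Omega> f = inv_fourier_L2 (P_op \<Omega> (fourier_L2 f))"

definition S_op :: "real set \<Rightarrow> real set \<Rightarrow> (real \<Rightarrow> complex) \<Rightarrow> real \<Rightarrow> complex" where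
  "S_op T \<Omega> f = P_op T (Q_op \<Omega> (P_op T f))"

definition eigenspace :: "((real \<Rightarrow> complex) \<Rightarrow> real \<Rightarrow> complex) \<Rightarrow> real \<Rightarrow> (real \<Rightarrow> complex) set" where
  "eigenspace A \<mu> = {f \<in> L2. AE x in lborel. A f x = of_real \<mu> * f x}"

text \<open>
  \<open>has_L2_dim V n\<close>: modulo null functions, \<open>V\<close> has a basis over \<open>\<complex>\<close> of length \<open>n\<close>.
\<close>

definition has_L2_dim :: "(real \<Rightarrow> complex) set \<Rightarrow> nat \<Rightarrow> bool" where
  "has_L2_dim V n \<longleftrightarrow>
     (\<exists>e. (\<forall>i<n. e i \<in> V) \<and>
          (\<forall>a :: nat \<Rightarrow> complex.
             (AE x in lborel. (\<Sum>i<n. a i * e i x) = 0) \<longrightarrow> (\<forall>i<n. a i = 0)) \<and>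
          (\<forall>f\<in>V. \<exists>a :: nat \<Rightarrow> complex. AE x in lborel. f x = (\<Sum>i<n. a i * e i x)))"

text \<open>
  \<open>l 1 \<ge> l 2 \<ge> \<dots> > 0\<close> lists the positive eigenvalues of \<open>A\<close>, each as often as its
  multiplicity; a \<open>\<mu> > 0\<close> that is not an eigenvalue has eigenspace of dimension 0 and does
  not occur. The value \<open>l 0\<close> is irrelevant.
\<close>

definition positive_eigenvalue_listing ::
    "((real \<Rightarrow> complex) \<Rightarrow> real \<Rightarrow> complex) \<Rightarrow> (nat \<Rightarrow> real) \<Rightarrow> bool" where
  "positive_eigenvalue_listing A l \<longleftrightarrow>
     (\<forall>m n. 1 \<le> m \<and> m \<le> n \<longrightarrow> l n \<le> l m) \<and>
     (\<forall>n\<ge>1. l n > 0) \<and>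
     (\<forall>\<mu>>0. finite {n. 1 \<le> n \<and> l n = \<mu>} \<and>
             has_L2_dim (eigenspace A \<mu>) (card {n. 1 \<le> n \<and> l n = \<mu>}))"

definition pos_eigenvalue :: "((real \<Rightarrow> complex) \<Rightarrow> real \<Rightarrow> complex) \<Rightarrow> nat \<Rightarrow> real" where
  "pos_eigenvalue A = (SOME l. positive_eigenvalue_listing A l)"

text \<open>
  \<open>\<lambda>\<^sub>n(c)\<close>. The positive eigenvalues of \<open>S_op T \<Omega>\<close> for bounded intervals \<open>T\<close>, \<open>\<Omega>\<close> depend
  only on the product \<open>c\<close> of their lengths, so the symmetric choice serves as the definition.
\<close>

definition lam :: "nat \<Rightarrow> real \<Rightarrow> real" where
  "lam n c = pos_eigenvalue
     (S_op {- sqrt c / 2 .. sqrt c / 2} {- sqrt c / 2 .. sqrt c / 2}) n"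

end

theory Submission
  imports Defs "HOL-Probability.Probability" "HOL-Complex_Analysis.Great_Picard"
    "HOL-Real_Asymp.Real_Asymp"
begin

text \<open>
  Write \<open>R = sqrt c\<close>, so that \<open>T\<close> and \<open>\<Omega>\<close> are both \<open>[-R/2, R/2]\<close>. By the min-max principle
  \<open>\<lambda>\<^sub>n(c) \<ge> b\<close> as soon as there is an \<open>n\<close>-dimensional space of functions \<open>G\<close> supported in \<open>T\<close>
  whose Fourier transforms carry at least the fraction \<open>b\<close> of their energy inside \<open>\<Omega>\<close>
  (\<open>pos_eigenvalue_ge\<close>). Such a space can be written down. Fix a small \<open>\<eta>\<close>, put \<open>\<rho> = \<eta> R\<close>, and let
  \<open>w\<close> be the indicator of \<open>[-R/2 + \<rho>, R/2 - \<rho>]\<close> convolved with \<open>exp (- pi * x\<^sup>2)\<close>. Take the span of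
  the functions \<open>w(x) exp (2 pi i k x)\<close>, cut off to \<open>T\<close>, where \<open>k\<close> runs over \<open>n\<close> points of step
  \<open>1 / L\<close>, centred at the origin, with \<open>L = (1 - 4 \<eta>) R\<close>.
  \<^item> Cutting off to \<open>T\<close> changes a function of the span by an energy of exponential order \<open>exp (- const * \<rho>\<^sup>2)\<close>,
    because \<open>T\<close> contains the \<open>\<rho>\<close>-neighbourhood of the smoothed interval.
  \<^item> The Fourier transform of \<open>w\<close> is bounded by \<open>R * exp (- pi * \<xi>\<^sup>2)\<close>, so the energy outside \<open>\<Omega>\<close> has
    the same order as long as every \<open>k\<close> satisfies \<open>\<bar>k\<bar> \<le> R/2 - \<rho>\<close>. This leaves room for
    \<open>(1 - 2 \<eta>) (1 - 4 \<eta>) c\<close> frequencies, more than \<open>(1 - \<epsilon>) c\<close> if \<open>\<eta> = \<epsilon> / 6\<close>.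
  \<^item> The coefficients are controlled by the energy of the function: \<open>w\<close> is bounded below by a constant
    on the interval of length \<open>L\<close> around the origin, over which the exponentials are orthogonal.
  Since \<open>\<rho>\<^sup>2 = \<eta>\<^sup>2 c\<close>, the loss is a polynomial in \<open>c\<close> times \<open>exp (- const * c)\<close>, hence at most \<open>\<delta> powr c\<close> for
  large \<open>c\<close> (\<open>test_space_estimate\<close>, \<open>pos_eigenvalue_lower_bound\<close>).

  The operator, its eigenvalues and their listing are all given by choice, so most of the text
  shows that they are what they should be. Plancherel's theorem and the completeness of
  \<open>L\<^sup>2\<close> make the Fourier transform on \<open>L\<^sup>2\<close> a well-defined isometry, and its inverse is computed on
  functions of bounded support; this turns the localization operator into the integral
  operator with kernel \<open>sin (2 pi r (x - y)) / (pi (x - y))\<close> on \<open>[-r, r]\<close>, \<open>r = R/2\<close>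
  (\<open>S_op_eq_band_limit\<close>). Its kernel is real, so its eigenfunctions can be taken real, and eigenfunctions for
  positive eigenvalues are continuous. The spectral theory therefore takes place in the real
  vector space of bounded continuous functions with the inner product of \<open>L\<^sup>2[-r, r]\<close>. This space is
  incomplete; the limits in the construction of eigenvectors by successive maximization of the
  Rayleigh quotient come from the theorem of Arzela and Ascoli, by which the operator maps bounded
  sequences to sequences with convergent subsequences (\<open>maximal_eigenvector\<close>, \<open>eigenvector_sequence\<close>).
\<close>

section \<open>Linear systems and discriminants\<close>

text \<open>
  Gaussian elimination of one unknown reduces \<open>m + 1\<close> equations to \<open>m\<close>. This is the only dimension
  count in the proof: it makes the dimension of an eigenspace unique, and it finds in
  a space of test functions a vector orthogonal to fewer given vectors.
\<close>

lemma underdetermined_system: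
  fixes A :: "nat \<Rightarrow> 'b \<Rightarrow> 'f::field"
  assumes "m < card J"
  shows "\<exists>a. (\<exists>j\<in>J. a j \<noteq> 0) \<and> (\<forall>i<m. (\<Sum>j\<in>J. a j * A i j) = 0)"
  using assms
proof (induction m arbitrary: J A)
  case 0
  then have "J \<noteq> {}" by auto
  then show ?case by (intro exI[of _ "\<lambda>_. 1"]) auto
next
  case (Suc m)
  have fin: "finite J" using Suc.prems by (metis card.infinite less_nat_zero_code)
  show ?case
  proof (cases "\<forall>j\<in>J. A m j = 0")
    case True
    from Suc.IH[of J A] Suc.prems obtain a where
      a: "\<exists>j\<in>J. a j \<noteq> 0" "\<forall>i<m. (\<Sum>j\<in>J. a j * A i j) = 0" by auto
    moreover have "(\<Sum>j\<in>J. a j * A m j) = 0" using True by simp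
    ultimately show ?thesis by (metis less_Suc_eq)
  next
    case False
    then obtain p where p: "p \<in> J" "A m p \<noteq> 0" by auto
    define A' where "A' = (\<lambda>i j. A i j - A i p * A m j / A m p)"
    have "m < card (J - {p})" using Suc.prems p fin by simp
    from Suc.IH[OF this, of A'] obtain a where
      a: "\<exists>j\<in>J-{p}. a j \<noteq> 0" "\<And>i. i < m \<Longrightarrow> (\<Sum>j\<in>J-{p}. a j * A' i j) = 0" by auto
    define s where "s = (\<Sum>j\<in>J-{p}. a j * A m j)"
    define b where "b = a(p := - s / A m p)"
    have sum: "(\<Sum>j\<in>J. b j * A i j) = (\<Sum>j\<in>J-{p}. a j * A' i j)" for i
    proof -
      have "(\<Sum>j\<in>J. b j * A i j) = b p * A i p + (\<Sum>j\<in>J-{p}. a j * A i j)"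
        using fin p by (subst sum.remove[of J p]) (auto simp: b_def intro!: sum.cong)
      also have "b p * A i p = - (\<Sum>j\<in>J-{p}. a j * (A i p * A m j / A m p))"
        by (simp add: b_def s_def sum_distrib_left sum_distrib_right sum_divide_distrib mult_ac)
      finally show ?thesis
        by (simp add: A'_def algebra_simps sum_subtractf)
    qed
    have "(\<Sum>j\<in>J. b j * A i j) = 0" if "i < Suc m" for i
    proof (cases "i = m")
      case True
      have "A' m j = 0" for j using p by (simp add: A'_def)
      then show ?thesis using True by (simp add: sum)
    next
      case False
      then show ?thesis using that a by (simp add: sum)
    qed
    moreover have "\<exists>j\<in>J. b j \<noteq> 0" using a by (auto simp: b_def)
    ultimately show ?thesis by blast
  qed
qed

lemma quadratic_nonneg_imp_discriminant:
  fixes a b c :: real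
  assumes "\<And>t. 0 \<le> a + 2 * b * t + c * t\<^sup>2" "0 \<le> a" "0 \<le> c"
  shows "b\<^sup>2 \<le> a * c"
proof (cases "c = 0")
  case True
  have "b = 0"
  proof (rule ccontr)
    assume "b \<noteq> 0"
    then show False using assms(1)[of "- (a + 1) / (2 * b)"] True by simp
  qed
  then show ?thesis using True by simp
next
  case False
  then have c: "c > 0" using assms by simp
  have "0 \<le> a + 2 * b * (- b / c) + c * (- b / c)\<^sup>2" by (rule assms)
  also have "\<dots> = a - b\<^sup>2 / c" using c by (simp add: field_simps power2_eq_square)
  finally show ?thesis using c by (simp add: field_simps)
qed

section \<open>Compact positive operators on an inner product space\<close>

text \<open>
  \<open>B\<close> is only a semi-inner product, because it will be the inner product over an interval
  of functions on the whole line. Compactness of \<open>T\<close> says that the image of a bounded sequence has a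
  subsequence with a limit in the space itself; all limits below are found in this way. The last assumption, strict positivity on the orthogonal complement of each finite set, makes
  the sequence of positive eigenvalues infinite.
\<close>

locale compact_positive_form =
  fixes B :: "'a::real_vector \<Rightarrow> 'a \<Rightarrow> real" and T :: "'a \<Rightarrow> 'a"
  assumes B_add: "B (x + y) z = B x z + B y z"
    and B_scale: "B (c *\<^sub>R x) z = c * B x z"
    and B_sym: "B x y = B y x"
    and B_nonneg: "0 \<le> B x x"
    and T_lin: "linear T"
    and T_sym: "B (T x) y = B x (T y)"
    and T_pos: "0 \<le> B (T x) x"
    and T_null: "B x x = 0 \<Longrightarrow> T x = 0"
    and T_bdd: "\<exists>C. \<forall>x. B (T x) (T x) \<le> C * B x x"
    and T_compact: "\<And>x :: nat \<Rightarrow> 'a. (\<And>n. B (x n) (x n) \<le> 1) \<Longrightarrow>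
      \<exists>y s. strict_mono s \<and> (\<lambda>n::nat. B (T (x (s n)) - y) (T (x (s n)) - y)) \<longlonglongrightarrow> 0"
    and T_infinite: "finite E \<Longrightarrow> \<exists>x. (\<forall>e\<in>E. B x e = 0) \<and> 0 < B (T x) x"
begin

abbreviation N :: "'a \<Rightarrow> real" where "N x \<equiv> B x x"

lemma B_add_right: "B z (x + y) = B z x + B z y"
  using B_add B_sym by metis
lemma B_scale_right: "B z (c *\<^sub>R x) = c * B z x"
  using B_scale B_sym by metis
lemma B_zero [simp]: "B 0 x = 0" "B x 0 = 0"
  using B_scale[of 0 0] B_scale_right[of _ 0 0] by simp_all
lemma B_minus: "B (- x) z = - B x z" "B z (- x) = - B z x"
  using B_scale[of "-1" x z] B_scale_right[of z "-1" x] by simp_all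
lemma B_diff: "B (x - y) z = B x z - B y z" "B z (x - y) = B z x - B z y"
  using B_add[of x "- y"] B_add_right[of z x "- y"] unfolding diff_conv_add_uminus B_minus by (simp_all only:)
lemma B_sum: "B (sum f I) z = (\<Sum>i\<in>I. B (f i) z)"
  by (induction I rule: infinite_finite_induct) (auto simp: B_add)
lemmas B_simps = B_add B_add_right B_scale B_scale_right B_diff B_minus

lemma T_simps: "T (x + y) = T x + T y" "T (c *\<^sub>R x) = c *\<^sub>R T x" "T (x - y) = T x - T y"
  "T (sum f I) = (\<Sum>i\<in>I. T (f i))"
  using T_lin by (auto simp: linear_add linear_scale linear_diff linear_sum)

lemma B_Cauchy_Schwarz: "(B x y)\<^sup>2 \<le> N x * N y"
proof (rule quadratic_nonneg_imp_discriminant)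
  fix t :: real
  have "0 \<le> N (x + t *\<^sub>R y)" by (rule B_nonneg)
  also have "\<dots> = N x + 2 * B x y * t + N y * t\<^sup>2"
    by (simp add: B_simps B_sym[of y x] power2_eq_square algebra_simps)
  finally show "0 \<le> N x + 2 * B x y * t + N y * t\<^sup>2" .
qed (rule B_nonneg)+

lemma B_add_le: "N (x + y) \<le> 2 * N x + 2 * N y"
proof -
  have "0 \<le> N (x - y)" by (rule B_nonneg)
  then show ?thesis by (simp add: B_simps)
qed

text \<open>
  The supremum \<open>M\<close> of \<open>B (T x) x\<close> over the unit vectors \<open>x\<close> of the invariant subspace \<open>W\<close> is attained. On
  \<open>W\<close> the form of \<open>D = M - T\<close> is nonnegative, so its Cauchy-Schwarz inequality bounds
  \<open>B (D x) (D x)\<close> by \<open>M * B (D x) x\<close>. Along a maximizing sequence \<open>D x\<^sub>n\<close> therefore tends to 0; as \<open>T x\<^sub>n\<close> has a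
  limit \<open>y\<close> along a subsequence, so has \<open>M x\<^sub>n\<close>, and \<open>T y = M y\<close> up to a null vector.
\<close>

lemma maximal_eigenvector:
  assumes fin: "finite E" and eig: "\<And>z. z \<in> E \<Longrightarrow> \<exists>m. T z = m *\<^sub>R z"
  shows "\<exists>e M. M > 0 \<and> N e = 1 \<and> T e = M *\<^sub>R e \<and> (\<forall>z\<in>E. B e z = 0) \<and>
    (\<forall>x. (\<forall>z\<in>E. B x z = 0) \<longrightarrow> B (T x) x \<le> M * N x)"
proof -
  define W where "W = {x. \<forall>z\<in>E. B x z = 0}"
  have W_T: "T x \<in> W" if "x \<in> W" for x
    unfolding W_def
  proof safe
    fix z assume "z \<in> E"
    with eig obtain m where "T z = m *\<^sub>R z" by blast
    then show "B (T x) z = 0" using that \<open>z \<in> E\<close> by (simp add: T_sym B_simps W_def)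
  qed
  have W_lin: "a *\<^sub>R x + b *\<^sub>R y \<in> W" if "x \<in> W" "y \<in> W" for a b x y
    using that by (auto simp: W_def B_simps)
  have W_scale: "a *\<^sub>R x \<in> W" if "x \<in> W" for a x using W_lin[OF that that, of a 0] by simp
  obtain C where C: "\<And>x. N (T x) \<le> C * N x" using T_bdd by blast
  define Q where "Q = (\<lambda>x. B (T x) x) ` {x\<in>W. N x = 1}"
  obtain x0 where x0: "x0 \<in> W" "0 < B (T x0) x0" using T_infinite[OF fin] by (auto simp: W_def)
  have "N x0 \<noteq> 0" using x0 T_null[of x0] by auto
  then have x0p: "N x0 > 0" using B_nonneg[of x0] by simp
  define u0 where "u0 = (1 / sqrt (N x0)) *\<^sub>R x0"
  have u0: "u0 \<in> W" "N u0 = 1" "B (T u0) u0 > 0"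
    using x0 x0p W_scale by (auto simp: u0_def B_simps T_simps field_simps)
  have Qbdd: "bdd_above Q"
  proof (rule bdd_aboveI[of _ "sqrt C"])
    fix q assume "q \<in> Q"
    then obtain x where x: "x \<in> W" "N x = 1" "q = B (T x) x" by (auto simp: Q_def)
    have "q\<^sup>2 \<le> N (T x) * N x" unfolding x(3) by (rule B_Cauchy_Schwarz)
    also have "\<dots> \<le> C" using C[of x] x by simp
    finally show "q \<le> sqrt C" by (rule real_le_rsqrt)
  qed
  have Qne: "B (T u0) u0 \<in> Q" using u0 by (auto simp: Q_def)
  define M where "M = Sup Q"
  have Mpos: "M > 0" using cSup_upper[OF Qne Qbdd] u0 by (simp add: M_def)
  have Mub: "B (T x) x \<le> M * N x" if "x \<in> W" for x
  proof (cases "N x = 0")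
    case True then show ?thesis using T_null[OF True] by simp
  next
    case False
    then have p: "N x > 0" using B_nonneg[of x] by simp
    define u where "u = (1 / sqrt (N x)) *\<^sub>R x"
    have "u \<in> W" "N u = 1" using that p W_scale by (auto simp: u_def B_simps)
    then have "B (T u) u \<in> Q" by (auto simp: Q_def)
    then have "B (T u) u \<le> M" unfolding M_def by (rule cSup_upper[OF _ Qbdd])
    moreover have "B (T u) u = B (T x) x / N x"
      using p by (simp add: u_def B_simps T_simps field_simps)
    ultimately show ?thesis using p by (simp add: field_simps)
  qed
  have "\<exists>x. x \<in> W \<and> N x = 1 \<and> B (T x) x > M - 1 / Suc n" for n
  proof -
    have "\<exists>q\<in>Q. M - 1 / Suc n < q"
      using Qne Qbdd by (intro less_cSupD) (auto simp: M_def)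
    then show ?thesis by (auto simp: Q_def)
  qed
  then obtain x where x: "\<And>n. x n \<in> W" "\<And>n. N (x n) = 1"
    "\<And>n. B (T (x n)) (x n) > M - 1 / Suc n" by metis
  obtain y s where s: "strict_mono s"
    and y: "(\<lambda>n::nat. N (T (x (s n)) - y)) \<longlonglongrightarrow> 0"
    using T_compact[of x] x(2) by auto
  define D where "D = (\<lambda>x. M *\<^sub>R x - T x)"
  have D_bound: "N (D v) \<le> M * (M * N v - B (T v) v)" if v: "v \<in> W" for v
  proof -
    have Dv: "D v \<in> W" using W_lin[OF v W_T[OF v], of M "-1"] by (simp add: D_def)
    have D_exp: "B (D p) q = M * B p q - B (T p) q" for p q
      by (simp add: D_def B_simps)
    have D_sym: "B (D p) q = B (D q) p" for p q
      using D_exp[of p q] D_exp[of q p] T_sym[of p q] B_sym[of p "T q"] B_sym[of p q] by metis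
    have D_nn: "0 \<le> B (D p) p" if "p \<in> W" for p
      using Mub[OF that] by (simp add: D_def B_simps)
    have "(N (D v))\<^sup>2 \<le> B (D v) v * B (D (D v)) (D v)"
    proof (rule quadratic_nonneg_imp_discriminant)
      fix t :: real
      have "0 \<le> B (D (v + t *\<^sub>R D v)) (v + t *\<^sub>R D v)"
        using W_lin[OF v Dv, of 1 t] by (intro D_nn) simp
      also have "D (v + t *\<^sub>R D v) = D v + t *\<^sub>R D (D v)"
        by (simp add: D_def T_simps algebra_simps)
      also have "B (D v + t *\<^sub>R D (D v)) (v + t *\<^sub>R D v) =
          B (D v) v + 2 * N (D v) * t + B (D (D v)) (D v) * t\<^sup>2"
        by (simp add: B_simps D_sym[of "D v" v] power2_eq_square algebra_simps)
      finally show "0 \<le> B (D v) v + 2 * N (D v) * t + B (D (D v)) (D v) * t\<^sup>2" .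
    qed (use D_nn v Dv in auto)
    also have "B (D (D v)) (D v) \<le> M * N (D v)"
      using T_pos[of "D v"] D_exp[of "D v" "D v"] by linarith
    then have "B (D v) v * B (D (D v)) (D v) \<le> B (D v) v * (M * N (D v))"
      using D_nn[OF v] by (rule mult_left_mono)
    finally have *: "N (D v) * N (D v) \<le> (M * B (D v) v) * N (D v)"
      by (simp add: power2_eq_square mult_ac)
    have "N (D v) \<le> M * B (D v) v"
    proof (cases "N (D v) = 0")
      case True then show ?thesis using D_nn[OF v] Mpos by simp
    next
      case False
      then have "N (D v) > 0" using B_nonneg[of "D v"] by simp
      with * show ?thesis by simp
    qed
    then show ?thesis by (simp add: D_def B_simps)
  qed
  have Dlim: "(\<lambda>n. N (D (x n))) \<longlonglongrightarrow> 0"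
  proof (rule tendsto_sandwich[OF _ _ tendsto_const])
    show "\<forall>\<^sub>F n in sequentially. 0 \<le> N (D (x n))" by (simp add: B_nonneg)
    show "\<forall>\<^sub>F n in sequentially. N (D (x n)) \<le> M * (1 / Suc n)"
    proof (intro always_eventually allI)
      fix n
      have "N (D (x n)) \<le> M * (M * N (x n) - B (T (x n)) (x n))"
        by (rule D_bound[OF x(1)])
      also have "\<dots> \<le> M * (1 / Suc n)"
        using x(2)[of n] x(3)[of n] Mpos by (intro mult_left_mono) auto
      finally show "N (D (x n)) \<le> M * (1 / Suc n)" .
    qed
    show "(\<lambda>n. M * (1 / Suc n)) \<longlonglongrightarrow> 0"
      using tendsto_mult_right_zero[OF LIMSEQ_inverse_real_of_nat, of M] by (simp add: field_simps)
  qed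
  define p where "p = (\<lambda>n. M *\<^sub>R x (s n) - y)"
  have plim: "(\<lambda>n. N (p n)) \<longlonglongrightarrow> 0"
  proof (rule tendsto_sandwich[OF _ _ tendsto_const])
    show "\<forall>\<^sub>F n in sequentially. 0 \<le> N (p n)" by (simp add: B_nonneg)
    show "\<forall>\<^sub>F n in sequentially. N (p n) \<le>
      2 * N (D (x (s n))) + 2 * N (T (x (s n)) - y)"
      using B_add_le[of "D (x (s n))" "T (x (s n)) - y" for n]
      by (intro always_eventually allI) (simp add: p_def D_def)
    show "(\<lambda>n. 2 * N (D (x (s n))) + 2 * N (T (x (s n)) - y)) \<longlonglongrightarrow> 0"
      using tendsto_add[OF tendsto_mult_right_zero[OF LIMSEQ_subseq_LIMSEQ[OF Dlim s, unfolded o_def], of 2]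
        tendsto_mult_right_zero[OF y, of 2]] by simp
  qed
  have My: "N (M *\<^sub>R y - T y) = 0"
  proof -
    have le: "N (M *\<^sub>R y - T y) \<le>
        2 * (M\<^sup>2 * N (T (x (s n)) - y)) + 2 * (C * N (p n))" for n
    proof -
      have "M *\<^sub>R y - T y = (- M) *\<^sub>R (T (x (s n)) - y) + T (p n)"
        by (simp add: p_def T_simps algebra_simps)
      then have "N (M *\<^sub>R y - T y) \<le>
        2 * N ((- M) *\<^sub>R (T (x (s n)) - y)) + 2 * N (T (p n))"
        using B_add_le by metis
      also have "N ((- M) *\<^sub>R (T (x (s n)) - y))
          = M\<^sup>2 * N (T (x (s n)) - y)"
        by (simp only: B_scale B_scale_right power2_eq_square)
      finally show ?thesis using C[of "p n"] by linarith
    qed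
    have "(\<lambda>n. 2 * (M\<^sup>2 * N (T (x (s n)) - y)) + 2 * (C * N (p n))) \<longlonglongrightarrow> 2 * (M\<^sup>2 * 0) + 2 * (C * 0)"
      by (intro tendsto_intros y plim)
    then have "N (M *\<^sub>R y - T y) \<le> 0"
      using le by (intro LIMSEQ_le_const) auto
    then show ?thesis using B_nonneg by (metis order_antisym)
  qed
  have yW: "y \<in> W"
    unfolding W_def
  proof safe
    fix z assume z: "z \<in> E"
    have le: "(B y z)\<^sup>2 \<le> N (p n) * N z" for n
    proof -
      have "B (p n) z = - B y z" using x(1)[of "s n"] z by (simp add: p_def B_simps W_def)
      then show ?thesis using B_Cauchy_Schwarz[of "p n" z] by simp
    qed
    have "(\<lambda>n. N (p n) * N z) \<longlonglongrightarrow> 0 * N z" by (intro tendsto_intros plim)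
    then have "(B y z)\<^sup>2 \<le> 0" using le by (intro LIMSEQ_le_const) auto
    then show "B y z = 0" by simp
  qed
  have ypos: "N y > 0"
  proof -
    have le: "M\<^sup>2 - 2 * N y \<le> 2 * N (p n)" for n
    proof -
      have "N (M *\<^sub>R x (s n)) \<le> 2 * N (p n) + 2 * N y"
        using B_add_le[of "p n" y] by (simp add: p_def)
      then show ?thesis using x(2) by (simp add: B_simps power2_eq_square)
    qed
    have "(\<lambda>n. 2 * N (p n)) \<longlonglongrightarrow> 2 * 0" by (intro tendsto_intros plim)
    then have "M\<^sup>2 - 2 * N y \<le> 2 * 0" by (rule LIMSEQ_le_const) (use le in blast)
    moreover have "M\<^sup>2 > 0" using Mpos by simp
    ultimately show ?thesis by linarith
  qed
  \<comment> \<open>\<open>y\<close> itself satisfies the eigenvalue equation only up to a null vector, which \<open>T\<close> kills.\<close>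
  define e where "e = T y"
  have Te: "T e = M *\<^sub>R e" using T_null[OF My] by (simp add: T_simps e_def)
  have epos: "N e > 0"
  proof -
    have "N (M *\<^sub>R y) \<le> 2 * N (M *\<^sub>R y - T y) + 2 * N e"
      using B_add_le[of "M *\<^sub>R y - T y" e] by (simp add: e_def)
    moreover have "N (M *\<^sub>R y) > 0" using ypos Mpos by (simp add: B_simps)
    ultimately show ?thesis using My by linarith
  qed
  have eW: "e \<in> W" using W_T[OF yW] by (simp add: e_def)
  define e1 where "e1 = (1 / sqrt (N e)) *\<^sub>R e"
  have "N e1 = 1" "T e1 = M *\<^sub>R e1" "e1 \<in> W"
    using epos Te W_scale[OF eW] by (auto simp: e1_def B_simps T_simps field_simps)
  then show ?thesis
    using Mpos Mub by (intro exI[of _ e1] exI[of _ M]) (auto simp: W_def)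
qed

text \<open>
  The maximum principle is applied again and again on the orthogonal complement of the eigenvectors
  found so far. The eigenvalues tend to 0 because \<open>T\<close> maps distinct \<open>e i\<close>, \<open>e j\<close> to vectors at squared distance
  \<open>(l i)\<^sup>2 + (l j)\<^sup>2\<close>, which would rule out convergent subsequences if the eigenvalues stayed away from 0.
\<close>

theorem eigenvector_sequence:
  "\<exists>e l. (\<forall>k. T (e k) = l k *\<^sub>R e k \<and> l k > 0 \<and> N (e k) = 1) \<and>
     (\<forall>i j. i \<noteq> j \<longrightarrow> B (e i) (e j) = 0) \<and> decseq l \<and> l \<longlonglongrightarrow> 0 \<and>
     (\<forall>(k::nat) x. (\<forall>i<k. B x (e i) = 0) \<longrightarrow> B (T x) x \<le> l k * N x)"
proof -
  define P where "P = (\<lambda>(f :: nat \<Rightarrow> 'a \<times> real) (k::nat) (r :: 'a \<times> real).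
     T (fst r) = snd r *\<^sub>R fst r \<and> snd r > 0 \<and> N (fst r) = 1 \<and>
     (\<forall>i<k. B (fst r) (fst (f i)) = 0) \<and>
     (\<forall>x. (\<forall>i<k. B x (fst (f i)) = 0) \<longrightarrow> B (T x) x \<le> snd r * N x))"
  have "\<exists>f. \<forall>k. P f k (f k)"
  proof (rule dependent_wellorder_choice)
    fix r :: "'a \<times> real" and f g :: "nat \<Rightarrow> 'a \<times> real" and k :: nat
    assume "\<And>i. i < k \<Longrightarrow> f i = g i"
    then show "P f k r = P g k r" by (simp add: P_def)
  next
    fix k :: nat and f :: "nat \<Rightarrow> 'a \<times> real"
    assume *: "\<And>i. i < k \<Longrightarrow> P f i (f i)"
    have "\<exists>e M. M > 0 \<and> N e = 1 \<and> T e = M *\<^sub>R e \<and> (\<forall>z\<in>(\<lambda>i. fst (f i)) ` {..<k}. B e z = 0) \<and>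
      (\<forall>x. (\<forall>z\<in>(\<lambda>i. fst (f i)) ` {..<k}. B x z = 0) \<longrightarrow> B (T x) x \<le> M * N x)"
      using * by (intro maximal_eigenvector) (auto simp: P_def)
    then obtain e M where "M > 0" "N e = 1" "T e = M *\<^sub>R e" "\<forall>i<k. B e (fst (f i)) = 0"
      "\<forall>x. (\<forall>i<k. B x (fst (f i)) = 0) \<longrightarrow> B (T x) x \<le> M * N x" by auto
    then show "\<exists>r. P f k r" by (intro exI[of _ "(e, M)"]) (simp add: P_def)
  qed
  then obtain f where f: "\<And>k. P f k (f k)" by blast
  define e where "e = (\<lambda>k. fst (f k))"
  define l where "l = (\<lambda>k. snd (f k))"
  have Te: "T (e k) = l k *\<^sub>R e k" and lpos: "l k > 0" and e1: "N (e k) = 1" for k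
    using f[of k] by (auto simp: P_def e_def l_def)
  have max: "B (T x) x \<le> l k * N x" if "\<And>i. i < k \<Longrightarrow> B x (e i) = 0" for x k
    using f[of k] that by (auto simp: P_def e_def l_def)
  have orth0: "B (e k) (e i) = 0" if "i < k" for i k
    using f[of k] that by (auto simp: P_def e_def l_def)
  have orth: "B (e i) (e j) = 0" if "i \<noteq> j" for i j
    using orth0[of i j] orth0[of j i] that B_sym[of "e i" "e j"] by (metis nat_neq_iff)
  have dec: "decseq l"
  proof (rule decseq_SucI)
    fix k
    have "B (T (e (Suc k))) (e (Suc k)) \<le> l k * N (e (Suc k))"
      by (rule max) (simp add: orth0)
    then show "l (Suc k) \<le> l k" by (simp add: Te B_simps e1)
  qed
  have "l \<longlonglongrightarrow> 0"
  proof (rule ccontr)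
    assume n0: "\<not> l \<longlonglongrightarrow> 0"
    have "\<exists>d>0. \<forall>k. d \<le> l k"
    proof (rule ccontr)
      assume "\<not> ?thesis"
      then have *: "\<And>d. d > 0 \<Longrightarrow> \<exists>k. l k < d" by (meson not_le)
      have "l \<longlonglongrightarrow> 0"
      proof (rule LIMSEQ_I)
        fix r :: real assume "0 < r"
        with * obtain k where "l k < r" by blast
        then have "\<forall>n\<ge>k. norm (l n - 0) < r"
          using dec lpos by (metis abs_of_pos decseqD diff_zero order_le_less_trans real_norm_def)
        then show "\<exists>no. \<forall>n\<ge>no. norm (l n - 0) < r" by blast
      qed
      with n0 show False by simp
    qed
    then obtain d where d: "d > 0" "\<And>k. d \<le> l k" by blast
    obtain y s where s: "strict_mono s"
      and y: "(\<lambda>n::nat. N (T (e (s n)) - y)) \<longlonglongrightarrow> 0"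
      using T_compact[of e] e1 by auto
    have le: "2 * d\<^sup>2 \<le> 2 * N (T (e (s n)) - y)
        + 2 * N (T (e (s (Suc n))) - y)" for n
    proof -
      have ne: "s n \<noteq> s (Suc n)" using s by (simp add: strict_mono_eq)
      have sq: "d\<^sup>2 \<le> (l k)\<^sup>2" for k using d by (intro power_mono) auto
      have "2 * d\<^sup>2 \<le> (l (s n))\<^sup>2 + (l (s (Suc n)))\<^sup>2"
        using sq[of "s n"] sq[of "s (Suc n)"] by simp
      also have "\<dots> = N (T (e (s n)) - T (e (s (Suc n))))"
        using orth[OF ne] orth[OF ne[symmetric]] by (simp add: Te B_simps e1 power2_eq_square)
      also have "T (e (s n)) - T (e (s (Suc n))) = (T (e (s n)) - y) + - (T (e (s (Suc n))) - y)"
        by simp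
      also have "N \<dots> \<le> 2 * N (T (e (s n)) - y)
        + 2 * N (- (T (e (s (Suc n))) - y))" by (rule B_add_le)
      finally show ?thesis by (simp only: B_minus minus_minus)
    qed
    have "(\<lambda>n. 2 * N (T (e (s n)) - y)
        + 2 * N (T (e (s (Suc n))) - y)) \<longlonglongrightarrow> 2 * 0 + 2 * 0"
      by (intro tendsto_intros y LIMSEQ_Suc[OF y])
    then have "2 * d\<^sup>2 \<le> 2 * 0 + 2 * 0" using le by (intro LIMSEQ_le_const) auto
    then show False using d by simp
  qed
  then show ?thesis using Te lpos e1 orth dec max by (intro exI[of _ e] exI[of _ l]) auto
qed

text \<open>
  The part \<open>g\<close> of \<open>f\<close> that remains is orthogonal to every \<open>e k\<close>, so its Rayleigh quotient
  \<open>\<mu>\<close> would be at most each \<open>l k\<close>, and these tend to 0.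
\<close>

lemma eigenvector_in_span:
  assumes e: "\<And>k. T (e k) = l k *\<^sub>R e k" "\<And>k. N (e k) = 1"
    and orth: "\<And>i j. i \<noteq> j \<Longrightarrow> B (e i) (e j) = 0"
    and lim: "l \<longlonglongrightarrow> (0::real)"
    and max: "\<And>(k::nat) x. (\<And>i. i < k \<Longrightarrow> B x (e i) = 0) \<Longrightarrow> B (T x) x \<le> l k * N x"
    and f: "T f = \<mu> *\<^sub>R f" and mu: "\<mu> > 0"
  defines "g \<equiv> f - (\<Sum>k | l k = \<mu>. B f (e k) *\<^sub>R e k)"
  shows "finite {k. l k = \<mu>}" "N g = 0"
proof -
  have "\<forall>\<^sub>F k in sequentially. l k < \<mu>" using lim mu by (simp add: order_tendsto_iff)
  then obtain n where "\<And>k. k \<ge> n \<Longrightarrow> l k < \<mu>" by (auto simp: eventually_sequentially)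
  then have "{k. l k = \<mu>} \<subseteq> {..<n}" by (metis (mono_tags, lifting) lessThan_iff linorder_not_le mem_Collect_eq order_less_irrefl subsetI)
  then show fin: "finite {k. l k = \<mu>}" by (rule finite_subset) simp
  have Tg: "T g = \<mu> *\<^sub>R g"
    by (simp add: g_def T_simps f e scaleR_sum_right scaleR_diff_right mult.commute)
  have orth_g: "B g (e i) = 0" for i
  proof (cases "l i = \<mu>")
    case True
    have "(\<Sum>k | l k = \<mu>. B f (e k) * B (e k) (e i)) = (\<Sum>k | l k = \<mu>. if k = i then B f (e i) else 0)"
      by (intro sum.cong) (auto simp: e orth)
    also have "\<dots> = B f (e i)" using fin True by simp
    finally show ?thesis by (simp add: g_def B_simps B_sum)
  next
    case False
    have "\<mu> * B g (e i) = B (T g) (e i)" by (simp add: Tg B_simps)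
    also have "\<dots> = l i * B g (e i)" by (simp add: T_sym e B_simps)
    finally show ?thesis using False by simp
  qed
  have "\<mu> * N g \<le> l k * N g" for k
    using max[of k g] orth_g by (simp add: Tg B_simps)
  moreover have "(\<lambda>k. l k * N g) \<longlonglongrightarrow> 0 * N g" by (intro tendsto_intros lim)
  ultimately have "\<mu> * N g \<le> 0 * N g" by (intro LIMSEQ_le_const) auto
  then show "N g = 0" using mu B_nonneg[of g] by (simp add: mult_le_0_iff order_antisym)
qed

end

notation fourier_integral ("\<F>")

section \<open>The Fourier integral of integrable functions\<close>

lemma measurable_cis [measurable (raw)]:
  "f \<in> borel_measurable M \<Longrightarrow> (\<lambda>x. cis (f x)) \<in> borel_measurable M"
  unfolding cis_conv_exp by measurable

lemma measurable_cnj [measurable (raw)]: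
  "f \<in> borel_measurable M \<Longrightarrow> (\<lambda>x. cnj (f x)) \<in> borel_measurable M"
  by (rule borel_measurable_continuous_on[where f=cnj]) (auto intro: continuous_intros)

lemma fourier_integral_cis:
  "\<F> f \<xi> = (LBINT x. f x * cis (- 2 * pi * x * \<xi>))"
  unfolding fourier_integral_def by (simp add: cis_conv_exp mult_ac)

lemma measurable_fourier_integral [measurable (raw)]:
  assumes [measurable]: "f \<in> borel_measurable lborel" "h \<in> borel_measurable M"
  shows "(\<lambda>x. \<F> f (h x)) \<in> borel_measurable M"
  unfolding fourier_integral_cis by measurable

lemma integrable_mult_bounded:
  fixes f g :: "real \<Rightarrow> complex"
  assumes f: "integrable lborel f" and g [measurable]: "g \<in> borel_measurable lborel"
    and "\<And>x. cmod (g x) \<le> C"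
  shows "integrable lborel (\<lambda>x. f x * g x)"
proof (rule Bochner_Integration.integrable_bound)
  show "integrable lborel (\<lambda>x. C * cmod (f x))" using f by simp
  show "(\<lambda>x. f x * g x) \<in> borel_measurable lborel" using f by measurable
  have C: "0 \<le> C" using assms(3)[of 0] norm_ge_zero order_trans by blast
  show "AE x in lborel. norm (f x * g x) \<le> norm (C * cmod (f x))"
    using mult_left_mono[OF assms(3) norm_ge_zero] C
    by (intro AE_I2) (simp add: norm_mult mult.commute)
qed

lemma integrable_mult_cis:
  assumes "integrable lborel f" shows "integrable lborel (\<lambda>x. f x * cis (- 2 * pi * x * \<xi>))"
  using assms by (auto intro!: integrable_mult_bounded[where C=1])

lemma norm_fourier_integral_le:
  "cmod (\<F> f \<xi>) \<le> (LBINT x. cmod (f x))"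
  unfolding fourier_integral_cis
  by (rule order_trans[OF integral_norm_bound]) (simp add: norm_mult)

lemma fourier_integral_diff:
  assumes "integrable lborel f" "integrable lborel g"
  shows "\<F> (\<lambda>x. f x - g x) \<xi> = \<F> f \<xi> - \<F> g \<xi>"
  unfolding fourier_integral_cis using
    Bochner_Integration.integral_diff[OF assms[THEN integrable_mult_cis], of \<xi> \<xi>]
  by (simp add: left_diff_distrib)

lemma fourier_integral_diff_fun:
  assumes "integrable lborel f" "integrable lborel g"
  shows "\<F> (\<lambda>x. f x - g x) = (\<lambda>\<xi>. \<F> f \<xi> - \<F> g \<xi>)"
  using fourier_integral_diff[OF assms] by (rule ext)

lemma integrable_product_lborel:
  fixes u v :: "real \<Rightarrow> complex"
  assumes u: "integrable lborel u" and v: "integrable lborel v"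
    and c [measurable]: "(\<lambda>p. c (fst p) (snd p)) \<in> borel_measurable (lborel \<Otimes>\<^sub>M lborel)"
    and c_le: "\<And>x y. cmod (c x y) \<le> 1"
  shows "integrable (lborel \<Otimes>\<^sub>M lborel) (\<lambda>(x, y). u x * v y * c x y)"
proof -
  have [measurable]: "u \<in> borel_measurable lborel" "v \<in> borel_measurable lborel" using u v by auto
  have "integrable (lborel \<Otimes>\<^sub>M lborel) (\<lambda>(x, y). u x * v y)"
  proof (rule lborel_pair.Fubini_integrable)
    show "(\<lambda>(x, y). u x * v y) \<in> borel_measurable (lborel \<Otimes>\<^sub>M lborel)" by measurable
    show "integrable lborel (\<lambda>x. LBINT y. norm (case (x, y) of (x, y) \<Rightarrow> u x * v y))"
      using u by (simp add: norm_mult)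
    show "AE x in lborel. integrable lborel (\<lambda>y. case (x, y) of (x, y) \<Rightarrow> u x * v y)"
      using v by simp
  qed
  then show ?thesis
  proof (rule Bochner_Integration.integrable_bound)
    show "(\<lambda>(x, y). u x * v y * c x y) \<in> borel_measurable (lborel \<Otimes>\<^sub>M lborel)"
      using c by (simp add: case_prod_beta) 
    show "AE p in lborel \<Otimes>\<^sub>M lborel. norm (case p of (x, y) \<Rightarrow> u x * v y * c x y)
        \<le> norm (case p of (x, y) \<Rightarrow> u x * v y)"
      using c_le by (auto simp: norm_mult mult_left_le)
  qed
qed

text \<open>
  The multiplication formula, Fubini's theorem in disguise, carries all
  computations with Fourier integrals below.
\<close>

lemma fourier_integral_multiplication:
  assumes u: "integrable lborel u" and v: "integrable lborel v"
  shows "(LBINT \<xi>. \<F> u \<xi> * v \<xi>) = (LBINT x. u x * \<F> v x)"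
proof -
  have I: "integrable (lborel \<Otimes>\<^sub>M lborel) (\<lambda>(x, \<xi>). u x * v \<xi> * cis (- 2 * pi * x * \<xi>))"
    by (rule integrable_product_lborel[OF u v]) simp_all
  have "(LBINT \<xi>. \<F> u \<xi> * v \<xi>)
      = (LBINT \<xi>. LBINT x. u x * v \<xi> * cis (- 2 * pi * x * \<xi>))"
    unfolding fourier_integral_cis integral_mult_left_zero[symmetric]
    by (simp add: mult_ac)
  also have "\<dots> = (LBINT x. LBINT \<xi>. u x * v \<xi> * cis (- 2 * pi * x * \<xi>))"
    by (rule lborel_pair.Fubini_integral[OF I])
  also have "\<dots> = (LBINT x. u x * \<F> v x)"
    unfolding fourier_integral_cis integral_mult_right_zero[symmetric]
    by (simp add: mult_ac)
  finally show ?thesis .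
qed

text \<open>
  A rescaling of the characteristic function of the standard normal distribution.
\<close>

lemma gaussian_fourier:
  assumes t: "t > 0"
  shows "integrable lborel (\<lambda>x. exp (- pi * (t * x)\<^sup>2))"
    and "integrable lborel (\<lambda>x. complex_of_real (exp (- pi * (t * x)\<^sup>2)))"
    and "\<F> (\<lambda>x. of_real (exp (- pi * (t * x)\<^sup>2))) \<xi> = of_real (exp (- pi * (\<xi> / t)\<^sup>2) / t)"
proof -
  define s where "s = sqrt (2 * pi) * t"
  have s: "s > 0" using t by (simp add: s_def)
  have s2: "s\<^sup>2 = 2 * pi * t\<^sup>2" by (simp add: s_def power_mult_distrib)
  have nd: "std_normal_density (0 + s * x) = exp (- pi * (t * x)\<^sup>2) / sqrt (2 * pi)" for x
    by (simp add: std_normal_density_def power_mult_distrib s2 field_simps)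
  have i0: "integrable lborel std_normal_density" using integrable_std_normal_moment[of 0] by simp
  have "integrable lborel (\<lambda>x. std_normal_density (0 + s * x))"
    by (rule lborel_integrable_real_affine[OF i0]) (use s in simp)
  then have "integrable lborel (\<lambda>x. std_normal_density (0 + s * x) * sqrt (2 * pi))"
    by simp
  then show 1: "integrable lborel (\<lambda>x. exp (- pi * (t * x)\<^sup>2))"
    unfolding nd by simp
  then show "integrable lborel (\<lambda>x. complex_of_real (exp (- pi * (t * x)\<^sup>2)))"
    by (rule integrable_of_real)
  define r where "r = - (2 * pi * \<xi> / s)"
  have "complex_of_real (exp (- (r\<^sup>2) / 2)) = char std_normal_distribution r"
    by (simp add: char_std_normal_distribution)
  also have "\<dots> = (LBINT x. std_normal_density x *\<^sub>R iexp (r * x))"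
    unfolding char_def by (subst integral_density) (auto simp: normal_density_nonneg)
  also have "\<dots> = \<bar>s\<bar> *\<^sub>R (LBINT x. std_normal_density (0 + s * x) *\<^sub>R iexp (r * (0 + s * x)))"
    by (rule lborel_integral_real_affine) (use s in simp)
  also have "(\<lambda>x. std_normal_density (0 + s * x) *\<^sub>R iexp (r * (0 + s * x)))
      = (\<lambda>x. (of_real (exp (- pi * (t * x)\<^sup>2)) * cis (- 2 * pi * x * \<xi>)) / of_real (sqrt (2 * pi)))"
    unfolding nd using s by (auto simp: fun_eq_iff r_def scaleR_conv_of_real cis_conv_exp field_simps)
  also have "\<bar>s\<bar> *\<^sub>R (LBINT x. (of_real (exp (- pi * (t * x)\<^sup>2)) * cis (- 2 * pi * x * \<xi>)) / of_real (sqrt (2 * pi)))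
     = of_real t * \<F> (\<lambda>x. of_real (exp (- pi * (t * x)\<^sup>2))) \<xi>"
    unfolding fourier_integral_cis using t by (simp add: s_def scaleR_conv_of_real)
  also have "- r\<^sup>2 / 2 = - pi * (\<xi> / t)\<^sup>2"
    unfolding r_def power2_minus power_divide s2 using t
    by (simp add: power_mult_distrib power2_eq_square field_simps)
  finally show "\<F> (\<lambda>x. of_real (exp (- pi * (t * x)\<^sup>2))) \<xi> = of_real (exp (- pi * (\<xi> / t)\<^sup>2) / t)"
    using t by (simp add: field_simps)
qed

lemma integral_gaussian:
  assumes t: "t > 0"
  shows "(LBINT x. exp (- pi * (t * x)\<^sup>2)) = 1 / t"
proof -
  have "complex_of_real (LBINT x. exp (- pi * (t * x)\<^sup>2))
      = \<F> (\<lambda>x. of_real (exp (- pi * (t * x)\<^sup>2))) 0"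
    unfolding fourier_integral_cis by (simp flip: integral_complex_of_real)
  also have "\<dots> = of_real (1 / t)" by (subst gaussian_fourier(3)[OF t]) simp
  finally show ?thesis by (simp only: of_real_eq_iff)
qed

section \<open>Plancherel's theorem for continuous functions\<close>

lemma cnj_fourier_integral_cis:
  "cnj (\<F> g \<xi>) * cis (- 2 * pi * \<xi> * x)
     = \<F> (\<lambda>y. cnj (g (x - y))) \<xi>"
proof -
  have "cnj (\<F> g \<xi>) * cis (- 2 * pi * \<xi> * x)
      = (LBINT z. cnj (g z) * cis (2 * pi * z * \<xi>) * cis (- 2 * pi * \<xi> * x))"
    unfolding fourier_integral_cis Bochner_Integration.integral_cnj[symmetric]
      integral_mult_left_zero[symmetric] by (simp add: cis_cnj)
  also have "\<dots> = \<bar>- 1\<bar> *\<^sub>R (LBINT y. cnj (g (x + (- 1) * y)) * cis (2 * pi * (x + (- 1) * y) * \<xi>) * cis (- 2 * pi * \<xi> * x))"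
    by (rule lborel_integral_real_affine) simp
  also have "\<dots> = \<F> (\<lambda>y. cnj (g (x - y))) \<xi>"
    unfolding fourier_integral_cis by (simp add: mult.assoc cis_mult algebra_simps)
  finally show ?thesis .
qed

text \<open>
  The right-hand side pairs \<open>g\<close> with its convolution by a Gaussian of width \<open>t\<close>.
  The weight makes the left-hand side integrable before anything is known about the
  Fourier integral of \<open>g\<close> being square integrable.
\<close>

lemma gaussian_weighted_energy:
  assumes g: "integrable lborel g" and t: "t > 0"
  shows "(LBINT \<xi>. of_real (exp (- pi * (t * \<xi>)\<^sup>2) * (cmod (\<F> g \<xi>))\<^sup>2))
       = (LBINT x. g x * (LBINT s. cnj (g (x - t * s)) * of_real (exp (- pi * s\<^sup>2))))"
proof -
  define G where "G = (\<lambda>\<xi>. complex_of_real (exp (- pi * (t * \<xi>)\<^sup>2)))"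
  define v where "v = (\<lambda>\<xi>. cnj (\<F> g \<xi>) * G \<xi>)"
  have G: "integrable lborel G" unfolding G_def by (rule gaussian_fourier(2)[OF t])
  have [measurable]: "g \<in> borel_measurable lborel" using g by auto
  have v: "integrable lborel v"
    unfolding v_def mult.commute[of _ "G _"]
    by (rule integrable_mult_bounded[OF G]) (auto intro: norm_fourier_integral_le)
  have Fv: "\<F> v x = (LBINT s. cnj (g (x - t * s)) * of_real (exp (- pi * s\<^sup>2)))" for x
  proof -
    have gi: "integrable lborel (\<lambda>y. cnj (g (x - y)))"
      using lborel_integrable_real_affine[OF g, of "-1" x] by simp
    have "\<F> v x = (LBINT \<xi>. \<F> (\<lambda>y. cnj (g (x - y))) \<xi> * G \<xi>)"
      unfolding cnj_fourier_integral_cis[symmetric] unfolding fourier_integral_cis[of v] unfolding v_def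
      by (simp add: mult_ac)
    also have "\<dots> = (LBINT y. cnj (g (x - y)) * \<F> G y)"
      by (rule fourier_integral_multiplication[OF gi G])
    also have "\<dots> = (LBINT y. cnj (g (x - y)) * of_real (exp (- pi * (y / t)\<^sup>2) / t))"
      unfolding G_def by (subst gaussian_fourier(3)[OF t]) simp
    also have "\<dots> = \<bar>t\<bar> *\<^sub>R (LBINT s. cnj (g (x - (0 + t * s))) * of_real (exp (- pi * ((0 + t * s) / t)\<^sup>2) / t))"
      by (rule lborel_integral_real_affine) (use t in simp)
    also have "\<dots> = (LBINT s. cnj (g (x - t * s)) * of_real (exp (- pi * s\<^sup>2)))"
      using t by (simp add: scaleR_conv_of_real)
    finally show ?thesis .
  qed
  have "(LBINT \<xi>. of_real (exp (- pi * (t * \<xi>)\<^sup>2) * (cmod (\<F> g \<xi>))\<^sup>2))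
     = (LBINT \<xi>. \<F> g \<xi> * v \<xi>)"
    by (intro Bochner_Integration.integral_cong refl)
       (simp only: v_def G_def of_real_mult complex_norm_square of_real_power[symmetric] mult_ac)
  also have "\<dots> = (LBINT x. g x * \<F> v x)"
    by (rule fourier_integral_multiplication[OF g v])
  finally show ?thesis by (simp add: Fv)
qed

text \<open>
  Let \<open>t\<close> tend to 0 in \<open>gaussian_weighted_energy\<close>: the left-hand side increases to the energy of the
  Fourier integral, and on the right the convolution of the continuous function
  \<open>g\<close> with narrow Gaussians tends to \<open>g\<close> pointwise.
\<close>

lemma Plancherel_continuous:
  assumes g: "integrable lborel g" and cont: "continuous_on UNIV g"
    and bound: "\<And>x. cmod (g x) \<le> M"
  shows "(\<integral>\<^sup>+ \<xi>. ennreal ((cmod (\<F> g \<xi>))\<^sup>2) \<partial>lborel)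
       = (\<integral>\<^sup>+ x. ennreal ((cmod (g x))\<^sup>2) \<partial>lborel)"
proof -
  have [measurable]: "g \<in> borel_measurable lborel" using g by auto
  have M: "0 \<le> M" using bound[of 0] norm_ge_zero order_trans by blast
  define t where "t = (\<lambda>k. 1 / real (Suc k))"
  have t: "t k > 0" "t k \<le> 1" for k by (simp_all add: t_def field_simps)
  have tlim: "t \<longlonglongrightarrow> 0" unfolding t_def using LIMSEQ_inverse_real_of_nat by (simp add: field_simps)
  have gauss: "integrable lborel (\<lambda>s::real. exp (- pi * s\<^sup>2))" "(LBINT s. exp (- pi * s\<^sup>2)) = 1"
    using gaussian_fourier(1)[of 1] integral_gaussian[of 1] by simp_all
  define a where "a = (\<lambda>k x. LBINT s. cnj (g (x - t k * s)) * complex_of_real (exp (- pi * s\<^sup>2)))"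
  have [measurable]: "a k \<in> borel_measurable lborel" for k
    unfolding a_def by measurable
  have a_bound: "cmod (a k x) \<le> M" for k x
  proof -
    have "cmod (a k x) \<le> (LBINT s. M * exp (- pi * s\<^sup>2))"
      unfolding a_def
    proof (rule Bochner_Integration.integral_norm_bound_integral)
      show "integrable lborel (\<lambda>s. M * exp (- pi * s\<^sup>2))" using gauss by simp
      have "integrable lborel (\<lambda>s. complex_of_real (exp (- pi * s\<^sup>2)) * cnj (g (x - t k * s)))"
        by (rule integrable_mult_bounded[where C=M]) (use gauss bound in \<open>auto intro!: integrable_of_real\<close>)
      then show "integrable lborel (\<lambda>s. cnj (g (x - t k * s)) * complex_of_real (exp (- pi * s\<^sup>2)))"
        by (simp add: mult.commute)
    qed (auto simp: norm_mult bound intro!: mult_right_mono)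
    then show ?thesis using gauss by simp
  qed
  have a_lim: "(\<lambda>k. a k x) \<longlonglongrightarrow> cnj (g x)" for x
  proof -
    have "(\<lambda>k. a k x) \<longlonglongrightarrow> (LBINT s. cnj (g (x - 0 * s)) * complex_of_real (exp (- pi * s\<^sup>2)))"
      unfolding a_def
    proof (rule integral_dominated_convergence[where w="\<lambda>s. M * exp (- pi * s\<^sup>2)"])
      show "integrable lborel (\<lambda>s. M * exp (- pi * s\<^sup>2))" using gauss by simp
      have "isCont g y" for y using cont by (simp add: continuous_on_eq_continuous_at)
      then have "(\<lambda>k. g (x - t k * s)) \<longlonglongrightarrow> g (x - 0 * s)" for s
        by (intro isCont_tendsto_compose[where g=g] tendsto_intros tlim)
      then show "AE s in lborel. (\<lambda>k. cnj (g (x - t k * s)) * complex_of_real (exp (- pi * s\<^sup>2)))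
          \<longlonglongrightarrow> cnj (g (x - 0 * s)) * complex_of_real (exp (- pi * s\<^sup>2))"
        by (intro AE_I2 tendsto_intros)
    qed (auto simp: norm_mult bound intro!: mult_right_mono)
    then show ?thesis using gauss by simp
  qed
  have lim: "(\<lambda>k. LBINT x. g x * a k x) \<longlonglongrightarrow> (LBINT x. g x * cnj (g x))"
  proof (rule integral_dominated_convergence[where w="\<lambda>x. M * cmod (g x)"])
    show "AE x in lborel. (\<lambda>k. g x * a k x) \<longlonglongrightarrow> g x * cnj (g x)"
      by (intro AE_I2 tendsto_intros a_lim)
    show "AE x in lborel. cmod (g x * a k x) \<le> M * cmod (g x)" for k
      using mult_left_mono[OF a_bound norm_ge_zero] by (intro AE_I2) (simp add: norm_mult mult.commute)
  qed (use g in auto)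
  define E where "E = (\<lambda>k \<xi>. exp (- pi * (t k * \<xi>)\<^sup>2) * (cmod (\<F> g \<xi>))\<^sup>2)"
  have E_int: "integrable lborel (E k)" for k
    unfolding E_def
  proof (rule Bochner_Integration.integrable_bound)
    let ?C = "LBINT x. cmod (g x)"
    show "integrable lborel (\<lambda>\<xi>. ?C\<^sup>2 * exp (- pi * (t k * \<xi>)\<^sup>2))"
      using gaussian_fourier(1)[OF t(1)] by simp
    show "AE \<xi> in lborel. norm (exp (- pi * (t k * \<xi>)\<^sup>2) * (cmod (\<F> g \<xi>))\<^sup>2)
        \<le> norm (?C\<^sup>2 * exp (- pi * (t k * \<xi>)\<^sup>2))"
      using norm_fourier_integral_le[of g]
      by (intro AE_I2) (simp add: mult.commute power_mono)
  qed measurable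
  have gg: "integrable lborel (\<lambda>x. (cmod (g x))\<^sup>2)"
  proof (rule Bochner_Integration.integrable_bound)
    show "integrable lborel (\<lambda>x. M * cmod (g x))" using g by simp
    show "AE x in lborel. norm ((cmod (g x))\<^sup>2) \<le> norm (M * cmod (g x))"
      using mult_right_mono[OF bound norm_ge_zero] M by (intro AE_I2) (simp add: power2_eq_square)
  qed measurable
  have E_eq: "complex_of_real (LBINT \<xi>. E k \<xi>) = (LBINT x. g x * a k x)" for k
    using gaussian_weighted_energy[OF g t(1)[of k]] by (simp add: E_def a_def flip: integral_complex_of_real)
  have "(\<lambda>k. complex_of_real (LBINT \<xi>. E k \<xi>)) \<longlonglongrightarrow> complex_of_real (LBINT x. (cmod (g x))\<^sup>2)"
    using lim unfolding E_eq by (simp add: integral_complex_of_real[symmetric] complex_norm_square del: of_real_power of_real_mult)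
  then have E_lim: "(\<lambda>k. LBINT \<xi>. E k \<xi>) \<longlonglongrightarrow> (LBINT x. (cmod (g x))\<^sup>2)"
    by (simp only: tendsto_of_real_iff)
  have "(\<lambda>k. ennreal (LBINT \<xi>. E k \<xi>)) \<longlonglongrightarrow> ennreal (LBINT x. (cmod (g x))\<^sup>2)"
    using E_lim by (rule tendsto_ennrealI)
  also have "(\<lambda>k. ennreal (LBINT \<xi>. E k \<xi>)) = (\<lambda>k. \<integral>\<^sup>+ \<xi>. ennreal (E k \<xi>) \<partial>lborel)"
    by (subst nn_integral_eq_integral[OF E_int]) (auto simp: E_def)
  also have "ennreal (LBINT x. (cmod (g x))\<^sup>2) = (\<integral>\<^sup>+ x. ennreal ((cmod (g x))\<^sup>2) \<partial>lborel)"
    by (rule nn_integral_eq_integral[OF gg, symmetric]) simp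
  finally have 1: "(\<lambda>k. \<integral>\<^sup>+ \<xi>. ennreal (E k \<xi>) \<partial>lborel) \<longlonglongrightarrow> (\<integral>\<^sup>+ x. ennreal ((cmod (g x))\<^sup>2) \<partial>lborel)" .
  have "(\<lambda>k. \<integral>\<^sup>+ \<xi>. ennreal (E k \<xi>) \<partial>lborel) \<longlonglongrightarrow> (\<integral>\<^sup>+ \<xi>. ennreal ((cmod (\<F> g \<xi>))\<^sup>2) \<partial>lborel)"
  proof (rule nn_integral_LIMSEQ)
    have mono: "t (Suc k) \<le> t k" for k by (simp add: t_def field_simps)
    have "(t (Suc k) * \<xi>)\<^sup>2 \<le> (t k * \<xi>)\<^sup>2" for k \<xi>
      unfolding power_mult_distrib using mono[of k] t(1)[of "Suc k"]
      by (intro mult_right_mono power_mono) auto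
    then have "E k \<xi> \<le> E (Suc k) \<xi>" for k \<xi>
      unfolding E_def by (intro mult_right_mono) auto
    then show "incseq (\<lambda>k \<xi>. ennreal (E k \<xi>))"
      by (intro incseq_SucI le_funI ennreal_leI)
    show "(\<lambda>\<xi>. ennreal (E k \<xi>)) \<in> borel_measurable lborel" for k
      unfolding E_def by measurable
    fix \<xi>
    have "(\<lambda>k. E k \<xi>) \<longlonglongrightarrow> exp (- pi * (0 * \<xi>)\<^sup>2) * (cmod (\<F> g \<xi>))\<^sup>2"
      unfolding E_def by (intro tendsto_intros tlim)
    then show "(\<lambda>k. ennreal (E k \<xi>)) \<longlonglongrightarrow> ennreal ((cmod (\<F> g \<xi>))\<^sup>2)"
      by (intro tendsto_ennrealI) simp
  qed
  from LIMSEQ_unique[OF this 1] show ?thesis .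
qed

section \<open>The space \<open>L\<^sup>2\<close>\<close>

text \<open>
  The squared norm of \<open>L\<^sup>2\<close>. Working with squares, the inequality
  \<open>energy (f + g) \<le> 2 * energy f + 2 * energy g\<close> takes the place of the triangle inequality.
\<close>

definition energy :: "(real \<Rightarrow> complex) \<Rightarrow> real" where
  "energy f = (LBINT x. (cmod (f x))\<^sup>2)"

lemma L2_measurable: "f \<in> L2 \<Longrightarrow> f \<in> borel_measurable lborel"
  by (simp add: L2_def)

lemma L2_integrable: "f \<in> L2 \<Longrightarrow> integrable lborel (\<lambda>x. (cmod (f x))\<^sup>2)"
  by (simp add: L2_def)

lemma energy_nonneg [simp]: "0 \<le> energy f"
  by (simp add: energy_def)

lemma nn_integral_energy:
  "f \<in> L2 \<Longrightarrow> (\<integral>\<^sup>+x. ennreal ((cmod (f x))\<^sup>2) \<partial>lborel) = ennreal (energy f)"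
  unfolding energy_def by (rule nn_integral_eq_integral) (auto simp: L2_integrable)

lemma L2I_nn_integral:
  assumes [measurable]: "f \<in> borel_measurable lborel"
    and le: "(\<integral>\<^sup>+x. ennreal ((cmod (f x))\<^sup>2) \<partial>lborel) \<le> ennreal C" and C: "0 \<le> C"
  shows "f \<in> L2" "energy f \<le> C"
proof -
  have "(\<integral>\<^sup>+x. ennreal ((cmod (f x))\<^sup>2) \<partial>lborel) < \<infinity>"
    using le by (simp add: order_le_less_trans)
  then have "integrable lborel (\<lambda>x. (cmod (f x))\<^sup>2)"
    by (intro integrableI_bounded) auto
  then show f: "f \<in> L2" by (simp add: L2_def)
  show "energy f \<le> C" using le C unfolding nn_integral_energy[OF f] by simp
qed

lemma L2I_bound:
  assumes "integrable lborel w" "f \<in> borel_measurable lborel" "\<And>x. (cmod (f x))\<^sup>2 \<le> w x"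
  shows "f \<in> L2" "energy f \<le> (LBINT x. w x)"
proof -
  have [measurable]: "f \<in> borel_measurable lborel" by fact
  have "integrable lborel (\<lambda>x. (cmod (f x))\<^sup>2)"
    by (rule Bochner_Integration.integrable_bound[OF assms(1)])
       (auto intro!: AE_I2 order_trans[OF assms(3)])
  then show f: "f \<in> L2" by (simp add: L2_def)
  show "energy f \<le> (LBINT x. w x)"
    unfolding energy_def by (rule integral_mono[OF L2_integrable[OF f] assms(1,3)])
qed

lemma cmod_add_sq_le: "(cmod (a + b))\<^sup>2 \<le> 2 * (cmod a)\<^sup>2 + 2 * (cmod b)\<^sup>2"
proof -
  have "(cmod (a + b))\<^sup>2 \<le> (cmod a + cmod b)\<^sup>2" by (intro power_mono norm_triangle_ineq) simp
  also have "\<dots> \<le> 2 * (cmod a)\<^sup>2 + 2 * (cmod b)\<^sup>2"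
    using zero_le_power2[of "cmod a - cmod b"] unfolding power2_sum power2_diff by linarith
  finally show ?thesis .
qed

lemma L2_add:
  assumes "f \<in> L2" "g \<in> L2"
  shows "(\<lambda>x. f x + g x) \<in> L2" "energy (\<lambda>x. f x + g x) \<le> 2 * energy f + 2 * energy g"
proof -
  note [measurable] = assms[THEN L2_measurable]
  note i = assms[THEN L2_integrable]
  have w: "integrable lborel (\<lambda>x. 2 * (cmod (f x))\<^sup>2 + 2 * (cmod (g x))\<^sup>2)" using i by simp
  note * = L2I_bound[OF w, of "\<lambda>x. f x + g x", OF _ cmod_add_sq_le]
  show "(\<lambda>x. f x + g x) \<in> L2" by (rule *(1)) measurable
  have "energy (\<lambda>x. f x + g x) \<le> (LBINT x. 2 * (cmod (f x))\<^sup>2 + 2 * (cmod (g x))\<^sup>2)"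
    by (rule *(2)) measurable
  then show "energy (\<lambda>x. f x + g x) \<le> 2 * energy f + 2 * energy g"
    using i by (simp add: energy_def)
qed

lemma L2_cmult:
  assumes "f \<in> L2"
  shows "(\<lambda>x. c * f x) \<in> L2" "energy (\<lambda>x. c * f x) = (cmod c)\<^sup>2 * energy f"
  using assms by (auto simp: L2_def norm_mult power_mult_distrib energy_def)

lemma L2_minus: "f \<in> L2 \<Longrightarrow> (\<lambda>x. - f x) \<in> L2"
  using L2_cmult(1)[of f "-1"] by simp

lemma L2_diff:
  assumes "f \<in> L2" "g \<in> L2"
  shows "(\<lambda>x. f x - g x) \<in> L2" "energy (\<lambda>x. f x - g x) \<le> 2 * energy f + 2 * energy g"
  using L2_add[OF assms(1) L2_minus[OF assms(2)]] by (simp_all add: energy_def)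

lemma energy_diff_commute: "energy (\<lambda>x. f x - g x) = energy (\<lambda>x. g x - f x)"
  by (simp add: energy_def norm_minus_commute)

lemma L2_cong_AE:
  assumes "f \<in> L2" "g \<in> borel_measurable lborel" "AE x in lborel. f x = g x"
  shows "g \<in> L2" "energy g = energy f"
proof -
  note [measurable] = L2_measurable[OF assms(1)] assms(2)
  have ae: "AE x in lborel. (cmod (f x))\<^sup>2 = (cmod (g x))\<^sup>2" using assms(3) by eventually_elim simp
  show "g \<in> L2" using assms integrable_cong_AE[OF _ _ ae] by (auto simp: L2_def)
  show "energy g = energy f" unfolding energy_def using integral_cong_AE[OF _ _ ae] by simp
qed

lemma energy_zero_imp_AE:
  assumes "f \<in> L2" "energy f = 0" shows "AE x in lborel. f x = 0"
proof -
  have "AE x in lborel. (cmod (f x))\<^sup>2 = 0"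
    using integral_nonneg_eq_0_iff_AE[OF L2_integrable[OF assms(1)]] assms(2) by (simp add: energy_def)
  then show ?thesis by simp
qed

lemma L2_tendsto_energy:
  assumes "\<And>k. u k \<in> L2" "f \<in> L2"
  shows "L2_tendsto u f \<longleftrightarrow> (\<lambda>k. energy (\<lambda>x. u k x - f x)) \<longlonglongrightarrow> 0"
  unfolding L2_tendsto_def nn_integral_energy[OF L2_diff(1)[OF assms]]
  by (simp flip: ennreal_0 add: tendsto_ennreal_iff)

definition re_inner :: "(real \<Rightarrow> complex) \<Rightarrow> (real \<Rightarrow> complex) \<Rightarrow> real" where
  "re_inner f g = Re (LBINT x. f x * cnj (g x))"

lemma L2_mult_integrable:
  assumes "f \<in> L2" "g \<in> L2" shows "integrable lborel (\<lambda>x. f x * cnj (g x))"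
proof (rule Bochner_Integration.integrable_bound)
  note [measurable] = assms[THEN L2_measurable]
  show "integrable lborel (\<lambda>x. (cmod (f x))\<^sup>2 + (cmod (g x))\<^sup>2)"
    using assms[THEN L2_integrable] by simp
  have "a * b \<le> a\<^sup>2 + b\<^sup>2" if "0 \<le> a" "0 \<le> b" for a b :: real
    using sum_squares_bound[of a b] mult_nonneg_nonneg[OF that] by linarith
  then show "AE x in lborel. norm (f x * cnj (g x)) \<le> norm ((cmod (f x))\<^sup>2 + (cmod (g x))\<^sup>2)"
    by (intro AE_I2) (simp add: norm_mult)
  show "(\<lambda>x. f x * cnj (g x)) \<in> borel_measurable lborel" by measurable
qed

lemma energy_polarization:
  assumes "f \<in> L2" "g \<in> L2"
  shows "energy (\<lambda>x. f x - g x) = energy f + energy g - 2 * re_inner f g"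
proof -
  note i = assms[THEN L2_integrable] L2_mult_integrable[OF assms]
  have "(cmod (a - b))\<^sup>2 = (cmod a)\<^sup>2 + (cmod b)\<^sup>2 - 2 * Re (a * cnj b)" for a b
    unfolding cmod_power2 by (simp add: power2_eq_square algebra_simps)
  then have "energy (\<lambda>x. f x - g x)
      = (LBINT x. (cmod (f x))\<^sup>2 + (cmod (g x))\<^sup>2 - 2 * Re (f x * cnj (g x)))"
    by (simp add: energy_def)
  also have "\<dots> = (LBINT x. (cmod (f x))\<^sup>2 + (cmod (g x))\<^sup>2) - (LBINT x. 2 * Re (f x * cnj (g x)))"
    by (intro Bochner_Integration.integral_diff Bochner_Integration.integrable_add integrable_mult_right integrable_Re i)
  also have "\<dots> = energy f + energy g - 2 * re_inner f g"
    using i unfolding energy_def re_inner_def by (simp only: integral_mult_right_zero integral_Re Bochner_Integration.integral_add)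
  finally show ?thesis .
qed

lemma re_inner_Cauchy_Schwarz:
  assumes f: "f \<in> L2" and g: "g \<in> L2" shows "(re_inner f g)\<^sup>2 \<le> energy f * energy g"
proof (rule quadratic_nonneg_imp_discriminant)
  fix t :: real
  have "re_inner f (\<lambda>x. of_real (- t) * g x) = - t * re_inner f g"
    unfolding re_inner_def complex_cnj_mult complex_cnj_complex_of_real mult.left_commute[of "f _"]
      integral_mult_right_zero by simp
  then have "energy (\<lambda>x. f x - of_real (- t) * g x) = energy f + 2 * re_inner f g * t + energy g * t\<^sup>2"
    using energy_polarization[OF f L2_cmult(1)[OF g], of "of_real (- t)"] L2_cmult(2)[OF g, of "of_real (- t)"]
    by (simp add: mult_ac)
  then show "0 \<le> energy f + 2 * re_inner f g * t + energy g * t\<^sup>2" by (metis energy_nonneg)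
qed simp_all

lemma energy_tendsto:
  assumes u: "\<And>k. u k \<in> L2" and f: "f \<in> L2" and lim: "L2_tendsto u f"
  shows "(\<lambda>k. energy (u k)) \<longlonglongrightarrow> energy f"
proof -
  define D where "D = (\<lambda>k. energy (\<lambda>x. f x - u k x))"
  have D: "D \<longlonglongrightarrow> 0"
    using lim unfolding L2_tendsto_energy[OF u f] D_def energy_diff_commute[of f] .
  have le: "\<bar>energy (u k) - energy f\<bar> \<le> D k + 2 * sqrt (energy f * D k)" for k
  proof -
    have d: "(\<lambda>x. f x - u k x) \<in> L2" by (rule L2_diff(1)[OF f u])
    have "\<bar>re_inner f (\<lambda>x. f x - u k x)\<bar> \<le> sqrt (energy f * D k)"
      using re_inner_Cauchy_Schwarz[OF f d] unfolding D_def by (rule real_le_rsqrt[of "\<bar>_\<bar>", unfolded power2_abs])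
    moreover have "energy (u k) = energy f + D k - 2 * re_inner f (\<lambda>x. f x - u k x)"
      using energy_polarization[OF f d] by (simp add: D_def)
    moreover have "0 \<le> D k" by (simp add: D_def)
    ultimately show ?thesis by linarith
  qed
  have "(\<lambda>k. D k + 2 * sqrt (energy f * D k)) \<longlonglongrightarrow> 0 + 2 * sqrt (energy f * 0)"
    by (intro tendsto_intros D)
  then have lim0: "(\<lambda>k. D k + 2 * sqrt (energy f * D k)) \<longlonglongrightarrow> 0" by simp
  have "(\<lambda>k. energy (u k) - energy f) \<longlonglongrightarrow> 0"
  proof (rule Lim_null_comparison[OF _ lim0])
    show "\<forall>\<^sub>F k in sequentially. norm (energy (u k) - energy f) \<le> D k + 2 * sqrt (energy f * D k)"
      unfolding real_norm_def by (intro always_eventually allI le)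
  qed
  then show ?thesis by (rule LIM_zero_cancel)
qed

lemma re_inner_tendsto:
  assumes u: "\<And>k. u k \<in> L2" and f: "f \<in> L2" and lim: "L2_tendsto u f" and g: "g \<in> L2"
  shows "(\<lambda>k. re_inner (u k) g) \<longlonglongrightarrow> re_inner f g"
proof -
  have eq: "re_inner h g = (energy h + energy g - energy (\<lambda>x. h x - g x)) / 2" if "h \<in> L2" for h
    using energy_polarization[OF that g] by simp
  have diff: "(\<lambda>k. energy (\<lambda>x. u k x - g x)) \<longlonglongrightarrow> energy (\<lambda>x. f x - g x)"
    using lim by (intro energy_tendsto L2_diff u f g) (simp add: L2_tendsto_def)
  show ?thesis
    unfolding eq[OF u] eq[OF f] by (intro tendsto_intros energy_tendsto[OF u f lim] diff) simp
qed

lemma L2_indicator: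
  assumes f: "f \<in> L2" and [measurable]: "A \<in> sets borel"
  shows "(\<lambda>x. f x * indicator A x) \<in> L2"
proof (rule L2I_bound(1)[OF L2_integrable[OF f]])
  note [measurable] = L2_measurable[OF f]
  show "(\<lambda>x. f x * indicator A x) \<in> borel_measurable lborel" by measurable
qed (auto simp: indicator_def)

lemma L2_interval_integrable:
  assumes f: "f \<in> L2"
  shows "integrable lborel (\<lambda>x. f x * indicator {a..b} x)"
proof (rule Bochner_Integration.integrable_bound)
  note [measurable] = L2_measurable[OF f]
  show "integrable lborel (\<lambda>x. indicator {a..b} x + (cmod (f x))\<^sup>2)"
    using L2_integrable[OF f]
    by (intro Bochner_Integration.integrable_add integrable_real_indicator)
       (auto simp: emeasure_lborel_Icc_eq)
  have "x \<le> 1 + x\<^sup>2" for x :: real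
    using zero_le_power2[of "x - 1/2"] by (simp add: power2_eq_square algebra_simps)
  then show "AE x in lborel. cmod (f x * indicator {a..b} x)
      \<le> norm (indicator {a..b} x + (cmod (f x))\<^sup>2)"
    by (intro AE_I2) (auto simp: indicator_def)
  show "(\<lambda>x. f x * indicator {a..b} x) \<in> borel_measurable lborel" by measurable
qed

text \<open>
  First \<open>f\<close> is truncated in its argument and in its values. The truncated function is the limit almost
  everywhere of continuous functions; these are forced into the same bounds by a continuous
  retraction onto the disc of radius \<open>R\<close> and a continuous cut-off, and then dominated convergence applies. The
  integrand \<open>\<phi>\<close> controls the norms of \<open>L\<^sup>1\<close> and \<open>L\<^sup>2\<close> at once: the first gives pointwise convergence of
  Fourier integrals, the second convergence of energies.
\<close>

lemma continuous_dense_L1_L2: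
  assumes f: "f \<in> L2" "integrable lborel f" and e: "e > 0"
  obtains g M where "integrable lborel g" "g \<in> L2" "continuous_on UNIV g" "\<And>x. cmod (g x) \<le> M"
    "(LBINT x. cmod (f x - g x)) < e" "energy (\<lambda>x. f x - g x) < e"
proof -
  define \<phi> :: "(real \<Rightarrow> complex) \<Rightarrow> real \<Rightarrow> real" where "\<phi> h x = cmod (h x) + (cmod (h x))\<^sup>2" for h x
  note [measurable] = L2_measurable[OF f(1)]
  have \<phi>_meas [measurable]: "h \<in> borel_measurable lborel \<Longrightarrow> \<phi> h \<in> borel_measurable lborel" for h
    unfolding \<phi>_def[abs_def] by simp
  define fm where "fm = (\<lambda>m x. if \<bar>x\<bar> \<le> real (Suc m) \<and> cmod (f x) \<le> real (Suc m) then f x else 0)"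
  have [measurable]: "fm m \<in> borel_measurable lborel" for m unfolding fm_def by measurable
  have i\<phi>: "integrable lborel (\<phi> f)"
    using f L2_integrable[OF f(1)] unfolding \<phi>_def by simp
  have "(\<lambda>m. LBINT x. \<phi> (\<lambda>x. f x - fm m x) x) \<longlonglongrightarrow> (LINT x|(lborel :: real measure). (0::real))"
  proof (rule integral_dominated_convergence[where w="\<phi> f" and f="\<lambda>_. 0" and
      s="\<lambda>m. \<phi> (\<lambda>x. f x - fm m x)"])
    show "integrable lborel (\<phi> f)" by (rule i\<phi>)
    show "AE x in lborel. (\<lambda>m. \<phi> (\<lambda>x. f x - fm m x) x) \<longlonglongrightarrow> 0"
    proof (intro AE_I2 tendsto_eventually)
      fix x
      obtain N where N: "max \<bar>x\<bar> (cmod (f x)) \<le> real N" using real_arch_simple by blast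
      have "fm m x = f x" if "m \<ge> N" for m using N that by (auto simp: fm_def)
      then show "\<forall>\<^sub>F m in sequentially. \<phi> (\<lambda>x. f x - fm m x) x = 0"
        by (intro eventually_sequentiallyI[of N]) (simp add: \<phi>_def)
    qed
    show "AE x in lborel. norm (\<phi> (\<lambda>x. f x - fm m x) x) \<le> \<phi> f x" for m
      by (intro AE_I2) (auto simp: \<phi>_def fm_def)
  qed measurable
  then have "\<forall>\<^sub>F m in sequentially. (LBINT x. \<phi> (\<lambda>x. f x - fm m x) x) < e / 4"
    using e by (intro order_tendstoD(2)[where a="e/4"]) auto
  then obtain m where m: "(LBINT x. \<phi> (\<lambda>x. f x - fm m x) x) < e / 4"
    by (meson eventually_happens' sequentially_bot)
  define R where "R = real (Suc m)"
  have R: "R > 0" by (simp add: R_def)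
  have "fm m measurable_on UNIV"
    by (rule lebesgue_measurable_imp_measurable_on) (auto intro: measurable_completion)
  then obtain N g where N: "negligible N" and g: "\<And>n. continuous_on UNIV (g n)"
    and glim: "\<And>x. x \<notin> N \<Longrightarrow> (\<lambda>n. g n x) \<longlonglongrightarrow> fm m x"
    unfolding measurable_on_def by auto
  define cl where "cl = (\<lambda>z. z * complex_of_real (R / max R (cmod z)))"
  define bump where "bump = (\<lambda>x::real. min 1 (max 0 (R + 1 - \<bar>x\<bar>)))"
  define h where "h = (\<lambda>n x. of_real (bump x) * cl (g n x))"
  have cl_cont: "continuous_on UNIV cl"
    unfolding cl_def using R by (intro continuous_intros) auto
  have cl_le: "cmod (cl z) \<le> R" for z
    using R by (auto simp: cl_def norm_mult norm_divide max_def field_simps)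
  have cl_id: "cl z = z" if "cmod z \<le> R" for z
    using that R by (simp add: cl_def max_absorb1)
  have bump01: "0 \<le> bump x" "bump x \<le> 1" for x by (auto simp: bump_def)
  have h_cont: "continuous_on UNIV (h n)" for n
    unfolding h_def bump_def
    by (intro continuous_intros continuous_on_compose2[OF cl_cont g]) auto
  then have h_meas [measurable]: "h n \<in> borel_measurable lborel" for n
    by (simp add: borel_measurable_continuous_onI)
  define I where "I = (\<lambda>x. indicator {- (R + 1)..R + 1} x :: real)"
  have h_le: "cmod (h n x) \<le> R * I x" for n x
  proof (cases "x \<in> {- (R + 1)..R + 1}")
    case True
    have "bump x * cmod (cl (g n x)) \<le> 1 * R"
      using bump01 cl_le R by (intro mult_mono) auto
    then show ?thesis using True bump01 by (simp add: h_def norm_mult I_def)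
  next
    case False
    then have "bump x = 0" by (auto simp: bump_def)
    then show ?thesis using False by (simp add: h_def I_def)
  qed
  have fm_le: "cmod (fm m x) \<le> R * I x" for x
    by (auto simp: fm_def R_def I_def indicator_def)
  have iI: "integrable lborel I"
    unfolding I_def by (intro integrable_real_indicator) (auto simp: emeasure_lborel_Icc_eq)
  have h_int: "integrable lborel (h n)" for n
    by (rule Bochner_Integration.integrable_bound[of _ "\<lambda>x. R * I x"])
       (use iI R in \<open>auto intro!: AE_I2 order_trans[OF h_le]\<close>)
  have h_L2: "h n \<in> L2" for n
  proof (rule L2I_bound(1)[of "\<lambda>x. R\<^sup>2 * I x"])
    show "(cmod (h n x))\<^sup>2 \<le> R\<^sup>2 * I x" for x
      using power_mono[OF h_le[of n x] norm_ge_zero, of 2]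
      by (cases "x \<in> {- (R + 1)..R + 1}") (simp_all add: I_def)
  qed (use iI in auto)
  have ae: "AE x in lborel. x \<notin> N"
    using N AE_not_in[of N lebesgue] AE_completion_iff[of "\<lambda>x. x \<notin> N" lborel] by (simp add: negligible_iff_null_sets)
  have "(\<lambda>n. LBINT x. \<phi> (\<lambda>x. fm m x - h n x) x) \<longlonglongrightarrow> (LINT x|(lborel :: real measure). (0::real))"
  proof (rule integral_dominated_convergence[where w="\<lambda>x. (2 * R + 4 * R\<^sup>2) * I x"
      and f="\<lambda>_. 0" and s="\<lambda>n. \<phi> (\<lambda>x. fm m x - h n x)"])
    show "integrable lborel (\<lambda>x. (2 * R + 4 * R\<^sup>2) * I x)" using iI by simp
    show "AE x in lborel. (\<lambda>n. \<phi> (\<lambda>x. fm m x - h n x) x) \<longlonglongrightarrow> 0"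
      using ae
    proof eventually_elim
      fix x assume "x \<notin> N"
      have "(\<lambda>n. h n x) \<longlonglongrightarrow> of_real (bump x) * cl (fm m x)"
        unfolding h_def using cl_cont
        by (intro tendsto_intros isCont_tendsto_compose[where g=cl] glim \<open>x \<notin> N\<close>)
           (simp add: continuous_on_eq_continuous_at)
      also have "of_real (bump x) * cl (fm m x) = fm m x"
        using cl_id[of "fm m x"] by (auto simp: fm_def R_def bump_def)
      finally have "(\<lambda>n. \<phi> (\<lambda>x. fm m x - h n x) x) \<longlonglongrightarrow> cmod (fm m x - fm m x) + (cmod (fm m x - fm m x))\<^sup>2"
        unfolding \<phi>_def by (intro tendsto_intros)
      then show "(\<lambda>n. \<phi> (\<lambda>x. fm m x - h n x) x) \<longlonglongrightarrow> 0" by simp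
    qed
    show "AE x in lborel. norm (\<phi> (\<lambda>x. fm m x - h n x) x) \<le> (2 * R + 4 * R\<^sup>2) * I x" for n
    proof (intro AE_I2)
      fix x
      have "cmod (fm m x - h n x) \<le> 2 * R * I x"
        using norm_triangle_ineq4[of "fm m x" "h n x"] fm_le[of x] h_le[of n x] by linarith
      moreover from this have "(cmod (fm m x - h n x))\<^sup>2 \<le> (2 * R * I x)\<^sup>2" by (intro power_mono) auto
      ultimately show "norm (\<phi> (\<lambda>x. fm m x - h n x) x) \<le> (2 * R + 4 * R\<^sup>2) * I x"
        by (auto simp: \<phi>_def I_def indicator_def power_mult_distrib)
    qed
  qed measurable
  then have "\<forall>\<^sub>F n in sequentially. (LBINT x. \<phi> (\<lambda>x. fm m x - h n x) x) < e / 4"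
    using e by (intro order_tendstoD(2)[where a="e/4"]) auto
  then obtain n where n: "(LBINT x. \<phi> (\<lambda>x. fm m x - h n x) x) < e / 4"
    by (meson eventually_happens' sequentially_bot)
  have fm_int: "integrable lborel (fm m)"
    by (rule Bochner_Integration.integrable_bound[of _ "\<lambda>x. R * I x"])
       (use iI R in \<open>auto intro!: AE_I2 order_trans[OF fm_le]\<close>)
  have fm_L2: "fm m \<in> L2"
    by (rule L2I_bound(1)[OF L2_integrable[OF f(1)]]) (auto simp: fm_def)
  have \<phi>_int: "integrable lborel (\<phi> (\<lambda>x. a x - b x))"
    if "a \<in> L2" "b \<in> L2" "integrable lborel a" "integrable lborel b" for a b
    using L2_integrable[OF L2_diff(1)[OF that(1,2)]] that(3,4) unfolding \<phi>_def by simp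
  note i3 = \<phi>_int[OF f(1) h_L2 f(2) h_int, of n] \<phi>_int[OF f(1) fm_L2 f(2) fm_int]
    \<phi>_int[OF fm_L2 h_L2 fm_int h_int, of n]
  have "(LBINT x. \<phi> (\<lambda>x. f x - h n x) x)
      \<le> (LBINT x. 2 * \<phi> (\<lambda>x. f x - fm m x) x + 2 * \<phi> (\<lambda>x. fm m x - h n x) x)"
  proof (rule integral_mono)
    fix x
    have "cmod (f x - h n x) \<le> cmod (f x - fm m x) + cmod (fm m x - h n x)"
      using norm_triangle_ineq[of "f x - fm m x" "fm m x - h n x"] by simp
    moreover have "(cmod (f x - h n x))\<^sup>2 \<le> 2 * (cmod (f x - fm m x))\<^sup>2 + 2 * (cmod (fm m x - h n x))\<^sup>2"
      using cmod_add_sq_le[of "f x - fm m x" "fm m x - h n x"] by simp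
    moreover have "a + a' \<le> 2 * (b + b') + 2 * (c + c')"
      if "a \<le> b + c" "a' \<le> 2 * b' + 2 * c'" "0 \<le> b" "0 \<le> c" for a b c a' b' c' :: real
      using that by auto
    ultimately show "\<phi> (\<lambda>x. f x - h n x) x \<le> 2 * \<phi> (\<lambda>x. f x - fm m x) x + 2 * \<phi> (\<lambda>x. fm m x - h n x) x"
      unfolding \<phi>_def by (metis norm_ge_zero)
  qed (use i3 in auto)
  also have "\<dots> = 2 * (LBINT x. \<phi> (\<lambda>x. f x - fm m x) x) + 2 * (LBINT x. \<phi> (\<lambda>x. fm m x - h n x) x)"
    using i3 by simp
  also have "\<dots> < e" using m n by linarith
  finally have tot: "(LBINT x. \<phi> (\<lambda>x. f x - h n x) x) < e" .
  show thesis
  proof (rule that[of "h n" R])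
    show "cmod (h n x) \<le> R" for x
      using h_le[of n x] R by (cases "x \<in> {- (R + 1)..R + 1}") (simp_all add: I_def)
    have "(LBINT x. cmod (f x - h n x)) \<le> (LBINT x. \<phi> (\<lambda>x. f x - h n x) x)"
      by (rule integral_mono[OF _ i3(1)]) (use f h_int in \<open>auto simp: \<phi>_def\<close>)
    then show "(LBINT x. cmod (f x - h n x)) < e" using tot by linarith
    have "energy (\<lambda>x. f x - h n x) \<le> (LBINT x. \<phi> (\<lambda>x. f x - h n x) x)"
      unfolding energy_def
      by (rule integral_mono[OF _ i3(1)]) (use L2_integrable[OF L2_diff(1)[OF f(1) h_L2]] in \<open>auto simp: \<phi>_def\<close>)
    then show "energy (\<lambda>x. f x - h n x) < e" using tot by linarith
  qed (use h_int h_L2 h_cont in auto)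
qed

section \<open>The Fourier transform on \<open>L\<^sup>2\<close>\<close>

lemma cmod_fourier_integral_diff_le:
  assumes "integrable lborel f" "integrable lborel g"
  shows "cmod (\<F> f \<xi> - \<F> g \<xi>) \<le> (LBINT x. cmod (f x - g x))"
  using norm_fourier_integral_le[of "\<lambda>x. f x - g x" \<xi>] by (simp add: fourier_integral_diff[OF assms])

text \<open>
  Approximate by bounded continuous functions in both norms. Fatou's lemma gives the inequality \<open>half\<close>;
  applied to the differences, it shows that the Fourier integrals of the approximations converge in
  \<open>L\<^sup>2\<close>, and then equality passes to the limit.
\<close>

theorem Plancherel_L1_L2:
  assumes f: "f \<in> L2" "integrable lborel f"
  shows "\<F> f \<in> L2" "energy (\<F> f) = energy f"
proof -
  have bounded_case: "\<F> g \<in> L2 \<and> energy (\<F> g) = energy g"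
    if "integrable lborel g" "g \<in> L2" "continuous_on UNIV g" "\<And>x. cmod (g x) \<le> M" for g M
  proof -
    note [measurable] = L2_measurable[OF that(2)]
    have eq: "(\<integral>\<^sup>+ \<xi>. ennreal ((cmod (\<F> g \<xi>))\<^sup>2) \<partial>lborel) = ennreal (energy g)"
      using Plancherel_continuous[OF that(1,3,4)] nn_integral_energy[OF that(2)] by simp
    then have L2: "\<F> g \<in> L2"
      by (intro L2I_nn_integral(1)[of _ "energy g"]) auto
    with eq show ?thesis by (simp add: nn_integral_energy)
  qed
  have approx: "\<exists>g. \<forall>k. integrable lborel (g k) \<and> g k \<in> L2 \<and> \<F> (g k) \<in> L2 \<and>
      energy (\<F> (g k)) = energy (g k) \<and>
      (LBINT x. cmod (h x - g k x)) < 1 / Suc k \<and> energy (\<lambda>x. h x - g k x) < 1 / Suc k"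
    if h: "h \<in> L2" "integrable lborel h" for h
  proof (intro choice allI)
    fix k
    obtain g M where g: "integrable lborel g" "g \<in> L2" "continuous_on UNIV g" "\<And>x. cmod (g x) \<le> M"
      "(LBINT x. cmod (h x - g x)) < 1 / Suc k" "energy (\<lambda>x. h x - g x) < 1 / Suc k"
      by (rule continuous_dense_L1_L2[OF h, of "1 / Suc k"]) auto
    show "\<exists>g. integrable lborel g \<and> g \<in> L2 \<and> \<F> g \<in> L2 \<and>
      energy (\<F> g) = energy g \<and>
      (LBINT x. cmod (h x - g x)) < 1 / Suc k \<and> energy (\<lambda>x. h x - g x) < 1 / Suc k"
      using bounded_case[OF g(1-4)] g by blast
  qed
  have lim0: "(\<lambda>k. 1 / real (Suc k)) \<longlonglongrightarrow> 0"
    using LIMSEQ_inverse_real_of_nat by (simp add: inverse_eq_divide)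
  have tendsto: "L2_tendsto g h"
    if "h \<in> L2" "\<And>k. g k \<in> L2" "\<And>k. energy (\<lambda>x. h x - g k x) < 1 / Suc k" for g h
    unfolding L2_tendsto_energy[OF that(2,1)] energy_diff_commute[of "g k" h for k]
    by (rule tendsto_sandwich[OF _ _ tendsto_const lim0])
       (use that(3) in \<open>auto intro!: always_eventually less_imp_le\<close>)
  have half: "\<F> h \<in> L2 \<and> energy (\<F> h) \<le> energy h"
    if h: "h \<in> L2" "integrable lborel h" for h
  proof -
    note [measurable] = L2_measurable[OF h(1)]
    obtain g where g: "\<And>k. integrable lborel (g k)" "\<And>k. g k \<in> L2" "\<And>k. \<F> (g k) \<in> L2"
      "\<And>k. energy (\<F> (g k)) = energy (g k)"
      "\<And>k. (LBINT x. cmod (h x - g k x)) < 1 / Suc k" "\<And>k. energy (\<lambda>x. h x - g k x) < 1 / Suc k"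
      using approx[OF h] by blast
    have en: "(\<lambda>k. energy (g k)) \<longlonglongrightarrow> energy h"
      by (rule energy_tendsto[OF g(2) h(1) tendsto[OF h(1) g(2) g(6)]])
    have pw: "(\<lambda>k. \<F> (g k) \<xi>) \<longlonglongrightarrow> \<F> h \<xi>" for \<xi>
    proof (rule Lim_transform2[OF tendsto_const])
      have "cmod (\<F> h \<xi> - \<F> (g k) \<xi>) \<le> 1 / Suc k" for k
        using cmod_fourier_integral_diff_le[OF h(2) g(1), of \<xi> k] g(5)[of k] by linarith
      then show "(\<lambda>k. \<F> h \<xi> - \<F> (g k) \<xi>) \<longlonglongrightarrow> 0"
        by (intro Lim_null_comparison[OF _ lim0]) (auto intro!: always_eventually)
    qed
    have "(\<integral>\<^sup>+ \<xi>. ennreal ((cmod (\<F> h \<xi>))\<^sup>2) \<partial>lborel)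
        = (\<integral>\<^sup>+ \<xi>. liminf (\<lambda>k. ennreal ((cmod (\<F> (g k) \<xi>))\<^sup>2)) \<partial>lborel)"
    proof (intro nn_integral_cong)
      fix \<xi>
      have "(\<lambda>k. ennreal ((cmod (\<F> (g k) \<xi>))\<^sup>2)) \<longlonglongrightarrow> ennreal ((cmod (\<F> h \<xi>))\<^sup>2)"
        by (intro tendsto_ennrealI tendsto_intros pw)
      then show "ennreal ((cmod (\<F> h \<xi>))\<^sup>2) = liminf (\<lambda>k. ennreal ((cmod (\<F> (g k) \<xi>))\<^sup>2))"
        using lim_imp_Liminf[OF sequentially_bot] by metis
    qed
    also have "\<dots> \<le> liminf (\<lambda>k. \<integral>\<^sup>+ \<xi>. ennreal ((cmod (\<F> (g k) \<xi>))\<^sup>2) \<partial>lborel)"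
      using g(3)[THEN L2_measurable] by (intro nn_integral_liminf) auto
    also have "\<dots> = liminf (\<lambda>k. ennreal (energy (g k)))"
      by (simp add: nn_integral_energy g)
    also have "\<dots> = ennreal (energy h)"
      by (rule lim_imp_Liminf[OF sequentially_bot tendsto_ennrealI[OF en]])
    finally show ?thesis using L2I_nn_integral[of "\<F> h" "energy h"] by auto
  qed
  show Ff: "\<F> f \<in> L2" using half[OF f] by simp
  obtain g where g: "\<And>k. integrable lborel (g k)" "\<And>k. g k \<in> L2" "\<And>k. \<F> (g k) \<in> L2"
      "\<And>k. energy (\<F> (g k)) = energy (g k)"
      "\<And>k. (LBINT x. cmod (f x - g k x)) < 1 / Suc k" "\<And>k. energy (\<lambda>x. f x - g k x) < 1 / Suc k"
    using approx[OF f] by blast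
  have "energy (\<lambda>\<xi>. \<F> f \<xi> - \<F> (g k) \<xi>) < 1 / Suc k" for k
    using half[OF L2_diff(1)[OF f(1) g(2)[of k]]] g(6)[of k] f(2) g(1)[of k]
    by (simp add: fourier_integral_diff_fun)
  then have "L2_tendsto (\<lambda>k. \<F> (g k)) (\<F> f)"
    by (intro tendsto Ff g)
  then have "(\<lambda>k. energy (g k)) \<longlonglongrightarrow> energy (\<F> f)"
    using energy_tendsto[OF g(3) Ff] by (simp add: g)
  moreover have "(\<lambda>k. energy (g k)) \<longlonglongrightarrow> energy f"
    by (rule energy_tendsto[OF g(2) f(1) tendsto[OF f(1) g(2) g(6)]])
  ultimately show "energy (\<F> f) = energy f" by (rule LIMSEQ_unique)
qed

text \<open>
  The argument of Riesz and Fischer: a rapidly converging subsequence converges almost everywhere, and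
  Fatou's lemma bounds the distance to its limit.
\<close>

theorem L2_complete:
  assumes u: "\<And>k. u k \<in> L2"
    and cauchy: "\<And>e. e > 0 \<Longrightarrow> \<exists>N. \<forall>m\<ge>N. \<forall>n\<ge>N. energy (\<lambda>x. u m x - u n x) < e"
  shows "\<exists>g\<in>L2. L2_tendsto u g"
proof -
  note [measurable] = u[THEN L2_measurable]
  have "\<exists>N. \<forall>k. \<forall>m\<ge>N k. \<forall>n\<ge>N k. energy (\<lambda>x. u m x - u n x) < (1/4) ^ k"
    by (intro choice allI cauchy) simp
  then obtain N where N: "\<And>k m n. m \<ge> N k \<Longrightarrow> n \<ge> N k \<Longrightarrow> energy (\<lambda>x. u m x - u n x) < (1/4) ^ k"
    by metis
  \<comment> \<open>Adding up the \<open>N i\<close> makes \<open>r\<close> increasing as well as at least \<open>N k\<close>.\<close>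
  define r where "r = (\<lambda>k. k + (\<Sum>i\<le>k. N i))"
  have rN: "N k \<le> r k" for k
    unfolding r_def by (intro trans_le_add2 member_le_sum) auto
  have rk: "k \<le> r k" for k by (simp add: r_def)
  have rSuc: "N k \<le> r (Suc k)" for k
  proof -
    have "r k \<le> r (Suc k)" by (simp add: r_def)
    then show ?thesis using rN[of k] by linarith
  qed
  define d where "d = (\<lambda>k x. u (r (Suc k)) x - u (r k) x)"
  have d: "d k \<in> L2" "energy (d k) < (1/4) ^ k" for k
    unfolding d_def using L2_diff(1)[OF u u] N[OF rSuc rN] by auto
  note [measurable] = d(1)[THEN L2_measurable]
  have "(\<integral>\<^sup>+ x. (\<Sum>k. ennreal (2 ^ k * (cmod (d k x))\<^sup>2)) \<partial>lborel)
      = (\<Sum>k. \<integral>\<^sup>+ x. ennreal (2 ^ k * (cmod (d k x))\<^sup>2) \<partial>lborel)"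
    by (rule nn_integral_suminf) measurable
  also have "\<dots> = (\<Sum>k. ennreal (2 ^ k * energy (d k)))"
    by (simp add: ennreal_mult nn_integral_cmult nn_integral_energy d)
  also have "\<dots> \<le> (\<Sum>k. ennreal ((1/2) ^ k))"
  proof (intro suminf_le ennreal_leI)
    fix k
    have "2 ^ k * energy (d k) \<le> 2 ^ k * (1/4) ^ k" using d(2)[of k] by simp
    also have "\<dots> = (1/2) ^ k" by (simp flip: power_mult_distrib)
    finally show "2 ^ k * energy (d k) \<le> (1/2) ^ k" .
  qed auto
  also have "\<dots> = ennreal (\<Sum>k. (1/2) ^ k)" by (rule suminf_ennreal2) auto
  also have "\<dots> < \<infinity>" by simp
  finally have "AE x in lborel. (\<Sum>k. ennreal (2 ^ k * (cmod (d k x))\<^sup>2)) \<noteq> \<infinity>"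
    by (intro nn_integral_PInf_AE) auto
  then have conv: "AE x in lborel. convergent (\<lambda>k. u (r k) x)"
  proof eventually_elim
    fix x assume "(\<Sum>k. ennreal (2 ^ k * (cmod (d k x))\<^sup>2)) \<noteq> \<infinity>"
    then have s: "summable (\<lambda>k. 2 ^ k * (cmod (d k x))\<^sup>2)"
      by (intro summable_suminf_not_top) auto
    have "summable (\<lambda>k. d k x)"
    proof (rule summable_norm_cancel, rule summable_comparison_test')
      show "summable (\<lambda>k. 2 ^ k * (cmod (d k x))\<^sup>2 + (1/2) ^ k)"
        by (intro summable_add s) (auto intro: summable_geometric)
      fix k :: nat
      \<comment> \<open>The inequality \<open>2 * a \<le> 2 ^ k * a\<^sup>2 + (1/2) ^ k\<close> derives absolute convergence from convergence of the
        weighted squares.\<close>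
      define a where "a = cmod (d k x)"
      have "0 \<le> 2 ^ k * (a - (1/2) ^ k)\<^sup>2" by simp
      also have "\<dots> = 2 ^ k * a\<^sup>2 - 2 * a * (2 ^ k * (1/2) ^ k) + 2 ^ k * (1/2) ^ k * (1/2) ^ k"
        by (simp add: power2_diff power2_eq_square algebra_simps)
      also have "2 ^ k * (1/2) ^ k = (1::real)" by (simp flip: power_mult_distrib)
      finally have "2 * a \<le> 2 ^ k * a\<^sup>2 + (1/2) ^ k" by simp
      moreover have "0 \<le> a" by (simp add: a_def)
      ultimately have "a \<le> 2 ^ k * a\<^sup>2 + (1/2) ^ k" by linarith
      then show "norm (norm (d k x)) \<le> 2 ^ k * (cmod (d k x))\<^sup>2 + (1/2) ^ k"
        by (simp add: a_def)
    qed
    then have "convergent (\<lambda>n. \<Sum>k<n. d k x)" by (simp add: summable_iff_convergent)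
    then have "convergent (\<lambda>n. u (r n) x - u (r 0) x)"
      unfolding d_def sum_lessThan_telescope[of "\<lambda>n. u (r n) x"] .
    then show "convergent (\<lambda>k. u (r k) x)" by (simp add: convergent_diff_const_right_iff)
  qed
  define g where "g = (\<lambda>x. lim (\<lambda>k. u (r k) x))"
  have [measurable]: "g \<in> borel_measurable lborel" unfolding g_def by measurable
  have close: "(\<lambda>x. u m x - g x) \<in> L2 \<and> energy (\<lambda>x. u m x - g x) \<le> (1/4) ^ k" if m: "m \<ge> N k" for m k
  proof -
    have "(\<integral>\<^sup>+ x. ennreal ((cmod (u m x - g x))\<^sup>2) \<partial>lborel)
        = (\<integral>\<^sup>+ x. liminf (\<lambda>j. ennreal ((cmod (u m x - u (r j) x))\<^sup>2)) \<partial>lborel)"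
    proof (intro nn_integral_cong_AE, use conv in eventually_elim)
      fix x assume "convergent (\<lambda>k. u (r k) x)"
      then have "(\<lambda>k. u (r k) x) \<longlonglongrightarrow> g x" unfolding g_def by (simp add: convergent_LIMSEQ_iff)
      then have "(\<lambda>j. ennreal ((cmod (u m x - u (r j) x))\<^sup>2)) \<longlonglongrightarrow> ennreal ((cmod (u m x - g x))\<^sup>2)"
        by (intro tendsto_ennrealI tendsto_intros)
      then show "ennreal ((cmod (u m x - g x))\<^sup>2) = liminf (\<lambda>j. ennreal ((cmod (u m x - u (r j) x))\<^sup>2))"
        using lim_imp_Liminf[OF sequentially_bot] by metis
    qed
    also have "\<dots> \<le> liminf (\<lambda>j. \<integral>\<^sup>+ x. ennreal ((cmod (u m x - u (r j) x))\<^sup>2) \<partial>lborel)"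
      by (intro nn_integral_liminf) auto
    also have "\<dots> = liminf (\<lambda>j. ennreal (energy (\<lambda>x. u m x - u (r j) x)))"
      by (simp add: nn_integral_energy[OF L2_diff(1)[OF u u]])
    also have "\<dots> \<le> ennreal ((1/4) ^ k)"
    proof -
      have "\<forall>\<^sub>F j in sequentially. ennreal (energy (\<lambda>x. u m x - u (r j) x)) \<le> ennreal ((1/4) ^ k)"
        using N[OF m, of "r j" for j] rk
        by (intro eventually_sequentiallyI[of "N k"] ennreal_leI less_imp_le) (meson le_trans)
      then have "liminf (\<lambda>j. ennreal (energy (\<lambda>x. u m x - u (r j) x))) \<le> liminf (\<lambda>j::nat. ennreal ((1/4) ^ k))"
        by (rule Liminf_mono)
      then show ?thesis by (simp add: Liminf_const)
    qed
    finally show ?thesis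
      using L2I_nn_integral[of "\<lambda>x. u m x - g x" "(1/4) ^ k"] by auto
  qed
  have "(\<lambda>x. u (N 0) x - (u (N 0) x - g x)) \<in> L2"
    by (intro L2_diff(1) u close[OF order_refl, THEN conjunct1])
  then have gL2: "g \<in> L2" by simp
  moreover have "L2_tendsto u g"
    unfolding L2_tendsto_energy[OF u gL2]
  proof (rule LIMSEQ_I)
    fix e :: real assume "e > 0"
    then obtain k where k: "(1/4) ^ k < e" using real_arch_pow_inv[of e "1/4"] by auto
    then show "\<exists>no. \<forall>n\<ge>no. norm (energy (\<lambda>x. u n x - g x) - 0) < e"
      using close by (intro exI[of _ "N k"]) (auto intro: le_less_trans)
  qed
  ultimately show ?thesis by blast
qed

lemma L2_tendsto_truncate:
  assumes f: "f \<in> L2"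
  shows "L2_tendsto (\<lambda>k x. f x * indicator {- real k..real k} x) f"
proof -
  note [measurable] = L2_measurable[OF f]
  have "(\<lambda>k. LBINT x. (cmod (f x * indicator {- real k..real k} x - f x))\<^sup>2) \<longlonglongrightarrow> (LINT x|(lborel :: real measure). (0::real))"
  proof (rule integral_dominated_convergence[where w="\<lambda>x. (cmod (f x))\<^sup>2"])
    show "AE x in lborel. (\<lambda>k. (cmod (f x * indicator {- real k..real k} x - f x))\<^sup>2) \<longlonglongrightarrow> 0"
    proof (intro AE_I2 tendsto_eventually)
      fix x
      obtain N where N: "\<bar>x\<bar> \<le> real N" using real_arch_simple by blast
      then show "\<forall>\<^sub>F k in sequentially. (cmod (f x * indicator {- real k..real k} x - f x))\<^sup>2 = 0"
        by (intro eventually_sequentiallyI[of N]) (auto simp: indicator_def)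
    qed
  qed (use L2_integrable[OF f] in \<open>auto simp: indicator_def\<close>)
  then show ?thesis
    using L2_tendsto_energy[OF L2_indicator[OF f] f, of "\<lambda>k. {- real k..real k}"] by (simp add: energy_def)
qed

text \<open>
  The Fourier integrals of the truncations form a Cauchy sequence by Plancherel's theorem.
\<close>

lemma is_fourier_L2_exists:
  assumes f: "f \<in> L2" shows "\<exists>g. is_fourier_L2 f g"
proof -
  define u where "u = (\<lambda>k x. f x * indicator {- real k..real k} x)"
  have u: "u k \<in> L2" "integrable lborel (u k)" for k
    unfolding u_def by (auto intro!: L2_indicator L2_interval_integrable f)
  have uf: "L2_tendsto u f" unfolding u_def by (rule L2_tendsto_truncate[OF f])
  then have lim: "(\<lambda>k. energy (\<lambda>x. u k x - f x)) \<longlonglongrightarrow> 0"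
    unfolding L2_tendsto_energy[OF u(1) f] .
  have "\<exists>g\<in>L2. L2_tendsto (\<lambda>k. \<F> (u k)) g"
  proof (rule L2_complete)
    show "\<F> (u k) \<in> L2" for k by (rule Plancherel_L1_L2(1)[OF u])
    fix e :: real assume "e > 0"
    then have "\<forall>\<^sub>F k in sequentially. energy (\<lambda>x. u k x - f x) < e / 4"
      using lim by (intro order_tendstoD(2)[of _ 0]) auto
    then obtain N where N: "\<And>k. k \<ge> N \<Longrightarrow> energy (\<lambda>x. u k x - f x) < e / 4"
      by (auto simp: eventually_sequentially)
    have "energy (\<lambda>\<xi>. \<F> (u m) \<xi> - \<F> (u n) \<xi>) < e" if "m \<ge> N" "n \<ge> N" for m n
    proof -
      have "energy (\<lambda>\<xi>. \<F> (u m) \<xi> - \<F> (u n) \<xi>)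
          = energy (\<F> (\<lambda>x. u m x - u n x))"
        by (simp add: fourier_integral_diff_fun u)
      also have "\<dots> = energy (\<lambda>x. (u m x - f x) - (u n x - f x))"
        using u by (subst Plancherel_L1_L2(2)[OF L2_diff(1)]) auto
      also have "\<dots> \<le> 2 * energy (\<lambda>x. u m x - f x) + 2 * energy (\<lambda>x. u n x - f x)"
        by (intro L2_diff u f)
      also have "\<dots> < e" using N[OF that(1)] N[OF that(2)] by linarith
      finally show ?thesis .
    qed
    then show "\<exists>N. \<forall>m\<ge>N. \<forall>n\<ge>N. energy (\<lambda>x. \<F> (u m) x - \<F> (u n) x) < e"
      by blast
  qed
  then show ?thesis using f u uf unfolding is_fourier_L2_def by blast
qed

lemma is_fourier_L2E:
  assumes "is_fourier_L2 f g"
  obtains u where "\<And>k. u k \<in> L2" "\<And>k. integrable lborel (u k)" "L2_tendsto u f"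
    "L2_tendsto (\<lambda>k. \<F> (u k)) g" "f \<in> L2" "g \<in> L2"
  using assms unfolding is_fourier_L2_def by blast

lemma is_fourier_L2_diff:
  assumes "is_fourier_L2 f g" "is_fourier_L2 f' g'"
  shows "is_fourier_L2 (\<lambda>x. f x - f' x) (\<lambda>x. g x - g' x)"
proof -
  obtain u where u: "\<And>k. u k \<in> L2" "\<And>k. integrable lborel (u k)" "L2_tendsto u f"
    "L2_tendsto (\<lambda>k. \<F> (u k)) g" and f: "f \<in> L2" "g \<in> L2"
    using assms(1) by (rule is_fourier_L2E) blast
  obtain u' where u': "\<And>k. u' k \<in> L2" "\<And>k. integrable lborel (u' k)" "L2_tendsto u' f'"
    "L2_tendsto (\<lambda>k. \<F> (u' k)) g'" and f': "f' \<in> L2" "g' \<in> L2"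
    using assms(2) by (rule is_fourier_L2E) blast
  have diff: "L2_tendsto (\<lambda>k x. v k x - v' k x) (\<lambda>x. h x - h' x)"
    if "L2_tendsto v h" "L2_tendsto v' h'" "\<And>k. v k \<in> L2" "\<And>k. v' k \<in> L2" "h \<in> L2" "h' \<in> L2" for v v' h h'
  proof -
    have swap: "(\<lambda>x. (v k x - v' k x) - (h x - h' x)) = (\<lambda>x. (v k x - h x) - (v' k x - h' x))" for k
      by (simp add: fun_eq_iff)
    have le: "energy (\<lambda>x. (v k x - v' k x) - (h x - h' x))
       \<le> 2 * energy (\<lambda>x. v k x - h x) + 2 * energy (\<lambda>x. v' k x - h' x)" for k
      unfolding swap by (intro L2_diff that)
    have "(\<lambda>k. 2 * energy (\<lambda>x. v k x - h x) + 2 * energy (\<lambda>x. v' k x - h' x)) \<longlonglongrightarrow> 2 * 0 + 2 * 0"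
      using that L2_tendsto_energy[OF that(3,5)] L2_tendsto_energy[OF that(4,6)]
      by (intro tendsto_intros) auto
    then have lim: "(\<lambda>k. 2 * energy (\<lambda>x. v k x - h x) + 2 * energy (\<lambda>x. v' k x - h' x)) \<longlonglongrightarrow> 0"
      by (simp only: mult_zero_right add_0)
    have "(\<lambda>k. energy (\<lambda>x. (v k x - v' k x) - (h x - h' x))) \<longlonglongrightarrow> 0"
      by (rule tendsto_sandwich[OF _ _ tendsto_const lim]) (intro always_eventually allI energy_nonneg le)+
    then show ?thesis
      by (subst L2_tendsto_energy) (auto intro!: L2_diff that)
  qed
  have "L2_tendsto (\<lambda>k. \<F> (\<lambda>x. u k x - u' k x)) (\<lambda>x. g x - g' x)"
    using diff[OF u(4) u'(4)] f f' Plancherel_L1_L2(1) u u'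
    by (simp add: fourier_integral_diff_fun)
  moreover have "L2_tendsto (\<lambda>k x. u k x - u' k x) (\<lambda>x. f x - f' x)"
    by (rule diff) (use u u' f f' in auto)
  ultimately show ?thesis
    unfolding is_fourier_L2_def using u u' f f'
    by (intro conjI exI[of _ "\<lambda>k x. u k x - u' k x"]) (auto intro!: L2_diff)
qed

lemma is_fourier_L2_energy:
  assumes "is_fourier_L2 f g" shows "energy g = energy f"
proof -
  obtain u where u: "\<And>k. u k \<in> L2" "\<And>k. integrable lborel (u k)" "L2_tendsto u f"
    "L2_tendsto (\<lambda>k. \<F> (u k)) g" and f: "f \<in> L2" "g \<in> L2"
    using assms(1) by (rule is_fourier_L2E) blast
  have "(\<lambda>k. energy (u k)) \<longlonglongrightarrow> energy g"
    using energy_tendsto[OF Plancherel_L1_L2(1)[OF u(1,2)] f(2) u(4)] by (simp add: Plancherel_L1_L2(2) u)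
  then show ?thesis using energy_tendsto[OF u(1) f(1) u(3)] LIMSEQ_unique by blast
qed

lemma is_fourier_L2_cong:
  assumes f: "is_fourier_L2 f g" and g': "g' \<in> borel_measurable lborel" "AE x in lborel. g x = g' x"
  shows "is_fourier_L2 f g'"
proof -
  obtain u where u: "\<And>k. u k \<in> L2" "\<And>k. integrable lborel (u k)" "L2_tendsto u f"
    "L2_tendsto (\<lambda>k. \<F> (u k)) g" and fg: "f \<in> L2" "g \<in> L2"
    using assms(1) by (rule is_fourier_L2E) blast
  have "(\<integral>\<^sup>+ x. ennreal ((cmod (\<F> (u k) x - g x))\<^sup>2) \<partial>lborel)
    = (\<integral>\<^sup>+ x. ennreal ((cmod (\<F> (u k) x - g' x))\<^sup>2) \<partial>lborel)" for k
    by (intro nn_integral_cong_AE, use g'(2) in eventually_elim) simp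
  then have "L2_tendsto (\<lambda>k. \<F> (u k)) g'" using u(4) by (simp add: L2_tendsto_def)
  then show ?thesis
    unfolding is_fourier_L2_def using u fg L2_cong_AE(1)[OF fg(2) g'] by blast
qed

lemma is_fourier_L2_fourier_L2: "f \<in> L2 \<Longrightarrow> is_fourier_L2 f (fourier_L2 f)"
  unfolding fourier_L2_def using is_fourier_L2_exists by (rule someI_ex)

lemma is_fourier_L2_unique:
  assumes "is_fourier_L2 f g" "is_fourier_L2 f g'" shows "AE x in lborel. g x = g' x"
proof -
  note d = is_fourier_L2_diff[OF assms]
  have "energy (\<lambda>x. g x - g' x) = 0" using is_fourier_L2_energy[OF d] by (simp add: energy_def)
  then have "AE x in lborel. g x - g' x = 0"
    using d by (intro energy_zero_imp_AE) (auto simp: is_fourier_L2_def)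
  then show ?thesis by simp
qed

lemma is_fourier_L2_inj:
  assumes "is_fourier_L2 f g" "is_fourier_L2 f' g" shows "AE x in lborel. f x = f' x"
proof -
  note d = is_fourier_L2_diff[OF assms]
  have "energy (\<lambda>x. f x - f' x) = 0" using is_fourier_L2_energy[OF d] by (simp add: energy_def)
  then have "AE x in lborel. f x - f' x = 0"
    using d by (intro energy_zero_imp_AE) (auto simp: is_fourier_L2_def)
  then show ?thesis by simp
qed

lemma is_fourier_L2_integral:
  assumes "f \<in> L2" "integrable lborel f" shows "is_fourier_L2 f (\<F> f)"
  unfolding is_fourier_L2_def using assms Plancherel_L1_L2(1)[OF assms]
  by (intro conjI exI[of _ "\<lambda>_. f"]) (auto simp: L2_tendsto_def)

section \<open>The localization operator as an integral operator\<close>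

lemma energy_reflect: "energy (\<lambda>x. f (- x)) = energy f"
  unfolding energy_def
  using lborel_integral_real_affine[of "-1" "\<lambda>x. (cmod (f x))\<^sup>2" 0] by simp

lemma L2_reflect:
  assumes "f \<in> L2" shows "(\<lambda>x. f (- x)) \<in> L2"
  using assms lborel_integrable_real_affine[OF L2_integrable[OF assms], of "-1" 0]
  by (auto simp: L2_def)

lemma fourier_integral_cnj: "\<F> (\<lambda>x. cnj (h x)) \<xi> = cnj (\<F> h (- \<xi>))"
  unfolding fourier_integral_cis Bochner_Integration.integral_cnj[symmetric] by (simp add: cis_cnj)

text \<open>
  Let \<open>g\<close> be the Fourier transform of the candidate \<open>f0\<close>. The multiplication formula and
  approximation show that the inner product of \<open>g\<close> and \<open>h\<close> is the energy of \<open>f0\<close>. As \<open>g\<close>, \<open>h\<close> and \<open>f0\<close> all have the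
  same energy, \<open>g\<close> and \<open>h\<close> agree.
\<close>

lemma is_fourier_L2_inverse:
  assumes h: "h \<in> L2" "integrable lborel h"
  shows "is_fourier_L2 (\<lambda>x. \<F> h (- x)) h"
proof -
  define f0 where "f0 = (\<lambda>x. \<F> h (- x))"
  have f0: "f0 \<in> L2" unfolding f0_def by (rule L2_reflect[OF Plancherel_L1_L2(1)[OF h]])
  have e0: "energy f0 = energy h"
    unfolding f0_def energy_reflect by (rule Plancherel_L1_L2(2)[OF h])
  obtain g where fg: "is_fourier_L2 f0 g" using is_fourier_L2_exists[OF f0] by blast
  then obtain u where u: "\<And>k. u k \<in> L2" "\<And>k. integrable lborel (u k)" "L2_tendsto u f0"
    "L2_tendsto (\<lambda>k. \<F> (u k)) g" and g: "g \<in> L2"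
    unfolding is_fourier_L2_def by blast
  have dual: "re_inner (\<F> (u k)) h = re_inner (u k) f0" for k
  proof -
    have "integrable lborel (\<lambda>x. cnj (h x))" using h(2) by simp
    from fourier_integral_multiplication[OF u(2) this, of k]
    show ?thesis by (simp add: re_inner_def f0_def fourier_integral_cnj)
  qed
  have "(\<lambda>k. re_inner (\<F> (u k)) h) \<longlonglongrightarrow> re_inner g h"
    by (rule re_inner_tendsto[OF _ g u(4) h(1)]) (rule Plancherel_L1_L2(1)[OF u(1,2)])
  moreover have "(\<lambda>k. re_inner (\<F> (u k)) h) \<longlonglongrightarrow> re_inner f0 f0"
    unfolding dual by (rule re_inner_tendsto[OF u(1) f0 u(3) f0])
  ultimately have "re_inner g h = re_inner f0 f0" by (rule LIMSEQ_unique)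
  also have "\<dots> = energy f0"
    using energy_polarization[OF f0 f0] by (simp add: energy_def)
  finally have "energy (\<lambda>x. g x - h x) = 0"
    using energy_polarization[OF g h(1)] is_fourier_L2_energy[OF fg] e0 by simp
  then have "AE x in lborel. g x - h x = 0"
    by (intro energy_zero_imp_AE L2_diff g h)
  then have "AE x in lborel. g x = h x" by simp
  then show ?thesis
    using is_fourier_L2_cong[OF fg L2_measurable[OF h(1)]] by (simp add: f0_def)
qed

text \<open>
  The choice in \<open>inv_fourier_L2\<close> ranges over all of \<open>L\<^sup>2\<close>; its result is determined because
  every element of \<open>L\<^sup>2\<close> has a Fourier transform with the same energy.
\<close>

lemma inv_fourier_L2_eq:
  assumes h: "h \<in> L2" "integrable lborel h" and ae: "AE \<xi> in lborel. h1 \<xi> = h \<xi>"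
  shows "AE x in lborel. inv_fourier_L2 h1 x = \<F> h (- x)"
proof -
  define f0 where "f0 = (\<lambda>x. \<F> h (- x))"
  have f0h: "is_fourier_L2 f0 h" unfolding f0_def by (rule is_fourier_L2_inverse[OF h])
  then have f0: "f0 \<in> L2" by (simp add: is_fourier_L2_def)
  have "AE \<xi> in lborel. fourier_L2 f0 \<xi> = h1 \<xi>"
    using is_fourier_L2_unique[OF is_fourier_L2_fourier_L2[OF f0] f0h] ae by eventually_elim simp
  with f0 have "\<exists>f. f \<in> L2 \<and> (AE \<xi> in lborel. fourier_L2 f \<xi> = h1 \<xi>)" by blast
  then have s: "inv_fourier_L2 h1 \<in> L2 \<and> (AE \<xi> in lborel. fourier_L2 (inv_fourier_L2 h1) \<xi> = h1 \<xi>)"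
    unfolding inv_fourier_L2_def by (rule someI_ex)
  then have "AE \<xi> in lborel. fourier_L2 (inv_fourier_L2 h1) \<xi> = h \<xi>"
    using ae by (auto elim: eventually_elim2)
  then have "is_fourier_L2 (inv_fourier_L2 h1) h"
    using s by (intro is_fourier_L2_cong[OF is_fourier_L2_fourier_L2 L2_measurable[OF h(1)]]) auto
  from is_fourier_L2_inj[OF this f0h] show ?thesis by (simp add: f0_def)
qed

text \<open>
  For \<open>z \<noteq> 0\<close> this is \<open>sin (2 * pi * z * r) / (pi * z)\<close>, see \<open>band_kernel_sin\<close>. The integral form gives bounds and
  continuity at \<open>z = 0\<close> without a case distinction.
\<close>

definition band_kernel :: "real \<Rightarrow> real \<Rightarrow> real" where
  "band_kernel r z = (LBINT \<xi>. indicator {- r..r} \<xi> * cos (2 * pi * z * \<xi>))"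

lemma integrable_indicator_bounded:
  fixes g :: "real \<Rightarrow> 'b::{banach, second_countable_topology, real_normed_algebra_1}"
  assumes [measurable]: "g \<in> borel_measurable lborel" and "\<And>x. norm (g x) \<le> M"
  shows "integrable lborel (\<lambda>x. indicator {a..b} x * g x)"
proof (rule Bochner_Integration.integrable_bound)
  show "integrable lborel (\<lambda>x. M * indicator {a..b} x)"
    by (intro integrable_mult_right integrable_real_indicator) (auto simp: emeasure_lborel_Icc_eq)
  show "AE x in lborel. norm (indicator {a..b} x * g x) \<le> norm (M * indicator {a..b} x)"
    using assms(2) by (intro AE_I2) (auto simp: indicator_def intro: order_trans[OF _ abs_ge_self])
  show "(\<lambda>x. indicator {a..b} x * g x) \<in> borel_measurable lborel" by measurable
qed

lemma band_kernel_complex: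
  "complex_of_real (band_kernel r z) = (LBINT \<xi>. indicator {- r..r} \<xi> * cis (2 * pi * z * \<xi>))"
proof -
  have i: "integrable lborel (\<lambda>\<xi>. indicator {- r..r} \<xi> * cis (2 * pi * z * \<xi>))"
    by (rule integrable_indicator_bounded[where M=1]) auto
  have Re: "Re (LBINT \<xi>. indicator {- r..r} \<xi> * cis (2 * pi * z * \<xi>)) = band_kernel r z"
    unfolding band_kernel_def integral_Re[OF i, symmetric]
    by (intro Bochner_Integration.integral_cong) (auto simp: indicator_def)
  have "Im (LBINT \<xi>. indicator {- r..r} \<xi> * cis (2 * pi * z * \<xi>))
      = (LBINT \<xi>. indicator {- r..r} \<xi> * sin (2 * pi * z * \<xi>))" (is "_ = ?S")
    unfolding integral_Im[OF i, symmetric]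
    by (intro Bochner_Integration.integral_cong) (auto simp: indicator_def)
  also have "?S = (LBINT \<xi>. indicator {- r..r} (0 + (- 1) * \<xi>) * sin (2 * pi * z * (0 + (- 1) * \<xi>)))"
    using lborel_integral_real_affine[of "-1" "\<lambda>\<xi>. indicator {- r..r} \<xi> * sin (2 * pi * z * \<xi>)" 0] by simp
  also have "\<dots> = (LBINT \<xi>. - (indicator {- r..r} \<xi> * sin (2 * pi * z * \<xi>)))"
    by (intro Bochner_Integration.integral_cong) (auto simp: indicator_def)
  also have "\<dots> = - ?S" by simp
  finally have "Im (LBINT \<xi>. indicator {- r..r} \<xi> * cis (2 * pi * z * \<xi>)) = 0"
    using \<open>Im _ = ?S\<close> by simp
  with Re show ?thesis by (simp add: complex_eq_iff)
qed

definition band_limit :: "real \<Rightarrow> (real \<Rightarrow> complex) \<Rightarrow> real \<Rightarrow> complex" where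
  "band_limit r g x = (LBINT y. g y * of_real (band_kernel r (x - y)))"

lemma band_limit_eq_fourier:
  assumes u: "integrable lborel u"
  shows "\<F> (\<lambda>\<xi>. \<F> u \<xi> * indicator {- r..r} \<xi>) (- x)
    = band_limit r u x"
proof -
  define v where "v = (\<lambda>\<xi>. indicator {- r..r} \<xi> * cis (2 * pi * x * \<xi>))"
  have v: "integrable lborel v"
    unfolding v_def by (rule integrable_indicator_bounded[where M=1]) auto
  have "\<F> (\<lambda>\<xi>. \<F> u \<xi> * indicator {- r..r} \<xi>) (- x)
      = (LBINT \<xi>. \<F> u \<xi> * v \<xi>)"
    unfolding fourier_integral_cis[of "\<lambda>\<xi>. \<F> u \<xi> * indicator {- r..r} \<xi>"] v_def
    by (simp add: mult_ac)
  also have "\<dots> = (LBINT y. u y * \<F> v y)"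
    by (rule fourier_integral_multiplication[OF u v])
  also have "\<F> v = (\<lambda>y. of_real (band_kernel r (x - y)))"
    unfolding band_kernel_complex fourier_integral_cis v_def
    by (simp add: mult.assoc cis_mult algebra_simps)
  finally show ?thesis by (simp only: band_limit_def)
qed

theorem S_op_eq_band_limit:
  assumes f: "f \<in> L2"
  shows "AE x in lborel. S_op {- r..r} {- r..r} f x =
    band_limit r (\<lambda>y. f y * indicator {- r..r} y) x * indicator {- r..r} x"
proof -
  define u where "u = (\<lambda>y. f y * indicator {- r..r} y)"
  have u: "u \<in> L2" "integrable lborel u"
    unfolding u_def by (auto intro!: L2_indicator f L2_interval_integrable)
  define h where "h = (\<lambda>\<xi>. \<F> u \<xi> * indicator {- r..r} \<xi>)"
  have h: "h \<in> L2" "integrable lborel h"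
    unfolding h_def by (auto intro!: L2_indicator L2_interval_integrable Plancherel_L1_L2 u)
  have "AE \<xi> in lborel. P_op {- r..r} (fourier_L2 u) \<xi> = h \<xi>"
    using is_fourier_L2_unique[OF is_fourier_L2_fourier_L2[OF u(1)] is_fourier_L2_integral[OF u]]
    by eventually_elim (simp add: P_op_def h_def)
  from inv_fourier_L2_eq[OF h this]
  show ?thesis
    by eventually_elim
      (simp add: S_op_def Q_op_def P_op_def h_def u_def[symmetric] band_limit_eq_fourier[OF u(2)])
qed

text \<open>
  In the energy picture the operator is multiplication by the indicator of the band. Symmetry and
  positivity can be read off, and the quadratic form is the energy inside the band.
\<close>

lemma band_limit_form:
  assumes u: "integrable lborel u" and v: "integrable lborel v"
  shows "(LBINT x. band_limit r u x * cnj (v x))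
    = (LBINT \<xi>. indicator {- r..r} \<xi> * (\<F> u \<xi> * cnj (\<F> v \<xi>)))"
proof -
  define h where "h = (\<lambda>\<xi>. \<F> u \<xi> * indicator {- r..r} \<xi>)"
  have [measurable]: "u \<in> borel_measurable lborel" using u by auto
  have h: "integrable lborel h"
    unfolding h_def mult.commute[of "\<F> u _"]
    by (rule integrable_indicator_bounded[OF _ norm_fourier_integral_le]) measurable
  have v': "integrable lborel (\<lambda>x. cnj (v (- x)))"
    using lborel_integrable_real_affine[OF v, of "-1" 0] by simp
  have "(LBINT x. band_limit r u x * cnj (v x))
     = (LBINT x. \<F> h (- x) * cnj (v x))"
    unfolding h_def band_limit_eq_fourier[OF u] ..
  also have "\<dots> = (LBINT x. \<F> h x * cnj (v (- x)))"
    using lborel_integral_real_affine[of "-1" "\<lambda>x. \<F> h (- x) * cnj (v x)" 0] by simp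
  also have "\<dots> = (LBINT \<xi>. h \<xi> * \<F> (\<lambda>x. cnj (v (- x))) \<xi>)"
    by (rule fourier_integral_multiplication[OF h v'])
  also have "\<dots> = (LBINT \<xi>. indicator {- r..r} \<xi> * (\<F> u \<xi> * cnj (\<F> v \<xi>)))"
  proof (intro Bochner_Integration.integral_cong refl)
    fix \<xi>
    have "\<F> (\<lambda>x. cnj (v (- x))) \<xi> = cnj (\<F> v \<xi>)"
      using cnj_fourier_integral_cis[of v \<xi> 0] by simp
    then show "h \<xi> * \<F> (\<lambda>x. cnj (v (- x))) \<xi>
        = indicator {- r..r} \<xi> * (\<F> u \<xi> * cnj (\<F> v \<xi>))"
      by (simp add: h_def mult_ac)
  qed
  finally show ?thesis .
qed

section \<open>The operator on bounded continuous functions\<close>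

lemma cnj_indicator [simp]: "cnj (indicator A x) = indicator A x"
  by (simp add: indicator_def)

lemma abs_cos_diff_le: "\<bar>cos a - cos b\<bar> \<le> \<bar>a - b\<bar>" for a b :: real
proof -
  have "\<bar>cos a - cos b\<bar> = 2 * \<bar>sin ((a + b) / 2)\<bar> * \<bar>sin ((b - a) / 2)\<bar>"
    unfolding cos_diff_cos by (simp add: abs_mult)
  also have "\<dots> \<le> 2 * 1 * \<bar>(b - a) / 2\<bar>"
    by (intro mult_mono abs_sin_le_one abs_sin_x_le_abs_x) auto
  finally show ?thesis by simp
qed

lemma integrable_band_kernel:
  "integrable lborel (\<lambda>\<xi>. indicator {- r..r} \<xi> * cos (2 * pi * z * \<xi>))"
  by (rule integrable_indicator_bounded[where M=1]) auto

lemma band_kernel_le: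
  assumes "r \<ge> 0" shows "\<bar>band_kernel r z\<bar> \<le> 2 * r"
proof -
  have "norm (band_kernel r z) \<le> (LBINT \<xi>. indicator {- r..r} \<xi>)"
    unfolding band_kernel_def
  proof (rule Bochner_Integration.integral_norm_bound_integral)
    show "integrable lborel (indicator {- r..r} :: real \<Rightarrow> real)"
      by (intro integrable_real_indicator) (auto simp: emeasure_lborel_Icc_eq)
    show "integrable lborel (\<lambda>\<xi>. indicator {- r..r} \<xi> * cos (2 * pi * z * \<xi>))"
      by (rule integrable_band_kernel)
  qed (auto simp: indicator_def)
  also have "\<dots> = 2 * r" using assms by simp
  finally show ?thesis by simp
qed

lemma band_kernel_Lipschitz:
  assumes "r \<ge> 0" shows "\<bar>band_kernel r z - band_kernel r z'\<bar> \<le> 4 * pi * r\<^sup>2 * \<bar>z - z'\<bar>"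
proof -
  have "norm (LBINT \<xi>. indicator {- r..r} \<xi> * cos (2 * pi * z * \<xi>) - indicator {- r..r} \<xi> * cos (2 * pi * z' * \<xi>))
     \<le> (LBINT \<xi>. indicator {- r..r} \<xi> * (2 * pi * r * \<bar>z - z'\<bar>))"
  proof (rule Bochner_Integration.integral_norm_bound_integral)
    show "integrable lborel (\<lambda>\<xi>. indicator {- r..r} \<xi> * (2 * pi * r * \<bar>z - z'\<bar>))"
      by (rule integrable_indicator_bounded) auto
    fix \<xi>
    show "norm (indicator {- r..r} \<xi> * cos (2 * pi * z * \<xi>) - indicator {- r..r} \<xi> * cos (2 * pi * z' * \<xi>))
        \<le> indicator {- r..r} \<xi> * (2 * pi * r * \<bar>z - z'\<bar>)"
    proof (cases "\<xi> \<in> {- r..r}")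
      case True
      have "\<bar>cos (2 * pi * z * \<xi>) - cos (2 * pi * z' * \<xi>)\<bar> \<le> \<bar>2 * pi * z * \<xi> - 2 * pi * z' * \<xi>\<bar>"
        by (rule abs_cos_diff_le)
      also have "2 * pi * z * \<xi> - 2 * pi * z' * \<xi> = 2 * pi * \<xi> * (z - z')"
        by (simp add: algebra_simps)
      also have "\<bar>\<dots>\<bar> = 2 * pi * \<bar>\<xi>\<bar> * \<bar>z - z'\<bar>" by (simp add: abs_mult)
      also have "\<dots> \<le> 2 * pi * r * \<bar>z - z'\<bar>"
        using True by (intro mult_right_mono mult_left_mono) auto
      finally show ?thesis using True by simp
    qed simp
  qed (intro Bochner_Integration.integrable_diff integrable_band_kernel)
  also have "\<dots> = 2 * r * (2 * pi * r * \<bar>z - z'\<bar>)" using assms by simp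
  finally show ?thesis
    unfolding band_kernel_def
      Bochner_Integration.integral_diff[OF integrable_band_kernel integrable_band_kernel, symmetric]
    by (simp add: power2_eq_square mult_ac)
qed

lemma continuous_band_kernel: "r \<ge> 0 \<Longrightarrow> continuous_on UNIV (band_kernel r)"
proof (rule lipschitz_on_continuous_on[of "4 * pi * r\<^sup>2"], rule lipschitz_onI)
  assume "r \<ge> 0"
  then show "dist (band_kernel r x) (band_kernel r y) \<le> 4 * pi * r\<^sup>2 * dist x y" for x y
    using band_kernel_Lipschitz by (simp add: dist_real_def)
qed simp

lemma measurable_band_kernel [measurable (raw)]:
  "r \<ge> 0 \<Longrightarrow> f \<in> borel_measurable M \<Longrightarrow> (\<lambda>x. band_kernel r (f x)) \<in> borel_measurable M"
  by (rule borel_measurable_continuous_on[OF continuous_band_kernel])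

lemma measurable_bcontfun [measurable]: "apply_bcontfun u \<in> borel_measurable borel"
  by (intro borel_measurable_continuous_onI) simp

lemma integral_indicator_HK:
  fixes g :: "real \<Rightarrow> 'b::euclidean_space"
  assumes "integrable lborel (\<lambda>x. indicator {a..b} x *\<^sub>R g x)"
  shows "(LBINT x. indicator {a..b} x *\<^sub>R g x) = integral {a..b} g"
  using set_borel_integral_eq_integral(2)[of "{a..b}" g] assms
  by (simp add: set_integrable_def set_lebesgue_integral_def)

text \<open>
  The spectral theory is set up on real bounded continuous functions on the whole line, of which the form
  only sees the restriction to \<open>[-r, r]\<close>. The operator maps into this space, so that an
  eigenfunction on the interval comes with its continuation to the line.
\<close>

definition band_form :: "real \<Rightarrow> (real \<Rightarrow>\<^sub>C real) \<Rightarrow> (real \<Rightarrow>\<^sub>C real) \<Rightarrow> real" where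
  "band_form r u v = (LBINT x. indicator {- r..r} x * (u x * v x))"

definition energy_on :: "real set \<Rightarrow> (real \<Rightarrow> complex) \<Rightarrow> real" where
  "energy_on S f = (LBINT x. indicator S x * (cmod (f x))\<^sup>2)"

lemma energy_on_nonneg: "0 \<le> energy_on S f"
  unfolding energy_on_def by (intro integral_nonneg_AE) auto

lemma integrable_energy_on:
  assumes f: "f \<in> L2" and [measurable]: "S \<in> sets borel"
  shows "integrable lborel (\<lambda>x. indicator S x * (cmod (f x))\<^sup>2)"
proof -
  note [measurable] = L2_measurable[OF f]
  show ?thesis
    by (rule Bochner_Integration.integrable_bound[OF L2_integrable[OF f]]) (auto simp: indicator_def)
qed

lemma energy_split:
  assumes f: "f \<in> L2" and S: "S \<in> sets borel"
  shows "energy f = energy_on S f + energy_on (- S) f"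
proof -
  have i: "integrable lborel (\<lambda>x. indicator S x * (cmod (f x))\<^sup>2)"
    "integrable lborel (\<lambda>x. indicator (- S) x * (cmod (f x))\<^sup>2)"
    using S by (auto intro!: integrable_energy_on f)
  show ?thesis
    unfolding energy_def energy_on_def Bochner_Integration.integral_add[OF i, symmetric]
    by (intro Bochner_Integration.integral_cong) (auto simp: indicator_def)
qed

definition cutoff :: "real \<Rightarrow> (real \<Rightarrow>\<^sub>C real) \<Rightarrow> real \<Rightarrow> complex" where
  "cutoff r u x = of_real (indicator {- r..r} x * u x)"

definition band_op :: "real \<Rightarrow> (real \<Rightarrow>\<^sub>C real) \<Rightarrow> real \<Rightarrow>\<^sub>C real" where
  "band_op r u = Bcontfun (\<lambda>x. Re (band_limit r (cutoff r u) x))"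

lemma abs_bcontfun_le: "\<bar>apply_bcontfun u x\<bar> \<le> norm u" for u :: "real \<Rightarrow>\<^sub>C real"
  using norm_bounded[of u x] by simp

lemma integrable_band_form: "integrable lborel (\<lambda>x. indicator {- r..r} x * (apply_bcontfun u x * apply_bcontfun v x))"
  for u v :: "real \<Rightarrow>\<^sub>C real"
  by (rule integrable_indicator_bounded[where M="norm u * norm v"])
     (auto simp: abs_mult intro!: mult_mono abs_bcontfun_le)

lemma integrable_cutoff: "integrable lborel (cutoff r u)"
  unfolding cutoff_def of_real_mult of_real_indicator
  by (rule integrable_indicator_bounded[where M="norm u"]) (auto intro: abs_bcontfun_le)

lemma cutoff_simps:
  "cutoff r (c *\<^sub>R u) x = of_real c * cutoff r u x" "cutoff r (u + v) x = cutoff r u x + cutoff r v x"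
  "cutoff r u x * indicator {- r..r} x = cutoff r u x"
  by (auto simp: cutoff_def indicator_def)

lemma band_form_nonneg: "0 \<le> band_form r u u"
  unfolding band_form_def by (intro integral_nonneg_AE) auto

lemma band_form_add: "band_form r (u + v) w = band_form r u w + band_form r v w"
  unfolding band_form_def Bochner_Integration.integral_add[OF integrable_band_form integrable_band_form, symmetric]
  by (simp add: algebra_simps)

lemma band_form_scale: "band_form r (c *\<^sub>R u) w = c * band_form r u w"
  by (simp add: band_form_def mult_ac flip: integral_mult_right_zero)

lemma band_form_sum: "band_form r (\<Sum>i\<in>I. f i) w = (\<Sum>i\<in>I. band_form r (f i) w)"
proof -
  have "band_form r 0 w = 0" by (simp add: band_form_def)
  then show ?thesis by (induction I rule: infinite_finite_induct) (simp_all add: band_form_add)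
qed

lemma band_form_le:
  assumes r: "r \<ge> 0" and le: "\<And>x. x \<in> {- r..r} \<Longrightarrow> \<bar>apply_bcontfun u x\<bar> \<le> M"
  shows "band_form r u u \<le> 2 * r * M\<^sup>2"
proof -
  have "band_form r u u \<le> (LBINT x. indicator {- r..r} x * M\<^sup>2)"
    unfolding band_form_def
  proof (rule integral_mono[OF integrable_band_form])
    show "integrable lborel (\<lambda>x. indicator {- r..r} x * M\<^sup>2)"
      by (rule integrable_indicator_bounded[where M="\<bar>M\<^sup>2\<bar>"]) auto
    fix x
    show "indicator {- r..r} x * (u x * u x) \<le> indicator {- r..r} x * M\<^sup>2"
    proof (cases "x \<in> {- r..r}")
      case True
      have "\<bar>u x\<bar>\<^sup>2 \<le> M\<^sup>2" by (intro power_mono le True) simp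
      then show ?thesis using True by (simp add: power2_eq_square)
    qed simp
  qed
  then show ?thesis using r by simp
qed

text \<open>
  The Cauchy-Schwarz inequality between \<open>u\<close> and 1, from the nonnegative quadratic
  polynomial \<open>t \<mapsto> \<integral> (\<bar>u\<bar> + t)\<^sup>2\<close>.
\<close>

lemma L1_cutoff_le:
  assumes "r \<ge> 0" shows "(LBINT y. cmod (cutoff r u y)) \<le> sqrt (2 * r * band_form r u u)"
proof -
  let ?N = "LBINT y. cmod (cutoff r u y)"
  have "?N\<^sup>2 \<le> band_form r u u * (2 * r)"
  proof (rule quadratic_nonneg_imp_discriminant)
    fix t :: real
    have i: "integrable lborel (\<lambda>y. indicator {- r..r} y * t\<^sup>2)"
      by (rule integrable_indicator_bounded[where M="t\<^sup>2"]) auto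
    have "0 \<le> (LBINT y. indicator {- r..r} y * (\<bar>u y\<bar> + t)\<^sup>2)"
      by (intro integral_nonneg_AE) auto
    also have "\<dots> = (LBINT y. indicator {- r..r} y * (u y * u y)
        + 2 * t * cmod (cutoff r u y) + indicator {- r..r} y * t\<^sup>2)"
      by (intro Bochner_Integration.integral_cong) (auto simp: cutoff_def indicator_def power2_eq_square algebra_simps)
    also have "\<dots> = band_form r u u + 2 * t * ?N + 2 * r * t\<^sup>2"
      using assms i by (simp add: integrable_band_form integrable_cutoff band_form_def)
    finally show "0 \<le> band_form r u u + 2 * ?N * t + 2 * r * t\<^sup>2" by (simp add: mult_ac)
  qed (use assms in \<open>auto intro: band_form_nonneg\<close>)
  then show ?thesis by (intro real_le_rsqrt) (simp add: mult_ac)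
qed

context
  fixes r :: real assumes r: "r > 0"
begin

lemma integrable_band_limit:
  assumes "integrable lborel g"
  shows "integrable lborel (\<lambda>y. g y * complex_of_real (band_kernel r (x - y)))"
  using r by (intro integrable_mult_bounded[OF assms, where C="2 * r"]) (auto intro: band_kernel_le)

lemma band_limit_le:
  assumes g: "integrable lborel g"
  shows "cmod (band_limit r g x) \<le> 2 * r * (LBINT y. cmod (g y))"
proof -
  have "cmod (band_limit r g x) \<le> (LBINT y. 2 * r * cmod (g y))"
    unfolding band_limit_def
  proof (rule Bochner_Integration.integral_norm_bound_integral[OF integrable_band_limit[OF g]])
    fix y
    have "cmod (g y) * \<bar>band_kernel r (x - y)\<bar> \<le> cmod (g y) * (2 * r)"
      using r by (intro mult_left_mono band_kernel_le) auto
    then show "norm (g y * complex_of_real (band_kernel r (x - y))) \<le> 2 * r * cmod (g y)"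
      by (simp add: norm_mult mult_ac)
  qed (use g in auto)
  then show ?thesis by simp
qed

lemma band_limit_Lipschitz:
  assumes g: "integrable lborel g"
  shows "cmod (band_limit r g x - band_limit r g x')
    \<le> 4 * pi * r\<^sup>2 * (LBINT y. cmod (g y)) * \<bar>x - x'\<bar>"
proof -
  note i = integrable_band_limit[OF g]
  have "cmod (LBINT y. g y * complex_of_real (band_kernel r (x - y)) - g y * complex_of_real (band_kernel r (x' - y)))
     \<le> (LBINT y. 4 * pi * r\<^sup>2 * \<bar>x - x'\<bar> * cmod (g y))"
  proof (rule Bochner_Integration.integral_norm_bound_integral)
    fix y
    have "cmod (g y) * \<bar>band_kernel r (x - y) - band_kernel r (x' - y)\<bar>
        \<le> cmod (g y) * (4 * pi * r\<^sup>2 * \<bar>(x - y) - (x' - y)\<bar>)"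
      using r by (intro mult_left_mono band_kernel_Lipschitz) auto
    then show "norm (g y * complex_of_real (band_kernel r (x - y)) - g y * complex_of_real (band_kernel r (x' - y)))
        \<le> 4 * pi * r\<^sup>2 * \<bar>x - x'\<bar> * cmod (g y)"
      by (simp add: norm_mult mult_ac flip: right_diff_distrib of_real_diff)
  qed (use g in \<open>auto intro!: Bochner_Integration.integrable_diff i\<close>)
  then show ?thesis
    unfolding Bochner_Integration.integral_diff[OF i i] integral_mult_right_zero
    by (simp add: band_limit_def mult_ac)
qed

lemma band_limit_bcontfun:
  assumes g: "integrable lborel g" shows "band_limit r g \<in> bcontfun"
proof (rule bcontfun_normI)
  have "0 \<le> (LBINT y. cmod (g y))" by simp
  then show "continuous_on UNIV (band_limit r g)"
    using band_limit_Lipschitz[OF g]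
    by (intro lipschitz_on_continuous_on[of "4 * pi * r\<^sup>2 * (LBINT y. cmod (g y))"] lipschitz_onI)
       (auto simp: dist_norm)
qed (rule band_limit_le[OF g])

lemma band_op_complex: "complex_of_real (band_op r u x) = band_limit r (cutoff r u) x"
proof -
  obtain w where w: "band_limit r (cutoff r u) = apply_bcontfun w"
    using band_limit_bcontfun[OF integrable_cutoff] by (rule bcontfunE)
  have "(\<lambda>x. Re (band_limit r (cutoff r u) x)) \<in> bcontfun"
    unfolding w by (rule bcontfun_normI[where b="norm w"])
      (auto intro!: continuous_intros order_trans[OF abs_Re_le_cmod norm_bounded])
  then have "band_op r u x = Re (band_limit r (cutoff r u) x)"
    by (simp add: band_op_def Bcontfun_inverse)
  moreover have "band_limit r (cutoff r u) x \<in> \<real>"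
    unfolding band_limit_def cutoff_def of_real_mult[symmetric] integral_complex_of_real by simp
  ultimately show ?thesis by (simp add: of_real_Re)
qed

lemma band_form_complex:
  "complex_of_real (band_form r (band_op r u) v)
    = (LBINT \<xi>. indicator {- r..r} \<xi> * (\<F> (cutoff r u) \<xi> * cnj (\<F> (cutoff r v) \<xi>)))"
  unfolding band_limit_form[OF integrable_cutoff integrable_cutoff, symmetric] band_op_complex[symmetric]
  unfolding band_form_def cutoff_def
  by (simp flip: integral_complex_of_real add: mult_ac)

lemma band_form_op_eq:
  "band_form r (band_op r u) u = energy_on {- r..r} (\<F> (cutoff r u))"
proof -
  have "complex_of_real (band_form r (band_op r u) u)
      = (LBINT \<xi>. complex_of_real (indicator {- r..r} \<xi> * (cmod (\<F> (cutoff r u) \<xi>))\<^sup>2))"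
    unfolding band_form_complex of_real_mult complex_norm_square of_real_indicator ..
  then show ?thesis by (simp only: energy_on_def integral_complex_of_real of_real_eq_iff)
qed

lemma band_op_sym: "band_form r (band_op r u) v = band_form r u (band_op r v)"
proof -
  have "complex_of_real (band_form r (band_op r u) v) = cnj (complex_of_real (band_form r (band_op r v) u))"
    unfolding band_form_complex Bochner_Integration.integral_cnj[symmetric] by (simp add: mult_ac)
  then have "band_form r (band_op r u) v = band_form r (band_op r v) u" by simp
  then show ?thesis by (simp add: band_form_def mult.commute)
qed

lemma linear_band_op: "linear (band_op r)"
proof (rule linearI; rule bcontfun_eqI)
  note i = integrable_band_limit[OF integrable_cutoff]
  fix u v :: "real \<Rightarrow>\<^sub>C real" and c x :: real
  have "complex_of_real (band_op r (u + v) x) = of_real (band_op r u x + band_op r v x)"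
    unfolding of_real_add band_op_complex by (simp add: band_limit_def cutoff_simps distrib_right i)
  then show "band_op r (u + v) x = apply_bcontfun (band_op r u + band_op r v) x"
    unfolding of_real_eq_iff by simp
  have "complex_of_real (band_op r (c *\<^sub>R u) x) = of_real (c * band_op r u x)"
    unfolding of_real_mult band_op_complex by (simp add: band_limit_def cutoff_simps mult.assoc)
  then show "band_op r (c *\<^sub>R u) x = apply_bcontfun (c *\<^sub>R band_op r u) x"
    unfolding of_real_eq_iff by simp
qed

lemma band_op_abs_le: "\<bar>band_op r u x\<bar> \<le> 2 * r * sqrt (2 * r * band_form r u u)"
proof -
  have "\<bar>band_op r u x\<bar> = cmod (band_limit r (cutoff r u) x)"
    unfolding band_op_complex[symmetric] by simp
  also have "\<dots> \<le> 2 * r * (LBINT y. cmod (cutoff r u y))"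
    by (rule band_limit_le[OF integrable_cutoff])
  also have "\<dots> \<le> 2 * r * sqrt (2 * r * band_form r u u)"
    using r by (intro mult_left_mono L1_cutoff_le) auto
  finally show ?thesis .
qed

lemma band_op_Lipschitz:
  "\<bar>band_op r u x - band_op r u x'\<bar> \<le> 4 * pi * r\<^sup>2 * sqrt (2 * r * band_form r u u) * \<bar>x - x'\<bar>"
proof -
  have "\<bar>band_op r u x - band_op r u x'\<bar> = cmod (band_limit r (cutoff r u) x - band_limit r (cutoff r u) x')"
    unfolding band_op_complex[symmetric] of_real_diff[symmetric] norm_of_real ..
  also have "\<dots> \<le> 4 * pi * r\<^sup>2 * (LBINT y. cmod (cutoff r u y)) * \<bar>x - x'\<bar>"
    by (rule band_limit_Lipschitz[OF integrable_cutoff])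
  also have "\<dots> \<le> 4 * pi * r\<^sup>2 * sqrt (2 * r * band_form r u u) * \<bar>x - x'\<bar>"
    using r by (intro mult_right_mono mult_left_mono L1_cutoff_le) auto
  finally show ?thesis .
qed

lemma band_op_bounded: "band_form r (band_op r u) (band_op r u) \<le> (16 * r ^ 4) * band_form r u u"
proof -
  have "band_form r (band_op r u) (band_op r u) \<le> 2 * r * (2 * r * sqrt (2 * r * band_form r u u))\<^sup>2"
    using r by (intro band_form_le band_op_abs_le) auto
  also have "\<dots> = (16 * r ^ 4) * band_form r u u"
    using r band_form_nonneg[of r u] by (simp add: power_mult_distrib power2_eq_square power4_eq_xxxx)
  finally show ?thesis .
qed

lemma band_form_null:
  assumes "band_form r u u = 0" "x \<in> {- r..r}" shows "u x = 0"
proof -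
  have "continuous_on {- r..r} (\<lambda>x. (u x)\<^sup>2)" by (intro continuous_intros) simp
  moreover have "integral {- r..r} (\<lambda>x. (u x)\<^sup>2) = 0"
    using integral_indicator_HK[of "- r" r "\<lambda>x. (u x)\<^sup>2"] integrable_band_form[of r u u] assms(1)
    by (simp add: band_form_def power2_eq_square)
  ultimately have "\<forall>x\<in>{- r..r}. (u x)\<^sup>2 = 0"
    using integral_eq_0_iff[of "- r" r "\<lambda>x. (u x)\<^sup>2"] r by auto
  with assms(2) show ?thesis by simp
qed

text \<open>
  The images of a bounded sequence are uniformly bounded and have a common Lipschitz constant, so the theorem
  of Arzela and Ascoli applies on \<open>[-r, r]\<close>; its limit is extended continuously to the line.
\<close>

lemma band_op_compact:
  fixes x :: "nat \<Rightarrow> (real \<Rightarrow>\<^sub>C real)"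
  assumes "\<And>n. band_form r (x n) (x n) \<le> 1"
  shows "\<exists>y s. strict_mono s \<and> (\<lambda>n::nat. band_form r (band_op r (x (s n)) - y) (band_op r (x (s n)) - y)) \<longlonglongrightarrow> 0"
proof -
  define F where "F = (\<lambda>n. apply_bcontfun (band_op r (x n)))"
  have norm_le: "sqrt (2 * r * band_form r (x n) (x n)) \<le> sqrt (2 * r)" for n
    using assms[of n] r by simp
  define L where "L = 4 * pi * r\<^sup>2 * sqrt (2 * r)"
  have L: "L > 0" using r by (simp add: L_def)
  have Lip: "\<bar>F n a - F n b\<bar> \<le> L * \<bar>a - b\<bar>" for n a b
    unfolding F_def L_def using norm_le[of n]
    by (intro order_trans[OF band_op_Lipschitz] mult_right_mono mult_left_mono) auto
  obtain g s where g: "continuous_on {- r..r} g" and s: "strict_mono (s :: nat \<Rightarrow> nat)"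
    and lim: "\<And>e. 0 < e \<Longrightarrow> \<exists>N. \<forall>n x. N \<le> n \<and> x \<in> {- r..r} \<longrightarrow> norm (F (s n) x - g x) < e"
  proof (rule Arzela_Ascoli[of "{- r..r}" F "2 * r * sqrt (2 * r)"])
    show "norm (F n t) \<le> 2 * r * sqrt (2 * r)" for n t
      unfolding F_def real_norm_def using r norm_le[of n]
      by (intro order_trans[OF band_op_abs_le] mult_left_mono) auto
    fix t e :: real assume "0 < e"
    then have "e / L > 0" using L by simp
    moreover have "norm (F n t - F n y) < e" if "norm (t - y) < e / L" for n y
    proof -
      have "L * \<bar>t - y\<bar> < e" using that L by (simp add: field_simps)
      then show ?thesis using Lip[of n t y] by simp
    qed
    ultimately show "\<exists>d>0. \<forall>n y. y \<in> {- r..r} \<and> norm (t - y) < d \<longrightarrow> norm (F n t - F n y) < e" by blast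
  qed auto
  obtain y :: "real \<Rightarrow>\<^sub>C real" where y: "\<And>t. t \<in> {- r..r} \<Longrightarrow> y t = g t"
    using continuous_on_cbox_bcontfunE[of "- r" r g] g by (metis cbox_interval)
  have "(\<lambda>n. band_form r (band_op r (x (s n)) - y) (band_op r (x (s n)) - y)) \<longlonglongrightarrow> 0"
  proof (rule LIMSEQ_I)
    fix e :: real assume e: "e > 0"
    define d where "d = sqrt (e / (4 * r))"
    have d: "d > 0" "d\<^sup>2 = e / (4 * r)" using e r by (simp_all add: d_def)
    obtain N where N: "\<And>n t. N \<le> n \<Longrightarrow> t \<in> {- r..r} \<Longrightarrow> norm (F (s n) t - g t) < d"
      using lim[OF d(1)] by blast
    have "band_form r (band_op r (x (s n)) - y) (band_op r (x (s n)) - y) < e" if "n \<ge> N" for n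
    proof -
      have "band_form r (band_op r (x (s n)) - y) (band_op r (x (s n)) - y) \<le> 2 * r * d\<^sup>2"
        using r N[OF that] y by (intro band_form_le) (auto simp: F_def less_imp_le)
      also have "\<dots> < e" using r e by (simp add: d)
      finally show ?thesis .
    qed
    then show "\<exists>no. \<forall>n\<ge>no. norm (band_form r (band_op r (x (s n)) - y) (band_op r (x (s n)) - y) - 0) < e"
      by (intro exI[of _ N]) (simp add: band_form_nonneg)
  qed
  then show ?thesis using s by blast
qed

end

section \<open>Positivity\<close>

lemma continuous_fourier_integral:
  assumes f: "integrable lborel f" shows "continuous_on UNIV (\<F> f)"
proof (rule continuous_at_imp_continuous_on, intro ballI, unfold continuous_at_sequentially comp_def, intro allI impI)
  fix \<xi> :: real and X assume X: "X \<longlonglongrightarrow> \<xi>"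
  have [measurable]: "f \<in> borel_measurable lborel" using f by auto
  show "(\<lambda>n. \<F> f (X n)) \<longlonglongrightarrow> \<F> f \<xi>"
    unfolding fourier_integral_cis
  proof (rule integral_dominated_convergence[where w="\<lambda>x. cmod (f x)"])
    show "AE x in lborel. (\<lambda>n. f x * cis (- 2 * pi * x * X n)) \<longlonglongrightarrow> f x * cis (- 2 * pi * x * \<xi>)"
      unfolding cis_conv_exp by (intro AE_I2 tendsto_intros X)
  qed (use f in \<open>auto simp: norm_mult\<close>)
qed

text \<open>
  Each derivative in \<open>\<xi>\<close> brings down another factor \<open>t\<close>, and the derivatives of the zero function
  vanish.
\<close>

lemma vanishing_fourier_moments:
  fixes p :: "real \<Rightarrow> real"
  assumes p: "continuous_on {a..b} p" and r: "r > 0"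
    and zero: "\<And>\<xi>. \<xi> \<in> {- r<..<r} \<Longrightarrow> integral {a..b} (\<lambda>t. of_real (p t) * cis (- 2 * pi * t * \<xi>)) = 0"
  shows "\<xi> \<in> {- r<..<r} \<Longrightarrow> integral {a..b} (\<lambda>t. of_real (p t * t ^ n) * cis (- 2 * pi * t * \<xi>)) = 0"
proof (induction n arbitrary: \<xi>)
  case 0
  then show ?case using zero by simp
next
  case (Suc n)
  define f where "f = (\<lambda>\<xi> t. complex_of_real (p t * t ^ n) * cis (- 2 * pi * t * \<xi>))"
  define f' where "f' = (\<lambda>\<xi> t. complex_of_real (p t * t ^ n) * ((- 2 * pi * t) *\<^sub>R (\<i> * cis (- 2 * pi * t * \<xi>))))"
  let ?U = "{- r<..<r}"
  have "((\<lambda>\<xi>. integral (cbox a b) (f \<xi>)) has_vector_derivative integral (cbox a b) (f' \<xi>)) (at \<xi> within ?U)"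
  proof (rule leibniz_rule_vector_derivative)
    fix \<eta> t :: real
    have "((\<lambda>\<xi>. cis (- 2 * pi * t * \<xi>)) has_vector_derivative (- 2 * pi * t) *\<^sub>R (\<i> * cis (- 2 * pi * t * \<eta>))) (at \<eta> within ?U)"
      by (auto simp: has_vector_derivative_complex_iff intro!: derivative_eq_intros)
    then show "((\<lambda>\<xi>. f \<xi> t) has_vector_derivative f' \<eta> t) (at \<eta> within ?U)"
      unfolding f_def f'_def by (rule has_vector_derivative_mult_right)
  next
    fix \<eta> :: real
    show "f \<eta> integrable_on cbox a b"
      unfolding f_def cis_conv_exp using p by (intro integrable_continuous continuous_intros) (auto simp: cbox_interval)
  next
    have "continuous_on (?U \<times> cbox a b) (\<lambda>z. p (snd z))"
      by (rule continuous_on_compose2[OF p]) (auto intro: continuous_intros simp: cbox_interval)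
    then show "continuous_on (?U \<times> cbox a b) (\<lambda>(x, t). f' x t)"
      unfolding f'_def cis_conv_exp case_prod_beta by (intro continuous_intros)
  qed (use Suc.prems in auto)
  moreover have "((\<lambda>\<xi>. integral (cbox a b) (f \<xi>)) has_vector_derivative 0) (at \<xi> within ?U)"
  proof (rule has_vector_derivative_transform[OF Suc.prems])
    show "integral (cbox a b) (f \<eta>) = 0" if "\<eta> \<in> ?U" for \<eta>
      using Suc.IH[OF that] by (simp add: f_def cbox_interval)
    show "((\<lambda>_. 0 :: complex) has_vector_derivative 0) (at \<xi> within ?U)" by simp
  qed
  ultimately have "integral (cbox a b) (f' \<xi>) = 0"
    using Suc.prems by (auto intro!: vector_derivative_unique_within_closed_interval simp: at_within_open[of \<xi> ?U] vector_derivative_unique_at)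
  moreover have "integral (cbox a b) (f' \<xi>) = (- 2 * pi * \<i>) * integral {a..b} (\<lambda>t. of_real (p t * t ^ Suc n) * cis (- 2 * pi * t * \<xi>))"
    unfolding f'_def integral_mult_right[symmetric] cbox_interval
    by (intro Henstock_Kurzweil_Integration.integral_cong) (simp add: scaleR_conv_of_real mult_ac)
  ultimately show ?case by simp
qed

lemma bcontfun_sum_apply: "apply_bcontfun (\<Sum>i\<in>I. f i) x = (\<Sum>i\<in>I. apply_bcontfun (f i) x)"
  for f :: "'i \<Rightarrow> 'c::topological_space \<Rightarrow>\<^sub>C 'd::real_normed_vector"
  by (induction I rule: infinite_finite_induct) auto

context
  fixes r :: real assumes r: "r > 0"
begin

text \<open>
  If the form vanishes, the Fourier transform of \<open>u\<close> vanishes on the band, hence all moments of \<open>u\<close>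
  over \<open>[-r, r]\<close> vanish, and a polynomial with this property is orthogonal to itself.
\<close>

lemma band_op_definite_on_polynomials:
  assumes zero: "band_form r (band_op r u) u = 0"
    and poly: "\<And>t. t \<in> {- r..r} \<Longrightarrow> apply_bcontfun u t = (\<Sum>j\<le>m. a j * t ^ j)"
  shows "band_form r u u = 0"
proof -
  let ?F = "\<F> (cutoff r u)"
  have F_cont: "continuous_on {- r..r} ?F"
    using continuous_fourier_integral[OF integrable_cutoff] by (rule continuous_on_subset) simp
  have F_int: "integrable lborel (\<lambda>\<xi>. indicator {- r..r} \<xi> *\<^sub>R (cmod (?F \<xi>))\<^sup>2)"
    using integrable_indicator_bounded[where M="(LBINT x. cmod (cutoff r u x))\<^sup>2" and g="\<lambda>\<xi>. (cmod (?F \<xi>))\<^sup>2"]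
      integrable_cutoff[of r u] norm_fourier_integral_le[of "cutoff r u"]
    by (auto simp: power_mono borel_measurable_integrable)
  have "integral {- r..r} (\<lambda>\<xi>. (cmod (?F \<xi>))\<^sup>2) = 0"
    using zero integral_indicator_HK[OF F_int] by (simp add: band_form_op_eq[OF r] energy_on_def)
  moreover have "continuous_on {- r..r} (\<lambda>\<xi>. (cmod (?F \<xi>))\<^sup>2)" by (intro continuous_intros F_cont)
  ultimately have F0: "?F \<xi> = 0" if "\<xi> \<in> {- r..r}" for \<xi>
    using integral_eq_0_iff[of "- r" r "\<lambda>\<xi>. (cmod (?F \<xi>))\<^sup>2"] r that by auto
  have F_eq: "?F \<xi> = integral {- r..r} (\<lambda>t. of_real (u t) * cis (- 2 * pi * t * \<xi>))" for \<xi>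
  proof -
    have eq: "cutoff r u t * cis (- 2 * pi * t * \<xi>) = indicator {- r..r} t *\<^sub>R (of_real (u t) * cis (- 2 * pi * t * \<xi>))" for t
      by (auto simp: cutoff_def indicator_def)
    show ?thesis
      using integrable_mult_cis[OF integrable_cutoff[of r u], of \<xi>] unfolding fourier_integral_cis eq
      by (rule integral_indicator_HK)
  qed
  have moment: "integral {- r..r} (\<lambda>t. u t * t ^ n) = 0" for n
  proof -
    have "integral {- r..r} (\<lambda>t. complex_of_real (u t * t ^ n) * cis (- 2 * pi * t * 0)) = 0"
      using F0 F_eq r by (intro vanishing_fourier_moments[of _ _ _ r]) auto
    then have "integral {- r..r} (\<lambda>t. complex_of_real (u t * t ^ n)) = 0" by simp
    moreover have "(\<lambda>t. u t * t ^ n) integrable_on {- r..r}"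
      by (intro integrable_continuous_interval continuous_intros) simp
    ultimately show ?thesis
      using integral_linear[OF _ bounded_linear_of_real[where 'a=complex], of "\<lambda>t. u t * t ^ n"]
      by (simp add: o_def)
  qed
  have "band_form r u u = integral {- r..r} (\<lambda>t. u t * u t)"
    using integral_indicator_HK[of "- r" r "\<lambda>t. u t * u t"] integrable_band_form[of r u u] by (simp add: band_form_def)
  also have "\<dots> = integral {- r..r} (\<lambda>t. \<Sum>j\<le>m. a j * (u t * t ^ j))"
    by (intro Henstock_Kurzweil_Integration.integral_cong) (simp add: poly sum_distrib_left mult_ac)
  also have "\<dots> = (\<Sum>j\<le>m. integral {- r..r} (\<lambda>t. a j * (u t * t ^ j)))"
    by (intro Henstock_Kurzweil_Integration.integral_sum) (auto intro!: integrable_continuous_interval continuous_intros)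
  also have "\<dots> = 0" by (simp add: moment)
  finally show ?thesis .
qed

text \<open>
  Among the polynomials of degree at most \<open>card E\<close> there is a nonzero one orthogonal to \<open>E\<close>.
\<close>

lemma band_op_positive_orthogonal:
  assumes E: "finite E" shows "\<exists>x. (\<forall>e\<in>E. band_form r x e = 0) \<and> 0 < band_form r (band_op r x) x"
proof -
  obtain e where e: "E = e ` {..<card E}"
    using ex_bij_betw_nat_finite[OF E] by (auto simp: bij_betw_def atLeast0LessThan)
  have "\<exists>p :: real \<Rightarrow>\<^sub>C real. \<forall>t\<in>{- r..r}. p t = t ^ j" for j
  proof -
    have "continuous_on (cbox (- r) r) (\<lambda>t. t ^ j)" by (intro continuous_intros)
    then obtain g :: "real \<Rightarrow>\<^sub>C real" where "\<And>t. t \<in> cbox (- r) r \<Longrightarrow> g t = t ^ j"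
      by (rule continuous_on_cbox_bcontfunE) blast
    then show ?thesis by (intro exI[of _ g]) (simp add: cbox_interval)
  qed
  then obtain p :: "nat \<Rightarrow> real \<Rightarrow>\<^sub>C real" where p: "\<And>j t. t \<in> {- r..r} \<Longrightarrow> p j t = t ^ j" by metis
  obtain a where a: "\<exists>j\<in>{..card E}. a j \<noteq> 0"
    "\<And>i. i < card E \<Longrightarrow> (\<Sum>j\<in>{..card E}. a j * band_form r (p j) (e i)) = 0"
    using underdetermined_system[of "card E" "{..card E}" "\<lambda>i j. band_form r (p j) (e i)"] by auto
  define x where "x = (\<Sum>j\<le>card E. a j *\<^sub>R p j)"
  have xt: "x t = (\<Sum>j\<le>card E. a j * t ^ j)" if "t \<in> {- r..r}" for t
    using p[OF that] by (simp add: x_def bcontfun_sum_apply)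
  have orth: "band_form r x z = 0" if "z \<in> E" for z
  proof -
    have "z \<in> e ` {..<card E}" using that by (simp flip: e)
    then obtain i where "i < card E" "z = e i" by auto
    then show ?thesis using a(2) by (simp add: x_def band_form_sum band_form_scale)
  qed
  have "band_form r (band_op r x) x \<noteq> 0"
  proof
    assume "band_form r (band_op r x) x = 0"
    then have "band_form r x x = 0" using xt by (rule band_op_definite_on_polynomials)
    then have "x t = 0" if "t \<in> {- r..r}" for t using that by (rule band_form_null[OF r])
    then have "{- r..r} \<subseteq> {t. (\<Sum>j\<le>card E. a j * t ^ j) = 0}" using xt by auto
    moreover have "finite {t. (\<Sum>j\<le>card E. a j * t ^ j) = 0}"
      using a(1) by (subst polyfun_finite_roots) auto
    ultimately have "finite {- r..r}" by (rule finite_subset)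
    then show False using r by (simp add: infinite_Icc)
  qed
  moreover have "0 \<le> band_form r (band_op r x) x"
    unfolding band_form_op_eq[OF r] by (rule energy_on_nonneg)
  ultimately show ?thesis using orth by (intro exI[of _ x]) auto
qed

lemma compact_positive_form_band: "compact_positive_form (band_form r) (band_op r)"
proof
  show "band_form r x y = band_form r y x" for x y by (simp add: band_form_def mult.commute)
  show "0 \<le> band_form r x x" for x by (rule band_form_nonneg)
  show "0 \<le> band_form r (band_op r x) x" for x
    unfolding band_form_op_eq[OF r] by (rule energy_on_nonneg)
  show "band_op r x = 0" if "band_form r x x = 0" for x
  proof (rule bcontfun_eqI)
    fix t
    have "cutoff r x = (\<lambda>_. 0)" using band_form_null[OF r that] by (auto simp: cutoff_def indicator_def)
    then have "complex_of_real (band_op r x t) = 0" by (simp add: band_op_complex[OF r] band_limit_def)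
    then show "band_op r x t = apply_bcontfun 0 t" by simp
  qed
  show "\<exists>C. \<forall>x. band_form r (band_op r x) (band_op r x) \<le> C * band_form r x x"
    using band_op_bounded[OF r] by blast
qed (use band_form_add band_form_scale band_op_sym[OF r] linear_band_op[OF r] band_op_compact[OF r]
       band_op_positive_orthogonal in \<open>auto simp: linear_iff\<close>)

end

section \<open>The listing of the positive eigenvalues\<close>

lemma has_L2_dim_le:
  assumes "has_L2_dim V m" "has_L2_dim V n" shows "n \<le> m"
proof (rule ccontr)
  assume "\<not> n \<le> m"
  then have mn: "m < n" by simp
  obtain e where e: "\<And>f. f \<in> V \<Longrightarrow> \<exists>a::nat \<Rightarrow> complex. AE x in lborel. f x = (\<Sum>i<m. a i * e i x)"
    using assms(1) unfolding has_L2_dim_def by blast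
  obtain e' where e': "\<And>i. i < n \<Longrightarrow> e' i \<in> V"
    and indep: "\<And>a::nat \<Rightarrow> complex. AE x in lborel. (\<Sum>i<n. a i * e' i x) = 0 \<Longrightarrow> \<forall>i<n. a i = 0"
    using assms(2) unfolding has_L2_dim_def by blast
  have "\<forall>j\<in>{..<n}. \<exists>c. AE x in lborel. e' j x = (\<Sum>i<m. c i * e i x)" using e e' by auto
  then obtain c where c: "\<And>j. j < n \<Longrightarrow> AE x in lborel. e' j x = (\<Sum>i<m. c j i * e i x)"
    by (auto dest!: bchoice)
  obtain a where a: "\<exists>j\<in>{..<n}. a j \<noteq> 0" "\<And>i. i < m \<Longrightarrow> (\<Sum>j<n. a j * c j i) = 0"
    using underdetermined_system[of m "{..<n}" "\<lambda>i j. c j i"] mn by auto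
  have "AE x in lborel. \<forall>j\<in>{..<n}. e' j x = (\<Sum>i<m. c j i * e i x)"
    by (rule AE_finite_allI) (use c in auto)
  then have "AE x in lborel. (\<Sum>j<n. a j * e' j x) = 0"
  proof eventually_elim
    fix x assume *: "\<forall>j\<in>{..<n}. e' j x = (\<Sum>i<m. c j i * e i x)"
    have "(\<Sum>j<n. a j * e' j x) = (\<Sum>j<n. \<Sum>i<m. a j * c j i * e i x)"
      using * by (intro sum.cong) (auto simp: sum_distrib_left mult_ac)
    also have "\<dots> = (\<Sum>i<m. (\<Sum>j<n. a j * c j i) * e i x)"
      by (subst sum.swap) (simp add: sum_distrib_right)
    finally show "(\<Sum>j<n. a j * e' j x) = 0" by (simp add: a)
  qed
  from indep[OF this] a(1) show False by auto
qed

text \<open>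
  Multiplicities are dimensions, so two listings attain each positive value equally often. If \<open>l n < l' n\<close>,
  then \<open>l'\<close> has at least \<open>n\<close> entries with a value in \<open>l' ` {1..n}\<close>, but \<open>l\<close> has fewer.
\<close>

lemma positive_eigenvalue_listing_le:
  assumes l: "positive_eigenvalue_listing A l" and l': "positive_eigenvalue_listing A l'" and n: "n \<ge> 1"
  shows "l' n \<le> l n"
proof (rule ccontr)
  assume "\<not> l' n \<le> l n"
  then have less: "l n < l' n" by simp
  have dec: "l b \<le> l a" "l' b \<le> l' a" if "1 \<le> a" "a \<le> b" for a b
    using l l' that unfolding positive_eigenvalue_listing_def by blast+
  have pos: "l' m > 0" if "m \<ge> 1" for m
    using l' that unfolding positive_eigenvalue_listing_def by blast
  have dim: "finite {m. 1 \<le> m \<and> L m = \<mu>}" "has_L2_dim (eigenspace A \<mu>) (card {m. 1 \<le> m \<and> L m = \<mu>})"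
    if "positive_eigenvalue_listing A L" "\<mu> > 0" for L \<mu>
    using that unfolding positive_eigenvalue_listing_def by auto
  have fin: "finite {m. 1 \<le> m \<and> l m = \<mu>}" "finite {m. 1 \<le> m \<and> l' m = \<mu>}" if "\<mu> > 0" for \<mu>
    using dim(1)[OF l that] dim(1)[OF l' that] .
  have card_eq: "card {m. 1 \<le> m \<and> l m = \<mu>} = card {m. 1 \<le> m \<and> l' m = \<mu>}" if "\<mu> > 0" for \<mu>
    using has_L2_dim_le[OF dim(2)[OF l' that] dim(2)[OF l that]]
      has_L2_dim_le[OF dim(2)[OF l that] dim(2)[OF l' that]] by (rule antisym)
  define M where "M = l' ` {1..n}"
  have M: "finite M" "\<And>\<mu>. \<mu> \<in> M \<Longrightarrow> \<mu> > 0" "\<And>\<mu>. \<mu> \<in> M \<Longrightarrow> l' n \<le> \<mu>"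
    using pos dec by (auto simp: M_def)
  have "n = card {1..n}" by simp
  also have "\<dots> \<le> card (\<Union>\<mu>\<in>M. {m. 1 \<le> m \<and> l' m = \<mu>})"
    using M fin by (intro card_mono) (auto simp: M_def)
  also have "\<dots> = (\<Sum>\<mu>\<in>M. card {m. 1 \<le> m \<and> l' m = \<mu>})"
    using M fin by (intro card_UN_disjoint) auto
  also have "\<dots> = (\<Sum>\<mu>\<in>M. card {m. 1 \<le> m \<and> l m = \<mu>})"
    using M by (intro sum.cong refl card_eq[symmetric]) auto
  also have "\<dots> = card (\<Union>\<mu>\<in>M. {m. 1 \<le> m \<and> l m = \<mu>})"
    using M fin by (intro card_UN_disjoint[symmetric]) auto
  also have "\<dots> \<le> card {1..<n}"
  proof (intro card_mono)
    show "(\<Union>\<mu>\<in>M. {m. 1 \<le> m \<and> l m = \<mu>}) \<subseteq> {1..<n}"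
    proof safe
      fix \<mu> m assume "l m \<in> M" "1 \<le> m"
      then have "l n < l m" using M(3) less by force
      then have "\<not> n \<le> m" using dec(1)[of n m] n by auto
      then show "m \<in> {1..<n}" using \<open>1 \<le> m\<close> by auto
    qed
  qed simp
  also have "\<dots> < n" using n by simp
  finally show False by simp
qed

lemma cutoff_L2: "cutoff r u \<in> L2"
proof (rule L2I_bound(1))
  show "integrable lborel (\<lambda>x. indicator {- r..r} x * (u x * u x))" by (rule integrable_band_form)
  show "cutoff r u \<in> borel_measurable lborel" using integrable_cutoff[of r u] by auto
qed (simp add: cutoff_def abs_mult indicator_def power2_eq_square)

lemma cutoff_inner: "(LBINT x. cutoff r u x * cutoff r v x) = of_real (band_form r u v)"
proof -
  have "(LBINT x. cutoff r u x * cutoff r v x)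
      = (LBINT x. complex_of_real (indicator {- r..r} x * (u x * v x)))"
    by (intro Bochner_Integration.integral_cong) (auto simp: cutoff_def indicator_def)
  then show ?thesis unfolding band_form_def by (simp only: integral_complex_of_real)
qed

lemma integrable_cutoff_mult: "integrable lborel (\<lambda>x. cutoff r u x * cutoff r v x)"
  using L2_mult_integrable[OF cutoff_L2 cutoff_L2, of r u r v] by (simp add: cutoff_def)

lemma complex_bcontfun_parts:
  fixes w :: "real \<Rightarrow> complex"
  assumes cont: "continuous_on UNIV w" and le: "\<And>x. cmod (w x) \<le> M"
  obtains u v :: "real \<Rightarrow>\<^sub>C real" where "\<And>x. of_real (u x) + \<i> * of_real (v x) = w x"
proof -
  have "(\<lambda>x. Re (w x)) \<in> bcontfun" "(\<lambda>x. Im (w x)) \<in> bcontfun"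
    by (rule bcontfun_normI[where b=M];
        use cont le in \<open>auto intro!: continuous_intros order_trans[OF abs_Re_le_cmod] order_trans[OF abs_Im_le_cmod]\<close>)+
  then obtain u v where "(\<lambda>x. Re (w x)) = apply_bcontfun u" "(\<lambda>x. Im (w x)) = apply_bcontfun v"
    by (metis bcontfunE)
  then show thesis by (intro that[of u v]) (metis complex_eq mult.commute)
qed

context
  fixes r :: real assumes r: "r > 0"
begin

interpretation compact_positive_form "band_form r" "band_op r"
  by (rule compact_positive_form_band[OF r])

lemma S_op_cutoff:
  "AE x in lborel. S_op {- r..r} {- r..r} (cutoff r u) x = cutoff r (band_op r u) x"
  using S_op_eq_band_limit[OF cutoff_L2[of r u], of r]
  by eventually_elim (simp add: cutoff_simps band_op_complex[OF r, symmetric] cutoff_def[of r "band_op r u"] of_real_indicator)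

text \<open>
  An eigenfunction for \<open>\<mu> > 0\<close> is \<open>1 / \<mu>\<close> times its image under the integral operator, hence equal to a
  bounded continuous function on \<open>[-r, r]\<close> and to 0 elsewhere. As the kernel is real, real and
  imaginary part are eigenfunctions too.
\<close>

lemma eigenfunction_real_parts:
  assumes f: "f \<in> eigenspace (S_op {- r..r} {- r..r}) \<mu>" and mu: "\<mu> > 0"
  obtains u v where "band_op r u = \<mu> *\<^sub>R u" "band_op r v = \<mu> *\<^sub>R v"
    "AE x in lborel. f x = cutoff r u x + \<i> * cutoff r v x"
proof -
  have fL2: "f \<in> L2" and ae: "AE x in lborel. S_op {- r..r} {- r..r} f x = of_real \<mu> * f x"
    using f by (auto simp: eigenspace_def)
  define g where "g = (\<lambda>y. f y * indicator {- r..r} y)"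
  have g: "integrable lborel g" unfolding g_def by (rule L2_interval_integrable[OF fL2])
  define w where "w = (\<lambda>x. band_limit r g x / of_real \<mu>)"
  have fw: "AE x in lborel. f x = w x * indicator {- r..r} x"
    using ae S_op_eq_band_limit[OF fL2, of r]
    by eventually_elim (use mu in \<open>simp add: w_def g_def field_simps\<close>)
  obtain W where W: "band_limit r g = apply_bcontfun W"
    using band_limit_bcontfun[OF r g] by (rule bcontfunE)
  have w_cont: "continuous_on UNIV w" and w_le: "cmod (w x) \<le> norm W / \<mu>" for x
  proof -
    have weq: "w = (\<lambda>x. apply_bcontfun W x / of_real \<mu>)" unfolding w_def W[symmetric] ..
    show "continuous_on UNIV w" unfolding weq using mu by (intro continuous_intros) auto
    show "cmod (w x) \<le> norm W / \<mu>" unfolding weq using norm_bounded[of W x] mu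
      by (simp add: norm_divide divide_right_mono)
  qed
  obtain u v :: "real \<Rightarrow>\<^sub>C real" where uvx: "\<And>x. of_real (u x) + \<i> * of_real (v x) = w x"
    by (rule complex_bcontfun_parts[OF w_cont w_le]) blast
  have uv: "cutoff r u x + \<i> * cutoff r v x = w x * indicator {- r..r} x" for x
    using uvx[of x] by (auto simp: cutoff_def indicator_def)
  have eq: "complex_of_real \<mu> * w x = of_real (band_op r u x) + \<i> * of_real (band_op r v x)" for x
  proof -
    have "complex_of_real \<mu> * w x = (LBINT y. g y * of_real (band_kernel r (x - y)))"
      using mu by (simp add: w_def band_limit_def)
    also have "\<dots> = (LBINT y. (cutoff r u y + \<i> * cutoff r v y) * of_real (band_kernel r (x - y)))"
    proof (rule integral_cong_AE)
      have "(\<lambda>y. cutoff r u y) \<in> borel_measurable lborel" "(\<lambda>y. cutoff r v y) \<in> borel_measurable lborel"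
        "g \<in> borel_measurable lborel"
        using integrable_cutoff[of r u] integrable_cutoff[of r v] g by auto
      note [measurable] = this
      have [measurable]: "(\<lambda>y. band_kernel r (x - y)) \<in> borel_measurable lborel"
        by (rule measurable_band_kernel) (use r in auto)
      show "(\<lambda>y. g y * of_real (band_kernel r (x - y))) \<in> borel_measurable lborel"
        "(\<lambda>y. (cutoff r u y + \<i> * cutoff r v y) * of_real (band_kernel r (x - y))) \<in> borel_measurable lborel"
        by measurable
      show "AE y in lborel. g y * of_real (band_kernel r (x - y))
          = (cutoff r u y + \<i> * cutoff r v y) * of_real (band_kernel r (x - y))"
        using fw by eventually_elim (simp add: g_def uv indicator_def)
    qed
    also have "\<dots> = (LBINT y. cutoff r u y * of_real (band_kernel r (x - y)) + \<i> * (cutoff r v y * of_real (band_kernel r (x - y))))"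
      by (simp add: algebra_simps)
    also have "\<dots> = of_real (band_op r u x) + \<i> * of_real (band_op r v x)"
      unfolding band_op_complex[OF r] band_limit_def
      by (simp add: integrable_band_limit[OF r] integrable_cutoff)
    finally show ?thesis .
  qed
  have "band_op r u x = \<mu> * u x" "band_op r v x = \<mu> * v x" for x
    using eq[of x] unfolding uvx[symmetric] by (simp_all add: complex_eq_iff)
  then show thesis
    using fw by (intro that[of u v]) (auto intro!: bcontfun_eqI simp: uv)
qed

text \<open>
  The sequence of \<open>eigenvector_sequence\<close>, shifted to start at index 1, lists the
  positive eigenvalues: cut off to \<open>[-r, r]\<close>, the \<open>e k\<close> with \<open>l k = \<mu>\<close> form a basis of the eigenspace of \<open>\<mu>\<close>.
\<close>

theorem eigenvalue_listing_exists:
  "\<exists>e l. (\<forall>k. band_op r (e k) = l k *\<^sub>R e k) \<and>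
    (\<forall>(k::nat) x. (\<forall>i<k. band_form r x (e i) = 0) \<longrightarrow> band_form r (band_op r x) x \<le> l k * band_form r x x) \<and>
    positive_eigenvalue_listing (S_op {- r..r} {- r..r}) (\<lambda>n. l (n - 1))"
proof -
  obtain e l where e: "\<And>k. band_op r (e k) = l k *\<^sub>R e k" "\<And>k. l k > 0" "\<And>k. band_form r (e k) (e k) = 1"
    and orth: "\<And>i j. i \<noteq> j \<Longrightarrow> band_form r (e i) (e j) = 0" and dec: "decseq l" and lim: "l \<longlonglongrightarrow> 0"
    and max: "\<And>(k::nat) x. (\<And>i. i < k \<Longrightarrow> band_form r x (e i) = 0) \<Longrightarrow> band_form r (band_op r x) x \<le> l k * band_form r x x"
    using eigenvector_sequence by blast
  have dim: "finite {n. 1 \<le> n \<and> l (n - 1) = \<mu>} \<and>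
      has_L2_dim (eigenspace (S_op {- r..r} {- r..r}) \<mu>) (card {n. 1 \<le> n \<and> l (n - 1) = \<mu>})" if mu: "\<mu> > 0" for \<mu>
  proof -
    define K where "K = {k. l k = \<mu>}"
    have span0: "\<And>x. x \<in> {- r..r} \<Longrightarrow> u x = (\<Sum>k\<in>K. band_form r u (e k) * e k x)" and finK: "finite K"
      if "band_op r u = \<mu> *\<^sub>R u" for u
    proof -
      note * = eigenvector_in_span[OF e(1,3) orth lim max that mu]
      show "finite K" using *(1) by (simp add: K_def)
      fix x assume "x \<in> {- r..r}"
      from band_form_null[OF r *(2) this]
      show "u x = (\<Sum>k\<in>K. band_form r u (e k) * e k x)" by (simp add: bcontfun_sum_apply K_def)
    qed
    have finK: "finite K" by (rule finK[of 0]) (simp add: T_simps linear_0[OF T_lin])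
    have im: "{n. 1 \<le> n \<and> l (n - 1) = \<mu>} = Suc ` K"
      by (auto simp: K_def image_iff Suc_le_eq gr0_conv_Suc)
    then have card: "card {n. 1 \<le> n \<and> l (n - 1) = \<mu>} = card K" by (simp add: card_image)
    obtain h where h: "bij_betw h {..<card K} K"
      using ex_bij_betw_nat_finite[OF finK] by (auto simp: atLeast0LessThan)
    define E where "E = (\<lambda>i. cutoff r (e (h i)))"
    have hK: "l (h i) = \<mu>" if "i < card K" for i
      using h that by (auto simp: bij_betw_def K_def)
    have E_in: "E i \<in> eigenspace (S_op {- r..r} {- r..r}) \<mu>" if "i < card K" for i
      unfolding eigenspace_def using S_op_cutoff[of "e (h i)"] hK[OF that] cutoff_L2
      by (auto simp: E_def e cutoff_simps)
    have E_inner: "(LBINT x. E i x * E j x) = (if i = j then 1 else 0)" if "i < card K" "j < card K" for i j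
    proof -
      have "i = j \<longleftrightarrow> h i = h j" using h that by (auto simp: bij_betw_def inj_on_def)
      then show ?thesis by (simp add: E_def cutoff_inner e orth)
    qed
    have "has_L2_dim (eigenspace (S_op {- r..r} {- r..r}) \<mu>) (card K)"
      unfolding has_L2_dim_def
    proof (intro exI[of _ E] conjI allI impI ballI)
      fix i assume "i < card K" then show "E i \<in> eigenspace (S_op {- r..r} {- r..r}) \<mu>" by (rule E_in)
    next
      fix a :: "nat \<Rightarrow> complex" and j
      assume ae: "AE x in lborel. (\<Sum>i<card K. a i * E i x) = 0" and j: "j < card K"
      have "0 = (LBINT x. (\<Sum>i<card K. a i * E i x) * E j x)"
        using ae by (intro integral_eq_zero_AE[symmetric]) (auto elim: eventually_mono)
      also have "\<dots> = (LBINT x. (\<Sum>i<card K. a i * (E i x * E j x)))"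
        by (simp add: sum_distrib_right mult.assoc)
      also have "\<dots> = (\<Sum>i<card K. a i * (LBINT x. E i x * E j x))"
        by (subst Bochner_Integration.integral_sum) (auto simp: E_def integrable_cutoff_mult)
      also have "\<dots> = (\<Sum>i<card K. if i = j then a j else 0)"
        using j by (intro sum.cong) (auto simp: E_inner)
      also have "\<dots> = a j" using j by simp
      finally show "a j = 0" by simp
    next
      fix f assume "f \<in> eigenspace (S_op {- r..r} {- r..r}) \<mu>"
      then obtain u v where uv: "band_op r u = \<mu> *\<^sub>R u" "band_op r v = \<mu> *\<^sub>R v"
        and f: "AE x in lborel. f x = cutoff r u x + \<i> * cutoff r v x"
        using eigenfunction_real_parts[OF _ mu] by blast
      define a where "a = (\<lambda>i. complex_of_real (band_form r u (e (h i))) + \<i> * of_real (band_form r v (e (h i))))"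
      have cut: "cutoff r u x = (\<Sum>i<card K. of_real (band_form r u (e (h i))) * E i x)" if "band_op r u = \<mu> *\<^sub>R u" for u x
      proof (cases "x \<in> {- r..r}")
        case True
        have "u x = (\<Sum>i<card K. band_form r u (e (h i)) * e (h i) x)"
          unfolding span0[OF that True] by (rule sum.reindex_bij_betw[OF h, symmetric])
        then show ?thesis using True by (simp add: cutoff_def E_def)
      qed (simp add: cutoff_def E_def)
      have "AE x in lborel. f x = (\<Sum>i<card K. a i * E i x)"
        using f by eventually_elim
          (simp add: cut[OF uv(1)] cut[OF uv(2)] a_def distrib_right sum.distrib sum_distrib_left mult.assoc)
      then show "\<exists>a. AE x in lborel. f x = (\<Sum>i<card K. a i * E i x)" by blast
    qed
    then show ?thesis unfolding card using finK im by simp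
  qed
  have "positive_eigenvalue_listing (S_op {- r..r} {- r..r}) (\<lambda>n. l (n - 1))"
    unfolding positive_eigenvalue_listing_def using dim e(2) dec by (auto simp: decseq_def)
  then show ?thesis using e max by (intro exI[of _ e] exI[of _ l]) auto
qed

text \<open>
  The lower half of the min-max principle, with complex test functions: some combination \<open>G\<close> of the \<open>n\<close>
  test functions is orthogonal to the first \<open>n - 1\<close> eigenfunctions. These are real, so the real and imaginary
  part of \<open>G\<close> are orthogonal to them as well, and the Rayleigh quotient of each is at most the
  \<open>n\<close>-th eigenvalue.
\<close>

theorem pos_eigenvalue_ge:
  fixes p :: "nat \<Rightarrow> real \<Rightarrow> complex"
  assumes n: "n \<ge> 1" and cont: "\<And>j. continuous_on UNIV (p j)" and bdd: "\<And>j x. cmod (p j x) \<le> C"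
    and test: "\<And>a. \<exists>j<n. a j \<noteq> 0 \<Longrightarrow>
      let G = (\<lambda>x. (\<Sum>j<n. a j * p j x) * indicator {- r..r} x) in
      energy G > 0 \<and> b * energy G \<le> energy_on {- r..r} (\<F> G)"
  shows "b \<le> pos_eigenvalue (S_op {- r..r} {- r..r}) n"
proof -
  let ?S = "S_op {- r..r} {- r..r}"
  obtain e l where e: "\<And>k. band_op r (e k) = l k *\<^sub>R e k"
    and max: "\<And>(k::nat) x. (\<And>i. i < k \<Longrightarrow> band_form r x (e i) = 0) \<Longrightarrow> band_form r (band_op r x) x \<le> l k * band_form r x x"
    and listing: "positive_eigenvalue_listing ?S (\<lambda>n. l (n - 1))"
    using eigenvalue_listing_exists by blast
  have "positive_eigenvalue_listing ?S (pos_eigenvalue ?S)"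
    using someI[of "positive_eigenvalue_listing ?S", OF listing] by (simp add: pos_eigenvalue_def)
  from positive_eigenvalue_listing_le[OF this listing n] have le: "l (n - 1) \<le> pos_eigenvalue ?S n" .
  define A where "A = (\<lambda>i j. LBINT x. p j x * cutoff r (e i) x)"
  have "n - 1 < card {..<n}" using n by simp
  then obtain a where a: "\<exists>j\<in>{..<n}. a j \<noteq> 0" "\<And>i. i < n - 1 \<Longrightarrow> (\<Sum>j<n. a j * A i j) = 0"
    using underdetermined_system[of "n - 1" "{..<n}" A] by auto
  define P where "P = (\<lambda>x. \<Sum>j<n. a j * p j x)"
  define G where "G = (\<lambda>x. P x * indicator {- r..r} x)"
  have G: "energy G > 0" "b * energy G \<le> energy_on {- r..r} (\<F> G)"
    using test[of a] a(1) by (auto simp: G_def P_def Let_def)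
  have P_cont: "continuous_on UNIV P" unfolding P_def by (intro continuous_intros cont)
  have P_le: "cmod (P x) \<le> (\<Sum>j<n. cmod (a j) * C)" for x
    unfolding P_def by (intro order_trans[OF norm_sum] sum_mono) (simp add: norm_mult bdd mult_left_mono)
  obtain u v :: "real \<Rightarrow>\<^sub>C real" where uvx: "\<And>x. of_real (u x) + \<i> * of_real (v x) = P x"
    by (rule complex_bcontfun_parts[OF P_cont P_le]) blast
  have Guv: "G = (\<lambda>x. cutoff r u x + \<i> * cutoff r v x)"
    using uvx by (auto simp: cutoff_def indicator_def G_def)
  note ic = integrable_cutoff[of r]
  have orth: "band_form r u (e i) = 0 \<and> band_form r v (e i) = 0" if "i < n - 1" for i
  proof -
    have pi: "integrable lborel (\<lambda>x. p j x * cutoff r (e i) x)" for j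
      unfolding mult.commute[of "p j _"]
      by (rule integrable_mult_bounded[OF ic _ bdd]) (use cont in \<open>simp add: borel_measurable_continuous_onI\<close>)
    have "of_real (band_form r u (e i)) + \<i> * of_real (band_form r v (e i)) = (LBINT x. G x * cutoff r (e i) x)"
      unfolding Guv cutoff_inner[symmetric] by (simp add: distrib_right mult.assoc integrable_cutoff_mult)
    also have "\<dots> = (LBINT x. (\<Sum>j<n. a j * (p j x * cutoff r (e i) x)))"
    proof (intro Bochner_Integration.integral_cong refl)
      show "G x * cutoff r (e i) x = (\<Sum>j<n. a j * (p j x * cutoff r (e i) x))" for x
        by (cases "x \<in> {- r..r}") (simp_all add: G_def P_def sum_distrib_right cutoff_def mult.assoc)
    qed
    also have "\<dots> = (\<Sum>j<n. a j * A i j)"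
      unfolding A_def by (subst Bochner_Integration.integral_sum) (auto intro!: integrable_mult_right pi)
    also have "\<dots> = 0" by (rule a(2)[OF that])
    finally show ?thesis by (simp add: complex_eq_iff)
  qed
  define Fu where "Fu = \<F> (cutoff r u)"
  define Fv where "Fv = \<F> (cutoff r v)"
  have FG: "\<F> G \<xi> = Fu \<xi> + \<i> * Fv \<xi>" for \<xi>
    using Bochner_Integration.integral_add[OF integrable_mult_cis[OF ic] integrable_mult_right[OF integrable_mult_cis[OF ic]], of u \<xi> \<i> v \<xi>]
    unfolding Fu_def Fv_def Guv fourier_integral_cis by (simp add: distrib_right mult.assoc)
  have iF: "integrable lborel (\<lambda>\<xi>. indicator {- r..r} \<xi> * (\<F> (cutoff r s) \<xi> * cnj (\<F> (cutoff r t) \<xi>)))" for s t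
  proof (rule integrable_indicator_bounded)
    show "(\<lambda>\<xi>. \<F> (cutoff r s) \<xi> * cnj (\<F> (cutoff r t) \<xi>)) \<in> borel_measurable lborel"
      using ic[of s] ic[of t] by (auto intro!: measurable_cnj measurable_fourier_integral borel_measurable_times)
    show "norm (\<F> (cutoff r s) \<xi> * cnj (\<F> (cutoff r t) \<xi>))
      \<le> (LBINT x. cmod (cutoff r s x)) * (LBINT x. cmod (cutoff r t x))" for \<xi>
      unfolding norm_mult complex_mod_cnj by (intro mult_mono norm_fourier_integral_le) auto
  qed
  \<comment> \<open>The mixed terms cancel because the operator is symmetric.\<close>
  have "complex_of_real (energy_on {- r..r} (\<F> G))
      = (LBINT \<xi>. indicator {- r..r} \<xi> * (Fu \<xi> * cnj (Fu \<xi>)) + indicator {- r..r} \<xi> * (Fv \<xi> * cnj (Fv \<xi>))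
          + (\<i> * (indicator {- r..r} \<xi> * (Fv \<xi> * cnj (Fu \<xi>))) - \<i> * (indicator {- r..r} \<xi> * (Fu \<xi> * cnj (Fv \<xi>)))))"
    unfolding energy_on_def integral_complex_of_real[symmetric] of_real_mult complex_norm_square of_real_indicator FG
    by (intro Bochner_Integration.integral_cong) (auto simp: algebra_simps)
  also have "\<dots> = of_real (band_form r (band_op r u) u) + of_real (band_form r (band_op r v) v)
      + (\<i> * of_real (band_form r (band_op r v) u) - \<i> * of_real (band_form r (band_op r u) v))"
    unfolding band_form_complex[OF r] Fu_def Fv_def using iF by simp
  also have "band_form r (band_op r v) u = band_form r (band_op r u) v"
    by (metis T_sym B_sym)
  finally have "complex_of_real (energy_on {- r..r} (\<F> G))
     = of_real (band_form r (band_op r u) u + band_form r (band_op r v) v)" by simp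
  then have "energy_on {- r..r} (\<F> G)
     = band_form r (band_op r u) u + band_form r (band_op r v) v" by (simp only: of_real_eq_iff)
  also have "\<dots> \<le> l (n - 1) * band_form r u u + l (n - 1) * band_form r v v"
    using orth by (intro add_mono max) auto
  also have "\<dots> = l (n - 1) * energy G"
  proof -
    have "(cmod (G x))\<^sup>2 = indicator {- r..r} x * (u x * u x) + indicator {- r..r} x * (v x * v x)" for x
      unfolding Guv cmod_power2 by (simp add: cutoff_def indicator_def power2_eq_square)
    then have "energy G = band_form r u u + band_form r v v"
      unfolding energy_def band_form_def by (simp add: integrable_band_form)
    then show ?thesis by (simp add: distrib_left)
  qed
  finally have "b * energy G \<le> l (n - 1) * energy G" using G(2) by linarith
  then show ?thesis using G(1) le by simp
qed

end

section \<open>Windows and exponentials\<close>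

lemma fourier_integral_convolution:
  assumes u: "integrable lborel u" and v: "integrable lborel v"
  shows "integrable lborel (\<lambda>x. LBINT y. u y * v (x - y))"
    and "\<F> (\<lambda>x. LBINT y. u y * v (x - y)) \<xi> = \<F> u \<xi> * \<F> v \<xi>"
proof -
  have [measurable]: "u \<in> borel_measurable lborel" "v \<in> borel_measurable lborel" using u v by auto
  have vs: "integrable lborel (\<lambda>x. v (x - y))" for y
    using lborel_integrable_real_affine[OF v, of 1 "- y"] by simp
  have shift: "(LBINT x. h (x - y)) = (LBINT x. h x)" for h :: "real \<Rightarrow> 'a::{banach, second_countable_topology}" and y
    using lborel_integral_real_affine[of 1 h "- y"] by simp
  have I: "integrable (lborel \<Otimes>\<^sub>M lborel) (\<lambda>(y, x). u y * v (x - y))"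
  proof (rule lborel_pair.Fubini_integrable)
    show "(\<lambda>(y, x). u y * v (x - y)) \<in> borel_measurable (lborel \<Otimes>\<^sub>M lborel)" by measurable
    have "(LBINT x. cmod (v (x - y))) = (LBINT x. cmod (v x))" for y
      by (rule shift[of "\<lambda>x. cmod (v x)" y])
    then show "integrable lborel (\<lambda>y. LBINT x. norm (case (y, x) of (y, x) \<Rightarrow> u y * v (x - y)))"
      using u by (simp add: norm_mult)
    show "AE y in lborel. integrable lborel (\<lambda>x. case (y, x) of (y, x) \<Rightarrow> u y * v (x - y))"
      using vs by simp
  qed
  from lborel_pair.integrable_snd[OF I] show "integrable lborel (\<lambda>x. LBINT y. u y * v (x - y))" .
  have I2: "integrable (lborel \<Otimes>\<^sub>M lborel) (\<lambda>(y, x). u y * v (x - y) * cis (- 2 * pi * x * \<xi>))"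
    by (rule Bochner_Integration.integrable_bound[OF I]) (auto simp: norm_mult)
  have "\<F> (\<lambda>x. LBINT y. u y * v (x - y)) \<xi>
      = (LBINT x. LBINT y. u y * v (x - y) * cis (- 2 * pi * x * \<xi>))"
    unfolding fourier_integral_cis integral_mult_left_zero[symmetric] ..
  also have "\<dots> = (LBINT y. LBINT x. u y * v (x - y) * cis (- 2 * pi * x * \<xi>))"
    by (rule lborel_pair.Fubini_integral[OF I2])
  also have "\<dots> = (LBINT y. u y * cis (- 2 * pi * y * \<xi>) * \<F> v \<xi>)"
  proof (intro Bochner_Integration.integral_cong refl)
    fix y
    have split: "u y * v (x - y) * cis (- 2 * pi * x * \<xi>)
       = u y * cis (- 2 * pi * y * \<xi>) * (v (x - y) * cis (- 2 * pi * (x - y) * \<xi>))" for x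
      by (simp add: mult_ac cis_mult) (simp add: algebra_simps)
    show "(LBINT x. u y * v (x - y) * cis (- 2 * pi * x * \<xi>))
        = u y * cis (- 2 * pi * y * \<xi>) * \<F> v \<xi>"
      unfolding fourier_integral_cis split integral_mult_right_zero
        shift[of "\<lambda>x. v x * cis (- 2 * pi * x * \<xi>)" y] ..
  qed
  also have "\<dots> = \<F> u \<xi> * \<F> v \<xi>"
    unfolding fourier_integral_cis[of u] by simp
  finally show "\<F> (\<lambda>x. LBINT y. u y * v (x - y)) \<xi> = \<F> u \<xi> * \<F> v \<xi>" .
qed

lemma fourier_integral_modulation:
  "\<F> (\<lambda>x. f x * cis (2 * pi * k * x)) \<xi> = \<F> f (\<xi> - k)"
  unfolding fourier_integral_cis by (simp add: mult.assoc cis_mult) (simp add: algebra_simps)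

lemma band_kernel_sin:
  assumes "s \<ge> 0" "z \<noteq> 0" shows "band_kernel s z = sin (2 * pi * z * s) / (pi * z)"
proof -
  let ?F = "\<lambda>x. sin (2 * pi * z * x) / (2 * pi * z)"
  have "((\<lambda>x. cos (2 * pi * z * x)) has_integral (?F s - ?F (- s))) {- s..s}"
  proof (rule fundamental_theorem_of_calculus)
    fix x assume "x \<in> {- s..s}"
    have "(?F has_real_derivative cos (2 * pi * z * x)) (at x within {- s..s})"
      using assms by (auto intro!: derivative_eq_intros)
    then show "(?F has_vector_derivative cos (2 * pi * z * x)) (at x within {- s..s})"
      by (simp add: has_real_derivative_iff_has_vector_derivative)
  qed (use assms in simp)
  then have "integral {- s..s} (\<lambda>x. cos (2 * pi * z * x)) = ?F s - ?F (- s)" by (rule integral_unique)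
  then have "band_kernel s z = ?F s - ?F (- s)"
    unfolding band_kernel_def using integral_indicator_HK[of "- s" s "\<lambda>x. cos (2 * pi * z * x)"] integrable_band_kernel[of s z]
    by simp
  then show ?thesis using assms by (simp add: field_simps)
qed

text \<open>
  Orthogonality of the exponentials over a period. The shift \<open>s\<close> of the lattice of frequencies only
  multiplies the sum by a function of modulus 1.
\<close>

lemma trigonometric_sum_energy:
  fixes a :: "nat \<Rightarrow> complex"
  assumes L: "L > 0"
  shows "(LBINT x. indicator {- (L/2)..L/2} x * (cmod (\<Sum>j<n. a j * cis (2 * pi * ((real j - s) / L) * x)))\<^sup>2)
    = L * (\<Sum>j<n. (cmod (a j))\<^sup>2)"
proof -
  let ?I = "indicator {- (L/2)..L/2} :: real \<Rightarrow> complex"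
  have orth: "(LBINT x. ?I x * cis (2 * pi * ((real j - real k) / L) * x)) = (if j = k then of_real L else 0)" for j k
  proof (cases "j = k")
    case True
    have "(LBINT x. complex_of_real (indicator {- (L/2)..L/2} x)) = of_real L"
      using L by (simp only: integral_complex_of_real) simp
    then show ?thesis using True by (simp add: of_real_indicator)
  next
    case False
    have "2 * pi * ((real j - real k) / L) * (L / 2) = of_int (int j - int k) * pi" using L by simp
    then have "sin (2 * pi * ((real j - real k) / L) * (L / 2)) = 0" unfolding sin_zero_iff_int2 by blast
    then show ?thesis
      using False L band_kernel_sin[of "L/2" "(real j - real k) / L"] band_kernel_complex[of "L/2" "(real j - real k) / L"] by simp
  qed
  have i: "integrable lborel (\<lambda>x. ?I x * cis (2 * pi * b * x))" for b
    by (rule integrable_indicator_bounded[where M=1]) auto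
  have ii: "integrable lborel (\<lambda>x. c * (?I x * cis (2 * pi * b * x)))" for b c
    by (rule integrable_mult_right[OF i])
  have expand: "?I x * ((\<Sum>j<n. a j * cis (2 * pi * ((real j - s) / L) * x)) * cnj (\<Sum>j<n. a j * cis (2 * pi * ((real j - s) / L) * x)))
      = (\<Sum>j<n. \<Sum>k<n. a j * cnj (a k) * (?I x * cis (2 * pi * ((real j - real k) / L) * x)))" for x
  proof -
    have "cis (2 * pi * ((real j - s) / L) * x) * cnj (cis (2 * pi * ((real k - s) / L) * x)) = cis (2 * pi * ((real j - real k) / L) * x)" for j k
      unfolding cis_cnj cis_mult by (rule arg_cong[where f=cis]) (simp add: diff_divide_distrib algebra_simps)
    then have "a j * cis (2 * pi * ((real j - s) / L) * x) * cnj (a k * cis (2 * pi * ((real k - s) / L) * x))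
       = a j * cnj (a k) * cis (2 * pi * ((real j - real k) / L) * x)" for j k
      unfolding complex_cnj_mult by (metis (no_types, lifting) mult.assoc mult.left_commute)
    then show ?thesis
      by (simp only: cnj_sum sum_product) (simp add: sum_distrib_left mult_ac)
  qed
  have "complex_of_real (LBINT x. indicator {- (L/2)..L/2} x * (cmod (\<Sum>j<n. a j * cis (2 * pi * ((real j - s) / L) * x)))\<^sup>2)
     = (LBINT x. (\<Sum>j<n. \<Sum>k<n. a j * cnj (a k) * (?I x * cis (2 * pi * ((real j - real k) / L) * x))))"
    unfolding integral_complex_of_real[symmetric] of_real_mult complex_norm_square of_real_indicator expand ..
  also have "\<dots> = (\<Sum>j<n. \<Sum>k<n. a j * cnj (a k) * (LBINT x. ?I x * cis (2 * pi * ((real j - real k) / L) * x)))"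
    by (simp only: Bochner_Integration.integral_sum Bochner_Integration.integrable_sum ii integral_mult_right_zero)
  also have "\<dots> = (\<Sum>j<n. \<Sum>k<n. if j = k then a j * cnj (a j) * of_real L else 0)"
    unfolding orth by (intro sum.cong) auto
  also have "\<dots> = (\<Sum>j<n. a j * cnj (a j) * of_real L)" by simp
  also have "\<dots> = complex_of_real (L * (\<Sum>j<n. (cmod (a j))\<^sup>2))"
    unfolding of_real_mult of_real_sum complex_norm_square by (simp add: sum_distrib_left mult_ac)
  finally show ?thesis by (simp only: of_real_eq_iff)
qed

lemma cmod_sum_mult_sq_le:
  "(cmod (\<Sum>j\<in>J. a j * z j))\<^sup>2 \<le> (\<Sum>j\<in>J. (cmod (a j))\<^sup>2) * (\<Sum>j\<in>J. (cmod (z j))\<^sup>2)"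
proof -
  have "(cmod (\<Sum>j\<in>J. a j * z j))\<^sup>2 \<le> (\<Sum>j\<in>J. cmod (a j) * cmod (z j))\<^sup>2"
    by (intro power_mono order_trans[OF norm_sum]) (simp_all add: norm_mult)
  also have "\<dots> \<le> (\<Sum>j\<in>J. (cmod (a j))\<^sup>2) * (\<Sum>j\<in>J. (cmod (z j))\<^sup>2)" by (rule Cauchy_Schwarz_ineq_sum)
  finally show ?thesis .
qed

text \<open>
  The window is the indicator of \<open>[-b, b]\<close> smoothed by a Gaussian, which makes it decay like a
  Gaussian in space (away from the interval) and in frequency at the same time. The
  reciprocal width \<open>t\<close> of the Gaussian is a parameter because the tail of the window of width 1
  is estimated through a wider one.
\<close>

definition window :: "real \<Rightarrow> real \<Rightarrow> real \<Rightarrow> real" where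
  "window t b x = (LBINT y. indicator {- b..b} y * exp (- pi * (t * (x - y))\<^sup>2))"

lemma integrable_window_integrand:
  "integrable lborel (\<lambda>y. indicator {- b..b} y * exp (- pi * (t * (x - y))\<^sup>2))"
  by (rule integrable_indicator_bounded[where M=1]) auto

lemma gaussian_shift:
  assumes t: "t > 0"
  shows "integrable lborel (\<lambda>y. exp (- pi * (t * (x - y))\<^sup>2))" "(LBINT y. exp (- pi * (t * (x - y))\<^sup>2)) = 1 / t"
  using lborel_integrable_real_affine[OF gaussian_fourier(1)[OF t], of "-1" x]
    lborel_integral_real_affine[of "-1" "\<lambda>y. exp (- pi * (t * y)\<^sup>2)" x] integral_gaussian[OF t] by simp_all

lemma window_nonneg: "0 \<le> window t b x"
  unfolding window_def by (intro integral_nonneg_AE) auto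

lemma window_le_1: "window 1 b x \<le> 1"
proof -
  have "window 1 b x \<le> (LBINT y. exp (- pi * (1 * (x - y))\<^sup>2))"
    unfolding window_def using integrable_window_integrand[of b 1 x] gaussian_shift(1)[of 1 x]
    by (intro integral_mono) (auto simp: indicator_def)
  then show ?thesis unfolding gaussian_shift(2)[OF zero_less_one] by simp
qed

lemma window_ge:
  assumes "\<bar>x\<bar> + 1 \<le> b" shows "2 * exp (- pi) \<le> window 1 b x"
proof -
  have "2 * exp (- pi) = (LBINT y. indicator {x - 1..x + 1} y * exp (- pi))" by simp
  also have "\<dots> \<le> window 1 b x"
    unfolding window_def
  proof (rule integral_mono[OF _ integrable_window_integrand])
    show "integrable lborel (\<lambda>y. indicator {x - 1..x + 1} y * exp (- pi))"
      by (rule integrable_indicator_bounded[where M="exp (- pi)"]) auto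
    fix y
    show "indicator {x - 1..x + 1} y * exp (- pi) \<le> indicator {- b..b} y * exp (- pi * (1 * (x - y))\<^sup>2)"
    proof (cases "y \<in> {x - 1..x + 1}")
      case True
      then have "(x - y)\<^sup>2 \<le> 1" by (intro abs_square_le_1[THEN iffD2]) auto
      then have "exp (- pi) \<le> exp (- pi * (x - y)\<^sup>2)" by (simp add: mult_left_le)
      then show ?thesis using True assms by (auto simp: indicator_def)
    qed simp
  qed
  finally show ?thesis .
qed

lemma continuous_window: "continuous_on UNIV (window t b)"
proof (rule continuous_at_imp_continuous_on, intro ballI, unfold continuous_at_sequentially comp_def, intro allI impI)
  fix x :: real and X assume X: "X \<longlonglongrightarrow> x"
  show "(\<lambda>n. window t b (X n)) \<longlonglongrightarrow> window t b x"
    unfolding window_def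
  proof (rule integral_dominated_convergence[where w="\<lambda>y. indicator {- b..b} y * 1"])
    show "integrable lborel (\<lambda>y. indicator {- b..b} y * (1::real))"
      by (rule integrable_indicator_bounded[where M=1]) auto
    show "AE y in lborel. (\<lambda>n. indicator {- b..b} y * exp (- pi * (t * (X n - y))\<^sup>2))
        \<longlonglongrightarrow> indicator {- b..b} y * exp (- pi * (t * (x - y))\<^sup>2)"
      by (intro AE_I2 tendsto_intros X)
  qed (auto simp: indicator_def)
qed

lemma measurable_window [measurable]: "window t b \<in> borel_measurable borel"
  by (intro borel_measurable_continuous_onI continuous_window)

lemma window_fourier:
  assumes t: "t > 0" and b: "b \<ge> 0"
  shows "integrable lborel (window t b)" "(LBINT x. window t b x) = 2 * b / t"
    and "cmod (\<F> (\<lambda>x. of_real (window t b x)) \<xi>) \<le> 2 * b * (exp (- pi * (\<xi> / t)\<^sup>2) / t)"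
proof -
  define u where "u = (\<lambda>y. complex_of_real (indicator {- b..b} y))"
  define v where "v = (\<lambda>y. complex_of_real (exp (- pi * (t * y)\<^sup>2)))"
  have u: "integrable lborel u"
    unfolding u_def by (intro integrable_of_real integrable_real_indicator) (auto simp: emeasure_lborel_Icc_eq)
  have v: "integrable lborel v" unfolding v_def by (rule gaussian_fourier(2)[OF t])
  have eq: "(\<lambda>x. complex_of_real (window t b x)) = (\<lambda>x. LBINT y. u y * v (x - y))"
    unfolding window_def u_def v_def by (simp flip: integral_complex_of_real)
  have Fw: "\<F> (\<lambda>x. of_real (window t b x)) \<eta> = \<F> u \<eta> * of_real (exp (- pi * (\<eta> / t)\<^sup>2) / t)" for \<eta>
    unfolding eq fourier_integral_convolution(2)[OF u v] gaussian_fourier(3)[OF t, folded v_def] ..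
  have "integrable lborel (\<lambda>x. complex_of_real (window t b x))"
    unfolding eq by (rule fourier_integral_convolution(1)[OF u v])
  from integrable_norm[OF this] show "integrable lborel (window t b)" by (simp add: window_nonneg)
  have "complex_of_real (LBINT x. window t b x) = \<F> (\<lambda>x. of_real (window t b x)) 0"
    unfolding fourier_integral_cis by (simp flip: integral_complex_of_real)
  also have "\<dots> = of_real (2 * b / t)"
    unfolding Fw unfolding fourier_integral_cis u_def using b by simp
  finally show "(LBINT x. window t b x) = 2 * b / t" unfolding of_real_eq_iff .
  have "cmod (\<F> u \<xi>) \<le> (LBINT y. cmod (u y))" by (rule norm_fourier_integral_le)
  also have "\<dots> = 2 * b" using b by (simp add: u_def)
  finally show "cmod (\<F> (\<lambda>x. of_real (window t b x)) \<xi>) \<le> 2 * b * (exp (- pi * (\<xi> / t)\<^sup>2) / t)"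
    unfolding Fw norm_mult norm_of_real using t by (simp add: divide_right_mono mult_right_mono)
qed

lemma gaussian_split:
  assumes "\<rho> \<ge> 0" "\<bar>s\<bar> \<ge> \<rho>" shows "exp (- pi * s\<^sup>2) \<le> exp (- pi * \<rho>\<^sup>2 / 2) * exp (- pi * s\<^sup>2 / 2)"
proof -
  have "\<rho>\<^sup>2 \<le> s\<^sup>2" using assms abs_le_square_iff[of \<rho> s] by simp
  then have "pi * \<rho>\<^sup>2 \<le> pi * s\<^sup>2" by (intro mult_left_mono) auto
  then have "- pi * s\<^sup>2 \<le> - pi * \<rho>\<^sup>2 / 2 + - pi * s\<^sup>2 / 2" by linarith
  then show ?thesis unfolding exp_add[symmetric] exp_le_cancel_iff .
qed

text \<open>
  At distance at least \<open>\<rho>\<close> half of the exponent already pays for the factor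
  \<open>exp (- pi * \<rho>\<^sup>2 / 2)\<close>; the other half is the window of width \<open>sqrt 2\<close>, which has finite mass.
\<close>

lemma window_tail:
  assumes b: "b \<ge> 0" and \<rho>: "\<rho> \<ge> 0" and r: "r \<ge> b + \<rho>"
  shows "integrable lborel (\<lambda>x. indicator (- {- r..r}) x * window 1 b x)"
    and "(LBINT x. indicator (- {- r..r}) x * window 1 b x) \<le> exp (- pi * \<rho>\<^sup>2 / 2) * (4 * b)"
proof -
  show i: "integrable lborel (\<lambda>x. indicator (- {- r..r}) x * window 1 b x)"
    by (rule Bochner_Integration.integrable_bound[OF window_fourier(1)[OF zero_less_one b]]) (auto simp: indicator_def)
  define t where "t = 1 / sqrt 2"
  have t: "t > 0" "t\<^sup>2 = 1/2" by (simp_all add: t_def power_divide)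
  have le: "indicator (- {- r..r}) x * window 1 b x \<le> exp (- pi * \<rho>\<^sup>2 / 2) * window t b x" for x
  proof (cases "x \<in> {- r..r}")
    case True then show ?thesis by (simp add: window_nonneg)
  next
    case False
    have "window 1 b x \<le> (LBINT y. exp (- pi * \<rho>\<^sup>2 / 2) * (indicator {- b..b} y * exp (- pi * (t * (x - y))\<^sup>2)))"
      unfolding window_def
    proof (rule integral_mono[OF integrable_window_integrand integrable_mult_right[OF integrable_window_integrand]])
      fix y
      show "indicator {- b..b} y * exp (- pi * (1 * (x - y))\<^sup>2) \<le> exp (- pi * \<rho>\<^sup>2 / 2) * (indicator {- b..b} y * exp (- pi * (t * (x - y))\<^sup>2))"
      proof (cases "y \<in> {- b..b}")
        case True
        have "\<bar>x - y\<bar> \<ge> \<rho>" using False True r by auto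
        from gaussian_split[OF \<rho> this] show ?thesis using True by (simp add: power_mult_distrib t(2))
      qed simp
    qed
    then show ?thesis using False by (simp add: window_def)
  qed
  have "(LBINT x. indicator (- {- r..r}) x * window 1 b x) \<le> (LBINT x. exp (- pi * \<rho>\<^sup>2 / 2) * window t b x)"
    by (intro integral_mono i le integrable_mult_right window_fourier(1)[OF t(1) b])
  also have "\<dots> = exp (- pi * \<rho>\<^sup>2 / 2) * (2 * b * sqrt 2)"
    unfolding integral_mult_right_zero window_fourier(2)[OF t(1) b] by (simp add: t_def)
  also have "\<dots> \<le> exp (- pi * \<rho>\<^sup>2 / 2) * (4 * b)"
  proof (intro mult_left_mono)
    have "sqrt 2 \<le> 2" by (rule real_le_lsqrt) auto
    then have "2 * b * sqrt 2 \<le> 2 * b * 2" using b by (intro mult_left_mono) auto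
    then show "2 * b * sqrt 2 \<le> 4 * b" by simp
  qed simp
  finally show "(LBINT x. indicator (- {- r..r}) x * window 1 b x) \<le> exp (- pi * \<rho>\<^sup>2 / 2) * (4 * b)" .
qed

section \<open>The space of test functions\<close>

text \<open>
  Here \<open>r\<close> is half the length of the interval, so the bound on \<open>n\<close> says that the \<open>n\<close> frequencies of step \<open>1 / L\<close>
  centred at 0 stay in \<open>[- (r - \<rho>), r - \<rho>]\<close>, at distance \<open>\<rho>\<close> from the complement of the band. The
  function \<open>G\<close> is \<open>P - H\<close>, where \<open>P\<close> is the combination before cutting off and \<open>H\<close> its part outside the
  interval. Outside the band the Fourier transform of \<open>P\<close> is small pointwise, and that of \<open>H\<close> in
  energy by Plancherel's theorem.
\<close>

lemma test_space_estimate: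
  fixes a :: "nat \<Rightarrow> complex" and r \<rho> :: real
  assumes \<rho>: "\<rho> \<ge> 1" and r: "r \<ge> 3 * \<rho>" and n: "real n \<le> 4 * (r - \<rho>) * (r - 2 * \<rho>)"
  defines "L \<equiv> 2 * (r - 2 * \<rho>)"
  defines "p \<equiv> \<lambda>j x. complex_of_real (window 1 (r - \<rho>) x) * cis (2 * pi * ((real j - (real n - 1) / 2) / L) * x)"
  defines "G \<equiv> \<lambda>x. (\<Sum>j<n. a j * p j x) * indicator {- r..r} x"
  defines "A \<equiv> (\<Sum>j<n. (cmod (a j))\<^sup>2)"
  shows "4 * exp (- 2 * pi) * L * A \<le> energy G"
    and "energy G - 8 * real n * r * (r + 1) * exp (- pi * \<rho>\<^sup>2 / 2) * A
      \<le> energy_on {- r..r} (\<F> G)"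
proof -
  define b where "b = r - \<rho>"
  have b: "b \<ge> 0" "b \<le> r" using \<rho> r by (simp_all add: b_def)
  have L: "L > 0" using \<rho> r by (simp add: L_def)
  define k where "k = (\<lambda>j. (real j - (real n - 1) / 2) / L)"
  define W where "W = (\<lambda>x. complex_of_real (window 1 b x))"
  have p_eq: "p = (\<lambda>j x. W x * cis (2 * pi * k j * x))" by (simp add: p_def W_def k_def b_def)
  have wi: "integrable lborel (window 1 b)" by (rule window_fourier(1)[OF zero_less_one b(1)])
  then have W: "integrable lborel W" unfolding W_def by (rule integrable_of_real)
  have p: "integrable lborel (p j)" for j
    unfolding p_eq by (rule integrable_mult_bounded[OF W, where C=1]) auto
  have p_norm: "cmod (p j x) = window 1 b x" for j x
    by (simp add: p_eq W_def norm_mult window_nonneg)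
  have A: "A \<ge> 0" unfolding A_def by (intro sum_nonneg) simp
  define P where "P = (\<lambda>x. \<Sum>j<n. a j * p j x)"
  have G_eq: "G = (\<lambda>x. P x * indicator {- r..r} x)" by (simp add: G_def P_def)
  have Pi: "integrable lborel P" unfolding P_def using p by simp
  have P_le: "(cmod (P x))\<^sup>2 \<le> A * real n * window 1 b x" for x
  proof -
    have "(cmod (P x))\<^sup>2 \<le> A * (\<Sum>j<n. (cmod (p j x))\<^sup>2)"
      unfolding P_def A_def by (rule cmod_sum_mult_sq_le)
    also have "\<dots> = A * real n * (window 1 b x)\<^sup>2" by (simp add: p_norm)
    also have "\<dots> \<le> A * real n * window 1 b x"
      using A window_nonneg[of 1 b x] window_le_1[of b x]
      by (intro mult_left_mono) (auto simp: power2_eq_square mult_left_le)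
    finally show ?thesis .
  qed
  define H where "H = (\<lambda>x. P x * indicator (- {- r..r}) x)"
  have [measurable]: "P \<in> borel_measurable lborel" using Pi by auto
  have Gi: "integrable lborel G"
    unfolding G_eq by (rule integrable_mult_bounded[OF Pi, where C=1]) (auto simp: indicator_def)
  have Hi: "integrable lborel H"
    unfolding H_def by (rule integrable_mult_bounded[OF Pi, where C=1]) (auto simp: indicator_def)
  have GL2: "G \<in> L2"
  proof (rule L2I_bound(1)[of "\<lambda>x. A * real n * window 1 b x"])
    show "(cmod (G x))\<^sup>2 \<le> A * real n * window 1 b x" for x
      using P_le[of x] A window_nonneg[of 1 b x] by (auto simp: G_eq indicator_def)
  qed (use wi Gi in auto)
  define E where "E = exp (- pi * \<rho>\<^sup>2 / 2)"
  have HL2: "H \<in> L2" and Hen: "energy H \<le> A * real n * (E * (4 * r))"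
  proof -
    have w: "integrable lborel (\<lambda>x. A * real n * (indicator (- {- r..r}) x * window 1 b x))"
      using window_tail(1)[of b \<rho> r] b \<rho> by (intro integrable_mult_right) (auto simp: b_def)
    have le: "(cmod (H x))\<^sup>2 \<le> A * real n * (indicator (- {- r..r}) x * window 1 b x)" for x
      using P_le[of x] by (auto simp: H_def indicator_def)
    note * = L2I_bound[OF w borel_measurable_integrable[OF Hi] le]
    show "H \<in> L2" by (rule *(1))
    have "energy H \<le> A * real n * (LBINT x. indicator (- {- r..r}) x * window 1 b x)"
      using *(2) by simp
    also have "\<dots> \<le> A * real n * (E * (4 * b))"
      unfolding E_def using window_tail(2)[of b \<rho> r] A b \<rho> by (intro mult_left_mono) (auto simp: b_def)
    also have "\<dots> \<le> A * real n * (E * (4 * r))"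
      using A b by (intro mult_left_mono) (auto simp: E_def)
    finally show "energy H \<le> A * real n * (E * (4 * r))" .
  qed
  show "4 * exp (- 2 * pi) * L * A \<le> energy G"
  proof -
    let ?q = "\<lambda>x. \<Sum>j<n. a j * cis (2 * pi * k j * x)"
    have Pq: "P x = W x * ?q x" for x
      unfolding P_def p_eq by (simp add: sum_distrib_left mult_ac)
    have "4 * exp (- 2 * pi) * L * A
        = (LBINT x. 4 * exp (- 2 * pi) * (indicator {- (L/2)..L/2} x * (cmod (?q x))\<^sup>2))"
      unfolding k_def A_def integral_mult_right_zero trigonometric_sum_energy[OF L] by simp
    also have "\<dots> \<le> energy G"
      unfolding energy_def
    proof (rule integral_mono)
      show "integrable lborel (\<lambda>x. (cmod (G x))\<^sup>2)" by (rule L2_integrable[OF GL2])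
      have "(cmod (?q x))\<^sup>2 \<le> A * real n" for x
        using cmod_sum_mult_sq_le[of a "\<lambda>j. cis (2 * pi * k j * x)" "{..<n}"] by (simp add: A_def)
      then show "integrable lborel (\<lambda>x. 4 * exp (- 2 * pi) * (indicator {- (L/2)..L/2} x * (cmod (?q x))\<^sup>2))"
        by (intro integrable_mult_right integrable_indicator_bounded[where M="A * real n"]) auto
      fix x
      show "4 * exp (- 2 * pi) * (indicator {- (L/2)..L/2} x * (cmod (?q x))\<^sup>2) \<le> (cmod (G x))\<^sup>2"
      proof (cases "x \<in> {- (L/2)..L/2}")
        case True
        moreover have "L / 2 = r - 2 * \<rho>" by (simp add: L_def)
        ultimately have "\<bar>x\<bar> + 1 \<le> b" "x \<in> {- r..r}" using \<rho> r by (auto simp: b_def abs_le_iff)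
        then have "(2 * exp (- pi))\<^sup>2 \<le> (window 1 b x)\<^sup>2" by (intro power_mono window_ge) auto
        also have "(2 * exp (- pi))\<^sup>2 = 4 * exp (- 2 * pi)"
          by (simp add: power_mult_distrib flip: exp_of_nat_mult)
        finally have "4 * exp (- 2 * pi) * (cmod (?q x))\<^sup>2 \<le> (window 1 b x)\<^sup>2 * (cmod (?q x))\<^sup>2"
          by (intro mult_right_mono) auto
        also have "\<dots> = (cmod (G x))\<^sup>2"
          using \<open>x \<in> {- r..r}\<close> Pq[of x]
          by (simp add: G_eq norm_mult power_mult_distrib W_def)
        finally show ?thesis using True by simp
      qed simp
    qed
    finally show ?thesis .
  qed
  have FP: "\<F> P \<xi> = (\<Sum>j<n. a j * \<F> W (\<xi> - k j))" for \<xi>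
  proof -
    have "\<F> P \<xi> = (LBINT x. (\<Sum>j<n. a j * (p j x * cis (- 2 * pi * x * \<xi>))))"
      unfolding fourier_integral_cis P_def by (simp add: sum_distrib_right mult.assoc)
    also have "\<dots> = (\<Sum>j<n. a j * \<F> (p j) \<xi>)"
      unfolding fourier_integral_cis[of "p _"]
      by (simp only: Bochner_Integration.integral_sum integral_mult_right_zero integrable_mult_right[OF integrable_mult_cis[OF p]])
    also have "\<dots> = (\<Sum>j<n. a j * \<F> W (\<xi> - k j))"
      unfolding p_eq by (simp only: fourier_integral_modulation)
    finally show ?thesis .
  qed
  have GPH: "G = (\<lambda>x. P x - H x)"
    by (auto simp: G_eq H_def indicator_def)
  have FG: "\<F> G \<xi> = \<F> P \<xi> - \<F> H \<xi>" for \<xi>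
    unfolding GPH by (rule fourier_integral_diff[OF Pi Hi])
  have k_le: "\<bar>k j\<bar> \<le> r - \<rho>" if "j < n" for j
  proof -
    have "\<bar>real j - (real n - 1) / 2\<bar> \<le> real n / 2" using that by (simp add: abs_le_iff field_simps)
    also have "\<dots> \<le> (r - \<rho>) * L" using n by (simp add: L_def algebra_simps)
    finally show ?thesis using L by (simp add: k_def abs_divide pos_divide_le_eq)
  qed
  have FP_le: "indicator (- {- r..r}) \<xi> * (cmod (\<F> P \<xi>))\<^sup>2
      \<le> A * (\<Sum>j<n. 4 * r\<^sup>2 * E * exp (- pi * (1 * (k j - \<xi>))\<^sup>2))" for \<xi>
  proof (cases "\<xi> \<in> {- r..r}")
    case True
    then show ?thesis using A by (simp add: E_def sum_nonneg)
  next
    case False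
    have "(cmod (\<F> P \<xi>))\<^sup>2 \<le> A * (\<Sum>j<n. (cmod (\<F> W (\<xi> - k j)))\<^sup>2)"
      unfolding FP A_def by (rule cmod_sum_mult_sq_le)
    also have "\<dots> \<le> A * (\<Sum>j<n. 4 * r\<^sup>2 * E * exp (- pi * (1 * (k j - \<xi>))\<^sup>2))"
    proof (intro mult_left_mono[OF _ A] sum_mono)
      fix j assume "j \<in> {..<n}"
      then have far: "\<bar>\<xi> - k j\<bar> \<ge> \<rho>" using k_le[of j] False by auto
      let ?e = "exp (- pi * (\<xi> - k j)\<^sup>2)"
      have "(cmod (\<F> W (\<xi> - k j)))\<^sup>2 \<le> (2 * b * ?e)\<^sup>2"
        unfolding W_def using window_fourier(3)[OF zero_less_one b(1), of "\<xi> - k j"] by (intro power_mono) simp_all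
      also have "\<dots> = 4 * b\<^sup>2 * (?e * ?e)" by (simp add: power2_eq_square)
      also have "\<dots> \<le> 4 * r\<^sup>2 * (E * ?e)"
      proof (intro mult_mono)
        have "?e \<le> E * exp (- pi * (\<xi> - k j)\<^sup>2 / 2)"
          unfolding E_def using \<rho> far by (intro gaussian_split) auto
        also have "\<dots> \<le> E * 1" by (intro mult_left_mono) (auto simp: E_def)
        finally show "?e \<le> E" by simp
        show "b\<^sup>2 \<le> r\<^sup>2" using b by (intro power_mono) auto
      qed (auto simp: E_def)
      finally show "(cmod (\<F> W (\<xi> - k j)))\<^sup>2 \<le> 4 * r\<^sup>2 * E * exp (- pi * (1 * (k j - \<xi>))\<^sup>2)"
        by (simp add: power2_commute mult.assoc)
    qed
    finally show ?thesis using False by simp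
  qed
  have FGL2: "\<F> G \<in> L2" and FGen: "energy (\<F> G) = energy G"
    by (rule Plancherel_L1_L2[OF GL2 Gi])+
  have FHL2: "\<F> H \<in> L2" and FHen: "energy (\<F> H) = energy H"
    by (rule Plancherel_L1_L2[OF HL2 Hi])+
  have total: "energy G = energy_on {- r..r} (\<F> G) + energy_on (- {- r..r}) (\<F> G)"
    unfolding FGen[symmetric] by (rule energy_split[OF FGL2]) simp
  have FH_int: "(LBINT \<xi>. (cmod (\<F> H \<xi>))\<^sup>2) = energy H"
    using FHen unfolding energy_def[of "\<F> H"] .
  have "energy_on (- {- r..r}) (\<F> G)
     \<le> (LBINT \<xi>. 2 * (A * (\<Sum>j<n. 4 * r\<^sup>2 * E * exp (- pi * (1 * (k j - \<xi>))\<^sup>2))) + 2 * (cmod (\<F> H \<xi>))\<^sup>2)"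
    unfolding energy_on_def
  proof (rule integral_mono)
    show "integrable lborel (\<lambda>\<xi>. indicator (- {- r..r}) \<xi> * (cmod (\<F> G \<xi>))\<^sup>2)"
      by (rule integrable_energy_on[OF FGL2]) auto
    show "integrable lborel (\<lambda>\<xi>. 2 * (A * (\<Sum>j<n. 4 * r\<^sup>2 * E * exp (- pi * (1 * (k j - \<xi>))\<^sup>2))) + 2 * (cmod (\<F> H \<xi>))\<^sup>2)"
      by (intro Bochner_Integration.integrable_add integrable_mult_right Bochner_Integration.integrable_sum
        gaussian_shift(1) L2_integrable[OF FHL2]) simp
    fix \<xi>
    have "indicator (- {- r..r}) \<xi> * (cmod (\<F> G \<xi>))\<^sup>2
        \<le> indicator (- {- r..r}) \<xi> * (2 * (cmod (\<F> P \<xi>))\<^sup>2 + 2 * (cmod (\<F> H \<xi>))\<^sup>2)"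
      unfolding FG using cmod_add_sq_le[of "\<F> P \<xi>" "- \<F> H \<xi>"]
      by (intro mult_left_mono) auto
    also have "\<dots> \<le> 2 * (indicator (- {- r..r}) \<xi> * (cmod (\<F> P \<xi>))\<^sup>2) + 2 * (cmod (\<F> H \<xi>))\<^sup>2"
      by (auto simp: indicator_def)
    also have "\<dots> \<le> 2 * (A * (\<Sum>j<n. 4 * r\<^sup>2 * E * exp (- pi * (1 * (k j - \<xi>))\<^sup>2))) + 2 * (cmod (\<F> H \<xi>))\<^sup>2"
      by (intro add_right_mono mult_left_mono FP_le) simp
    finally show "indicator (- {- r..r}) \<xi> * (cmod (\<F> G \<xi>))\<^sup>2 \<le> \<dots>" .
  qed
  also have "\<dots> = 2 * (A * (\<Sum>j<n. 4 * r\<^sup>2 * E * 1)) + 2 * energy H"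
  proof -
    have "(LBINT \<xi>. exp (- pi * (1 * (k j - \<xi>))\<^sup>2)) = 1" for j
      using gaussian_shift(2)[of 1 "k j"] by simp
    then show ?thesis
      unfolding FH_int[symmetric]
      by (simp only: Bochner_Integration.integral_add Bochner_Integration.integral_sum integral_mult_right_zero
        Bochner_Integration.integrable_sum integrable_mult_right gaussian_shift(1)[OF zero_less_one] L2_integrable[OF FHL2])
  qed
  also have "\<dots> \<le> 2 * (A * (\<Sum>j<n. 4 * r\<^sup>2 * E * 1)) + 2 * (A * real n * (E * (4 * r)))"
    by (intro add_left_mono mult_left_mono Hen) simp
  also have "\<dots> = 8 * real n * r * (r + 1) * E * A"
    by (simp add: power2_eq_square algebra_simps)
  finally have "energy_on (- {- r..r}) (\<F> G)
      \<le> 8 * real n * r * (r + 1) * E * A" .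
  then show "energy G - 8 * real n * r * (r + 1) * exp (- pi * \<rho>\<^sup>2 / 2) * A
      \<le> energy_on {- r..r} (\<F> G)"
    using total unfolding E_def by linarith
qed

text \<open>
  The constant comes from dividing the two estimates of \<open>test_space_estimate\<close>, with \<open>L \<ge> 2 * r / 3\<close>.
\<close>

lemma pos_eigenvalue_lower_bound:
  assumes \<rho>: "\<rho> \<ge> 1" and r: "r \<ge> 3 * \<rho>" and n: "n \<ge> 1" "real n \<le> 4 * (r - \<rho>) * (r - 2 * \<rho>)"
  shows "1 - 3 * real n * (r + 1) * exp (2 * pi) * exp (- pi * \<rho>\<^sup>2 / 2)
    \<le> pos_eigenvalue (S_op {- r..r} {- r..r}) n"
proof -
  define L where "L = 2 * (r - 2 * \<rho>)"
  have L: "L > 0" "2 * r / 3 \<le> L" using \<rho> r by (simp_all add: L_def)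
  have rp: "r > 0" using \<rho> r by simp
  define p where "p = (\<lambda>j x. complex_of_real (window 1 (r - \<rho>) x) * cis (2 * pi * ((real j - (real n - 1) / 2) / L) * x))"
  define E where "E = exp (- pi * \<rho>\<^sup>2 / 2)"
  let ?b = "1 - 3 * real n * (r + 1) * exp (2 * pi) * E"
  have "?b \<le> pos_eigenvalue (S_op {- r..r} {- r..r}) n"
  proof (rule pos_eigenvalue_ge[OF rp n(1)])
    show "continuous_on UNIV (p j)" for j
      unfolding p_def cis_conv_exp by (intro continuous_intros continuous_window)
    show "cmod (p j x) \<le> 1" for j x
      using window_nonneg window_le_1 by (simp add: p_def norm_mult)
    fix a :: "nat \<Rightarrow> complex" assume a: "\<exists>j<n. a j \<noteq> 0"
    define G where "G = (\<lambda>x. (\<Sum>j<n. a j * p j x) * indicator {- r..r} x)"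
    define A where "A = (\<Sum>j<n. (cmod (a j))\<^sup>2)"
    have A: "A > 0" unfolding A_def using a by (auto intro!: sum_pos2)
    have est: "4 * exp (- 2 * pi) * L * A \<le> energy G"
      "energy G - 8 * real n * r * (r + 1) * E * A
        \<le> energy_on {- r..r} (\<F> G)"
      using test_space_estimate[OF \<rho> r n(2), of a] by (simp_all only: G_def p_def L_def A_def E_def)
    have G0: "0 < 4 * exp (- 2 * pi) * L * A" using A L by simp
    then have Gpos: "energy G > 0" using est(1) by linarith
    have "8 * real n * r * (r + 1) * E * A = 3 * real n * (r + 1) * exp (2 * pi) * E * (4 * exp (- 2 * pi) * (2 * r / 3) * A)"
      by (simp add: exp_minus field_simps)
    also have "\<dots> \<le> 3 * real n * (r + 1) * exp (2 * pi) * E * (4 * exp (- 2 * pi) * L * A)"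
      using rp L A by (intro mult_left_mono mult_right_mono) (auto simp: E_def)
    also have "\<dots> \<le> 3 * real n * (r + 1) * exp (2 * pi) * E * energy G"
      using rp est(1) by (intro mult_left_mono) (auto simp: E_def)
    finally have "?b * energy G \<le> energy G - 8 * real n * r * (r + 1) * E * A"
      by (simp add: left_diff_distrib)
    also note est(2)
    finally show "let G = (\<lambda>x. (\<Sum>j<n. a j * p j x) * indicator {- r..r} x) in
      energy G > 0 \<and> ?b * energy G \<le> energy_on {- r..r} (\<F> G)"
      using Gpos by (simp add: Let_def G_def[symmetric])
  qed
  then show ?thesis by (simp add: E_def)
qed

theorem theorem1p4:
  fixes \<epsilon> :: real
  assumes "0 < \<epsilon>" and "\<epsilon> < 1"
  shows "\<exists>\<delta>::real. 0 < \<delta> \<and> \<delta> < 1 \<and>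
    (\<exists>c0>0. \<forall>c\<ge>c0. lam (nat \<lfloor>(1 - \<epsilon>) * c\<rfloor>) c \<ge> 1 - \<delta> powr c)"
proof -
  \<comment> \<open>The choice gives \<open>1 - \<epsilon> \<le> (1 - 2 * \<eta>) * (1 - 4 * \<eta>)\<close>, which makes room for the frequencies, and \<open>3 * \<rho> \<le> r\<close> below.\<close>
  define \<eta> where "\<eta> = \<epsilon> / 6"
  have \<eta>: "0 < \<eta>" "\<eta> < 1 / 6" using assms by (simp_all add: \<eta>_def)
  \<comment> \<open>Half of the decay \<open>exp (- pi * \<eta>\<^sup>2 / 2 * c)\<close> of the error; the other half absorbs the polynomial factor.\<close>
  define \<delta> where "\<delta> = exp (- pi * \<eta>\<^sup>2 / 4)"
  have \<delta>: "0 < \<delta>" "\<delta> < 1" using \<eta> by (simp_all add: \<delta>_def)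
  define \<kappa> where "\<kappa> = pi * \<eta>\<^sup>2 / 4"
  have \<kappa>: "\<kappa> > 0" using \<eta> by (simp add: \<kappa>_def)
  have "\<forall>\<^sub>F c in at_top. 3 * c * (sqrt c / 2 + 1) * exp (2 * pi) \<le> exp (\<kappa> * c)"
    using \<kappa> by real_asymp
  moreover have "\<forall>\<^sub>F c in at_top. 1 \<le> \<eta> * sqrt c" using \<eta>(1) by real_asymp
  moreover have "\<forall>\<^sub>F c in at_top. 1 \<le> (1 - \<epsilon>) * c" using assms(2) by real_asymp
  ultimately have "\<forall>\<^sub>F c in at_top. 3 * c * (sqrt c / 2 + 1) * exp (2 * pi) \<le> exp (\<kappa> * c)
      \<and> 1 \<le> \<eta> * sqrt c \<and> 1 \<le> (1 - \<epsilon>) * c"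
    by eventually_elim simp
  then obtain c1 where c1: "\<And>c. c \<ge> c1 \<Longrightarrow> 3 * c * (sqrt c / 2 + 1) * exp (2 * pi) \<le> exp (\<kappa> * c)
      \<and> 1 \<le> \<eta> * sqrt c \<and> 1 \<le> (1 - \<epsilon>) * c"
    by (auto simp: eventually_at_top_linorder)
  have main: "1 - \<delta> powr c \<le> lam (nat \<lfloor>(1 - \<epsilon>) * c\<rfloor>) c" if c: "c \<ge> max c1 1" for c
  proof -
    define n where "n = nat \<lfloor>(1 - \<epsilon>) * c\<rfloor>"
    define r where "r = sqrt c / 2"
    define \<rho> where "\<rho> = \<eta> * sqrt c"
    have cp: "c \<ge> 1" using c by simp
    have sq: "sqrt c * sqrt c = c" using cp by simp
    have growth: "3 * c * (r + 1) * exp (2 * pi) \<le> exp (\<kappa> * c)"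
      and \<rho>: "1 \<le> \<rho>" and n1: "1 \<le> (1 - \<epsilon>) * c"
      using c1[of c] c by (auto simp: r_def \<rho>_def)
    have \<rho>2: "- pi * \<rho>\<^sup>2 / 2 = - 2 * \<kappa> * c"
      using cp by (simp add: \<rho>_def \<kappa>_def power_mult_distrib)
    have "3 * c * (r + 1) * exp (2 * pi) * exp (- pi * \<rho>\<^sup>2 / 2) \<le> exp (\<kappa> * c) * exp (- 2 * \<kappa> * c)"
      unfolding \<rho>2 using growth by (intro mult_right_mono) auto
    also have "\<dots> = exp (- \<kappa> * c)" by (simp flip: exp_add)
    finally have asym: "3 * c * (r + 1) * exp (2 * pi) * exp (- pi * \<rho>\<^sup>2 / 2) \<le> exp (- \<kappa> * c)" .
    have n: "1 \<le> n" using n1 by (simp add: n_def le_nat_iff le_floor_iff)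
    have nle: "real n \<le> (1 - \<epsilon>) * c" using n1 by (simp add: n_def)
    also have "\<dots> \<le> (1 - 6 * \<eta> + 8 * \<eta>\<^sup>2) * c" using cp by (intro mult_right_mono) (auto simp: \<eta>_def)
    also have "\<dots> = 4 * (r - \<rho>) * (r - 2 * \<rho>)"
      unfolding r_def \<rho>_def using sq by (simp add: power2_eq_square algebra_simps)
    finally have n2: "real n \<le> 4 * (r - \<rho>) * (r - 2 * \<rho>)" .
    have r3: "3 * \<rho> \<le> r" using \<eta>(2) cp by (simp add: r_def \<rho>_def)
    have rp: "r \<ge> 0" using cp by (simp add: r_def)
    have "(1 - \<epsilon>) * c \<le> 1 * c" using assms(1) cp by (intro mult_right_mono) auto
    then have nc: "real n \<le> c" using nle by linarith
    have "3 * real n * (r + 1) * exp (2 * pi) * exp (- pi * \<rho>\<^sup>2 / 2) \<le> 3 * c * (r + 1) * exp (2 * pi) * exp (- pi * \<rho>\<^sup>2 / 2)"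
      using nc rp by (intro mult_right_mono mult_left_mono) auto
    also note asym
    also have "exp (- \<kappa> * c) = \<delta> powr c" by (simp add: \<delta>_def \<kappa>_def powr_def)
    finally have "1 - \<delta> powr c \<le> 1 - 3 * real n * (r + 1) * exp (2 * pi) * exp (- pi * \<rho>\<^sup>2 / 2)" by simp
    also have "\<dots> \<le> pos_eigenvalue (S_op {- r..r} {- r..r}) n"
      by (rule pos_eigenvalue_lower_bound[OF \<rho> r3 n n2])
    also have "\<dots> = lam n c" by (simp add: lam_def r_def)
    finally show ?thesis by (simp add: n_def)
  qed
  show ?thesis
    using \<delta> main by (intro exI[of _ \<delta>] conjI exI[of _ "max c1 1"]) auto
qed

end
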